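(* Let $A_1=\mathbb{Z}\alpha$ with $(\alpha,\alpha)=2$, let $\varpi=\alpha/2$, let $V_{A_1}$ be the lattice vertex operator algebra and $V_{A_1^\circ}$ the lattice generalized vertex algebra (both described in the context), let $W\subset V_{A_1}$ be the vertex subalgebra generated by $e^\alpha$, and let $C=\{v\in V_{A_1}\mid [u(n),v(m)]=0 \text{ for all } u\in W,\ n,m\in\mathbb{Z}\}$ be the commutant of $W$ in $V_{A_1}$. For $n\geq 0$ put $\phi_n=e^\varpi(-n-3/2)e^\varpi(-n-1)\mathbf{1}$ and $S=\{\phi_n\mid n=0,1,2,\ldots\}$. Then $S\subset C$, $S$ strongly generates $C$, and $S$ is a minimal set of generators of $C$ in the sense that no proper subset of $S$ generates $C$.
   Context: Let $\mathfrak{h}=\mathbb{C}\otimes_{\mathbb{Z}}A_1$ with the induced bilinear form and $\widehat{\mathfrak{h}}=\mathfrak{h}[t,t^{-1}]\oplus\mathbb{C}K$ the Heisenberg Lie algebra, $[h_1(n_1),h_2(n_2)]=n_1(h_1,h_2)\delta_{n_1+n_2,0}K$ where $h(n)=ht^n$. For $\lambda\in A_1^\circ=\mathbb{Z}\varpi$, $M(1,\lambda)$ is the Fock module generated by $e^\lambda$ with $Ke^\lambda=e^\lambda$, $h(0)e^\lambda=(h,\lambda)e^\lambda$, $h(n)e^\lambda=0$ for $n\ge1$. For $\beta\in A_1^\circ$ the vertex operator is $e^\beta(z)=\exp\bigl(\sum_{n<0}\frac{\beta(n)}{-n}z^{-n}\bigr)\exp\bigl(\sum_{n>0}\frac{\beta(n)}{-n}z^{-n}\bigr)z^{\beta(0)}e_\beta$,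 where $e_\beta e^\lambda=e^{\beta+\lambda}$, $z^{\beta(0)}e^\lambda=z^{(\beta,\lambda)}e^\lambda$; write $e^\beta(z)=\sum_{n\in\frac12\mathbb{Z}}e^\beta(n)z^{-n-1}$. $V_{A_1}=\bigoplus_{n\in\mathbb{Z}}M(1,n\alpha)$ is the lattice vertex operator algebra with vacuum $\mathbf 1=e^0$, $Y(\varpi(-1)\mathbf1,z)=\sum\varpi(n)z^{-n-1}$, $Y(e^\beta,z)=e^\beta(z)$ ($\beta\in A_1$); $V_{A_1^\circ}=\bigoplus_{n\in\mathbb{Z}}M(1,n\varpi)$ is the analogous lattice generalized vertex algebra (fields with powers in $\frac12\mathbb{Z}$), containing $V_{A_1}$. For any element $v$, modes are defined by $Y(v,z)=\sum_n v(n)z^{-n-1}$. A subset $S\subset C$ generates $C$ if monomials $a_1(n_1)\cdots a_r(n_r)\mathbf1$ ($r\ge0$, $a_i\in S$, $n_i\in\mathbb{Z}$) span $C$; it strongly generates $C$ if those with all $n_i\le -1$ already span $C$.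
   Formalization: In the vertex operator, z^{β(0)} is applied before e_β (factor z^{(β,λ)} on e^λ); the order z^{β(0)}e_β as written would give z^{(β,β+λ)}, breaking the vacuum axiom and making every φ_n zero. *)

theory Defs
  imports Complex_Main "HOL-Library.Poly_Mapping"
begin

(* Concrete model of V_{A_1^o} = (+)_{m in Z} M(1, m varpi).
   A basis key (m,p) stands for  prod_i varpi(-(i+1))^(p i) e^{m varpi};
   a vector is a coefficient function on keys (finitely supported ones are the
   actual elements). Note (varpi,varpi) = 1/2, alpha = 2 varpi. *)

type_synonym key = "int \<times> (nat \<Rightarrow>\<^sub>0 nat)"
type_synonym vec = "key \<Rightarrow> complex"

definition fsupp :: "vec \<Rightarrow> bool" where
  "fsupp v \<longleftrightarrow> finite {k. v k \<noteq> 0}"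

definition delta :: "key \<Rightarrow> vec" where
  "delta k = (\<lambda>k'. if k' = k then 1 else 0)"

definition vacuum :: vec where
  "vacuum = delta (0, 0)"

definition lspan :: "vec set \<Rightarrow> vec set" where
  "lspan X = {v. \<exists>F c. finite F \<and> F \<subseteq> X \<and> v = (\<lambda>k. \<Sum>x\<in>F. c x * x k)}"

definition VA1dual :: "vec set" where
  "VA1dual = {v. fsupp v}"

definition VA1 :: "vec set" where
  "VA1 = {v. fsupp v \<and> (\<forall>m p. v (m, p) \<noteq> 0 \<longrightarrow> even m)}"

definition hm :: "int \<Rightarrow> vec \<Rightarrow> vec" where
  "hm n v = (if n < 0 then
       (\<lambda>(m, p). if Poly_Mapping.lookup p (nat (-n-1)) \<ge> 1
                  then v (m, p - Poly_Mapping.single (nat (-n-1)) 1) else 0)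
     else if n = 0 then (\<lambda>(m, p). of_int m / 2 * v (m, p))
     else (\<lambda>(m, p). of_int n / 2 * of_nat (Poly_Mapping.lookup p (nat (n-1)) + 1)
                      * v (m, p + Poly_Mapping.single (nat (n-1)) 1)))"

definition parts :: "nat \<Rightarrow> (nat \<Rightarrow>\<^sub>0 nat) set" where
  "parts a = {m. (\<Sum>i\<in>Poly_Mapping.keys m. (i+1) * Poly_Mapping.lookup m i) = a}"

(* coefficient of z^a in exp(sum_{i>=0} cf i * A i * z^(i+1)) for commuting operators A i *)
definition expcoef :: "(nat \<Rightarrow> vec \<Rightarrow> vec) \<Rightarrow> (nat \<Rightarrow> complex) \<Rightarrow> nat \<Rightarrow> vec \<Rightarrow> vec" where
  "expcoef A cf a v = (\<lambda>k. \<Sum>m\<in>parts a.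
      (\<Prod>i<a. cf i ^ Poly_Mapping.lookup m i / of_nat (fact (Poly_Mapping.lookup m i)))
      * (foldr (\<lambda>i f. (A i ^^ Poly_Mapping.lookup m i) \<circ> f) [0..<a] id) v k)"

(* E^-(j varpi, z) = exp(sum_{k>0} (j varpi)(-k) z^k / k), coefficient of z^a *)
definition Eminus :: "int \<Rightarrow> nat \<Rightarrow> vec \<Rightarrow> vec" where
  "Eminus j a = expcoef (\<lambda>i. hm (- int i - 1)) (\<lambda>i. of_int j / of_nat (i+1)) a"

(* E^+(j varpi, z) = exp(sum_{k>0} (j varpi)(k) z^(-k) / (-k)), coefficient of z^(-b) *)
definition Eplus :: "int \<Rightarrow> nat \<Rightarrow> vec \<Rightarrow> vec" where
  "Eplus j b = expcoef (\<lambda>i. hm (int i + 1)) (\<lambda>i. - of_int j / of_nat (i+1)) b"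

definition pdeg :: "(nat \<Rightarrow>\<^sub>0 nat) \<Rightarrow> nat" where
  "pdeg p = (\<Sum>i\<in>Poly_Mapping.keys p. (i+1) * Poly_Mapping.lookup p i)"

(* e^{j varpi}(n) with n = N/2, on a basis vector at key (m,p):
   e^beta(z) e^lambda-part = E^- E^+ e_beta z^{(beta,lambda)}, (beta,lambda) = j m / 2;
   coefficient of z^{-n-1}: a - b + j m/2 = -N/2 - 1. *)
definition ebasis :: "int \<Rightarrow> int \<Rightarrow> key \<Rightarrow> vec" where
  "ebasis j N k = (case k of (m, p) \<Rightarrow>
     (\<lambda>k'. \<Sum>b\<in>{0..pdeg p}.
        (let a2 = 2 * int b - j * m - N - 2 in
          if even a2 \<and> a2 \<ge> 0
          then Eminus j (nat (a2 div 2)) (Eplus j b (delta (m + j, p))) k'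
          else 0)))"

definition emode :: "int \<Rightarrow> int \<Rightarrow> vec \<Rightarrow> vec" where
  "emode j N v = (\<lambda>k'. \<Sum>k\<in>{k. v k \<noteq> 0}. v k * ebasis j N k k')"

definition evlim :: "(nat \<Rightarrow> vec) \<Rightarrow> vec" where
  "evlim f = (THE x. \<exists>N. \<forall>M\<ge>N. f M = x)"

(* Modes of the vertex operator Y(key, z) for basis states of V_{A_1}:
   Y(e^{m varpi}, z) = e^{m varpi}(z), and for v = varpi(-k) w the iterate formula
   (a_{-k} w)_n = sum_i (-1)^i binom(-k,i) (a_{-k-i} w_{n+i} - (-1)^{-k} w_{-k+n-i} a_i),
   a = varpi(-1) 1 with Y(a,z) = sum varpi(n) z^{-n-1}.  Recursion on a fuel counter. *)
primrec Yr :: "nat \<Rightarrow> key \<Rightarrow> int \<Rightarrow> vec \<Rightarrow> vec" where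
  "Yr 0 k n = (if snd k = 0 then emode (fst k) (2 * n) else (\<lambda>u. u))"
| "Yr (Suc r) k n = (if snd k = 0 then emode (fst k) (2 * n) else
     (let i = Min (Poly_Mapping.keys (snd k)); kk = int i + 1;
          w = (fst k, snd k - Poly_Mapping.single i 1)
      in (\<lambda>u. evlim (\<lambda>I. (\<lambda>k'. \<Sum>l\<le>I.
            (-1) ^ l * (of_int (- kk) gchoose l) *
            (hm (- kk - int l) (Yr r w (n + int l) u) k'
             - (-1) ^ nat kk * Yr r w (- kk + n - int l) (hm (int l) u) k'))))))"

definition Ybasis :: "key \<Rightarrow> int \<Rightarrow> vec \<Rightarrow> vec" where
  "Ybasis k n = Yr (\<Sum>i\<in>Poly_Mapping.keys (snd k). Poly_Mapping.lookup (snd k) i) k n"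

definition vmode :: "vec \<Rightarrow> int \<Rightarrow> vec \<Rightarrow> vec" where
  "vmode v n u = (\<lambda>k'. \<Sum>k\<in>{k. v k \<noteq> 0}. v k * Ybasis k n u k')"

definition vsubalg :: "vec set \<Rightarrow> bool" where
  "vsubalg U \<longleftrightarrow> U \<subseteq> VA1 \<and> lspan U \<subseteq> U \<and> vacuum \<in> U \<and>
     (\<forall>u\<in>U. \<forall>v\<in>U. \<forall>n. vmode u n v \<in> U)"

definition e_alpha :: vec where
  "e_alpha = delta (2, 0)"

definition Wsub :: "vec set" where
  "Wsub = \<Inter> {U. vsubalg U \<and> e_alpha \<in> U}"

definition Ccomm :: "vec set" where
  "Ccomm = {v \<in> VA1. \<forall>u\<in>Wsub. \<forall>n m. \<forall>w\<in>VA1.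
              vmode u n (vmode v m w) = vmode v m (vmode u n w)}"

(* phi_n = e^varpi(-n-3/2) e^varpi(-n-1) 1   (mode indices doubled) *)
definition phi :: "nat \<Rightarrow> vec" where
  "phi n = emode 1 (- 2 * int n - 3) (emode 1 (- 2 * int n - 2) vacuum)"

definition mono_apply :: "(vec \<times> int) list \<Rightarrow> vec" where
  "mono_apply l = foldr (\<lambda>(a, n) w. vmode a n w) l vacuum"

definition generates :: "vec set \<Rightarrow> vec set \<Rightarrow> bool" where
  "generates S C \<longleftrightarrow> lspan {mono_apply l | l. \<forall>(a, n)\<in>set l. a \<in> S} = C"

definition strongly_generates :: "vec set \<Rightarrow> vec set \<Rightarrow> bool" where
  "strongly_generates S C \<longleftrightarrow>
     lspan {mono_apply l | l. \<forall>(a, n)\<in>set l. a \<in> S \<and> n \<le> -1} = C"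

end

theory Submission
  imports Defs "HOL-Computational_Algebra.Formal_Laurent_Series"
begin

text \<open>Identify \<open>M(1, m\<varpi>)\<close> with a polynomial ring and write \<open>H(z) = exp (\<Sum>\<^sub>k \<varpi>(-k) z\<^sup>k / k)\<close> with
  coefficients \<open>h\<^sub>n\<close>. The commutant is explicit: its charge-\<open>m\<varpi>\<close> part consists of the polynomials of
  degree at most \<open>m\<close> in the \<open>h\<^sub>n\<close>. Indeed, the annihilation part of \<open>e\<^sup>\<alpha>(z)\<close> is the
  substitution \<open>h\<^sub>n \<mapsto> h\<^sub>n - h\<^bsub>n-1\<^esub> / z\<close>, so that \<open>e\<^sup>\<alpha>(n) v = 0\<close> for all \<open>n \<ge> 0\<close>
  bounds the degree, and conversely the field of a product of \<open>m\<close> coefficients \<open>h\<^sub>n\<close> is a normally ordered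
  product of \<open>m\<close> derivatives of \<open>e\<^sup>\<varpi>(z)\<close>, whose contraction with \<open>e\<^sup>\<alpha>(w)\<close> is
  \<open>(z - w)\<^sup>m\<close> and hence symmetric for even \<open>m\<close>.

  The states \<open>h\<^sub>a h\<^sub>b e\<^sup>\<alpha>\<close> span the part of charge \<open>\<alpha>\<close>, and modulo derivatives there is exactly one
  of them in each even weight \<open>a + b = 2n\<close>, represented by \<open>\<phi>\<^sub>n\<close>. Strong generation follows because
  \<open>(h\<^bsub>c+r\<^esub> h\<^bsub>d+r\<^esub> e\<^sup>\<alpha>)(-1)\<close> maps \<open>x e\<^bsup>r\<alpha>\<^esup>\<close> to \<open>h\<^sub>c h\<^sub>d x e\<^bsup>(r+1)\<alpha>\<^esup>\<close> up to terms in which \<open>x\<close> is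
  replaced by elements of smaller weight. Minimality holds because a monomial of charge \<open>\<alpha>\<close> is a single
  derivative of some \<open>\<phi>\<^sub>i\<close>, and the functional that vanishes on derivatives detects \<open>\<phi>\<^sub>n\<close> alone.\<close>

section \<open>The Fock space as a polynomial ring\<close>

text \<open>The modes of a general state are given only by the iterate formula, with limits of
  operators, a form unsuited to commutators. The way out is that normally ordered multiplication by
  h_k carries a vertex operator to its k-th Hasse derivative (\<open>NA_Hs\<close>). The states that
  matter are combinations of products of such coefficients, so their fields are normally ordered
  words in derivatives of one vertex operator, and these are reordered by a two-term rule.

  Outside the comparison with the model no exponential is expanded: creation parts, annihilation
  parts and contractions are all characterised by the recursion of a logarithmic derivative, and
  identities are proved by comparing recursions.

  Although e^varpi(z) has half-integral powers, only even m occur as charges m varpi in V_{A_1},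
  where z^{(varpi, m varpi)} = z^{m/2} is integral. Laurent series in one variable therefore
  suffice, a second variable being treated coefficient by coefficient. The square root (1 -
  w/z)^{1/2}, the contraction of e^varpi with itself, shows up in the coefficients of phi_n.\<close>

type_synonym pol = "(nat \<Rightarrow>\<^sub>0 nat) \<Rightarrow>\<^sub>0 complex"

abbreviation "lookup \<equiv> Poly_Mapping.lookup"
abbreviation "keys \<equiv> Poly_Mapping.keys"
abbreviation "single \<equiv> Poly_Mapping.single"

definition sc :: "complex \<Rightarrow> pol" where
  "sc c = single 0 c"

definition sg :: "nat \<Rightarrow> (nat \<Rightarrow>\<^sub>0 nat)" where
  "sg i = single i 1"

lemma lookup_sg: "lookup (sg i) j = (if i = j then 1 else 0)"
  by (simp add: sg_def lookup_single when_def)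

definition pvar :: "nat \<Rightarrow> pol" where
  "pvar i = single (sg i) 1"

lemma sc_simps [simp]:
  "sc 0 = 0" "sc 1 = 1" "sc (a + b) = sc a + sc b" "sc (a * b) = sc a * sc b"
  "sc (- a) = - sc a" "sc (a - b) = sc a - sc b" "sc (of_nat n) = of_nat n" "sc (of_int i) = of_int i"
  "sc (numeral k) = numeral k" "sc (a ^ n) = sc a ^ n"
proof -
  show *: "sc 0 = 0" "sc 1 = 1" "sc (a + b) = sc a + sc b" for a b
    by (simp_all add: sc_def single_add)
  show m: "sc (a * b) = sc a * sc b" for a b
    by (simp add: sc_def mult_single)
  show u: "sc (- a) = - sc a" for a
    by (simp add: sc_def single_uminus)
  show "sc (a - b) = sc a - sc b"
    by (simp add: sc_def single_diff)
  show "sc (of_nat n) = of_nat n" "sc (of_int i) = of_int i" "sc (numeral k) = numeral k"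
    by (simp_all add: sc_def)
  show "sc (a ^ n) = sc a ^ n"
    by (induction n) (simp_all add: * m)
qed

lemma sc_sum: "sc (sum f A) = (\<Sum>x\<in>A. sc (f x))"
  by (induction A rule: infinite_finite_induct) auto

lemma lookup_sc_mult [simp]: "lookup (sc c * f) p = c * lookup f p"
proof -
  have "sc c * f = Poly_Mapping.map ((*) c) f"
    by (simp add: sc_def mult_map_scale_conv_mult)
  thus ?thesis
    by (simp add: Poly_Mapping.map.rep_eq when_def)
qed

lemma lookup_sc: "lookup (sc c) p = (if p = 0 then c else 0)"
  by (auto simp: sc_def lookup_single when_def)

lemma sc_inverse_cancel [simp]: "c \<noteq> 0 \<Longrightarrow> sc (inverse c) * (sc c * f) = f"
  by (metis field_class.field_inverse mult.assoc mult_1 sc_simps(2) sc_simps(4))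

lemma sc_cancel: "c \<noteq> 0 \<Longrightarrow> sc c * f = sc c * g \<Longrightarrow> f = g"
  by (metis sc_inverse_cancel)

section \<open>Linear operators on the polynomial ring\<close>

definition linop :: "(pol \<Rightarrow> pol) \<Rightarrow> bool" where
  "linop L \<longleftrightarrow> (\<forall>f g. L (f + g) = L f + L g) \<and> (\<forall>c f. L (sc c * f) = sc c * L f)"

lemma linopI: "(\<And>f g. L (f + g) = L f + L g) \<Longrightarrow> (\<And>c f. L (sc c * f) = sc c * L f) \<Longrightarrow> linop L"
  by (simp add: linop_def)

lemma linopD:
  assumes "linop L"
  shows "L (f + g) = L f + L g" "L (sc c * f) = sc c * L f" "L 0 = 0" "L (- f) = - L f"
    "L (f - g) = L f - L g" "L (sum h A) = (\<Sum>x\<in>A. L (h x))"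
proof -
  show a: "L (f + g) = L f + L g" for f g using assms by (simp add: linop_def)
  show s: "L (sc c * f) = sc c * L f" for c f using assms by (simp add: linop_def)
  show z: "L 0 = 0" using s[of 0 0] by simp
  show u: "L (- f) = - L f" for f using s[of "-1" f] by simp
  show "L (f - g) = L f - L g" using a[of f "-g"] u[of g] by simp
  show "L (sum h A) = (\<Sum>x\<in>A. L (h x))"
    by (induction A rule: infinite_finite_induct) (auto simp: a z)
qed

lemma linop_id: "linop (\<lambda>f. f)" and linop_mult: "linop (\<lambda>f. h * f)" and linop_0: "linop (\<lambda>f. 0)"
  by (auto intro!: linopI simp: algebra_simps)

lemma linop_comp: "linop L \<Longrightarrow> linop M \<Longrightarrow> linop (\<lambda>f. L (M f))"
  by (simp add: linop_def)

lemma linop_add: "linop L \<Longrightarrow> linop M \<Longrightarrow> linop (\<lambda>f. L f + M f)"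
  by (simp add: linop_def algebra_simps)

lemma linop_sum: "(\<And>x. x \<in> A \<Longrightarrow> linop (L x)) \<Longrightarrow> linop (\<lambda>f. \<Sum>x\<in>A. L x f)"
  by (induction A rule: infinite_finite_induct) (auto intro: linop_0 linop_add)

lemma linop_scale: "linop L \<Longrightarrow> linop (\<lambda>f. h * L f)"
  by (rule linop_comp[OF linop_mult])

lemma poly_mapping_sum_singles:
  "f = (\<Sum>q\<in>keys f. single q (lookup f q))"
proof (rule poly_mapping_eqI)
  fix k
  show "lookup f k = lookup (\<Sum>q\<in>keys f.
          single q (lookup f q)) k"
    by (cases "k \<in> keys f")
       (auto simp: lookup_sum lookup_single when_def sum.delta in_keys_iff)
qed

lemma single_eq_sc: "single q c = sc c * single q 1"
  by (simp add: sc_def mult_single)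

lemma linop_eqI:
  assumes "linop L" "linop M" "\<And>p. L (single p 1) = M (single p 1)"
  shows "L f = M f"
proof -
  have "L (single p c) = M (single p c)" for p c
    by (subst (1 2) single_eq_sc) (simp add: linopD[OF assms(1)] linopD[OF assms(2)] assms(3))
  thus ?thesis
    by (subst (1 2) poly_mapping_sum_singles) (simp add: linopD[OF assms(1)] linopD[OF assms(2)])
qed

section \<open>Multiplication by a variable and partial derivatives\<close>

lemma minus_sg_add_sg: "lookup p i \<ge> 1 \<Longrightarrow> p - sg i + sg i = p"
  by (rule poly_mapping_eqI) (auto simp: lookup_add lookup_minus lookup_sg)

lemma lookup_pvar_mult:
  "lookup (pvar i * f) p =
     (if lookup p i \<ge> 1 then lookup f (p - sg i) else 0)"
proof -
  have eq: "(p = sg i + q) = (lookup p i \<ge> 1 \<and> q = p - sg i)" for q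
  proof
    assume "p = sg i + q"
    thus "lookup p i \<ge> 1 \<and> q = p - sg i"
      by (auto simp: lookup_add lookup_sg)
  next
    assume "lookup p i \<ge> 1 \<and> q = p - sg i"
    thus "p = sg i + q" using minus_sg_add_sg[of p i] by (simp add: add.commute)
  qed
  have "pvar i * f = (\<Sum>q\<in>keys f. single (sg i + q) (lookup f q))"
    by (subst poly_mapping_sum_singles[of f]) (simp add: sum_distrib_left pvar_def mult_single)
  hence "lookup (pvar i * f) p =
     (\<Sum>q\<in>keys f. if p = sg i + q then lookup f q else 0)"
    by (auto simp: lookup_sum lookup_single when_def intro!: sum.cong)
  also have "\<dots> = (if lookup p i \<ge> 1 then lookup f (p - sg i) else 0)"
    by (simp add: eq in_keys_iff)
  finally show ?thesis .
qed

lemma pvar_mult_single: "pvar i * single p c = single (p + sg i) c"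
  by (simp add: pvar_def mult_single add.commute)

text \<open>Given on coefficients, in the form in which \<open>hm\<close> acts for positive index,
  so that the comparison with the model is immediate.\<close>

definition pder :: "nat \<Rightarrow> pol \<Rightarrow> pol" where
  "pder i f = Abs_poly_mapping (\<lambda>p. of_nat (lookup p i + 1) * lookup f (p + sg i))"

lemma lookup_pder: "lookup (pder i f) p =
    of_nat (lookup p i + 1) * lookup f (p + sg i)"
proof -
  have "{p. of_nat (lookup p i + 1) * lookup f (p + sg i) \<noteq> 0}
      \<subseteq> (\<lambda>q. q - sg i) ` keys f"
    by (force simp: in_keys_iff image_iff)
  hence "finite {p. of_nat (lookup p i + 1) * lookup f (p + sg i) \<noteq> 0}"
    by (rule finite_subset) simp
  thus ?thesis
    by (simp add: pder_def)
qed

lemma linop_pder: "linop (pder i)"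
  by (intro linopI; rule poly_mapping_eqI) (simp_all add: lookup_pder lookup_add ring_distribs)

lemma pder_commute: "pder i (pder j f) = pder j (pder i f)"
proof (cases "i = j")
  case False
  show ?thesis
    by (rule poly_mapping_eqI) (use False in \<open>simp add: lookup_pder lookup_add lookup_sg add_ac\<close>)
qed simp

lemma pder_pvar_mult: "pder i (pvar j * f) = pvar j * pder i f + (if i = j then f else 0)"
proof (rule poly_mapping_eqI)
  fix p
  show "lookup (pder i (pvar j * f)) p =
        lookup (pvar j * pder i f + (if i = j then f else 0)) p"
  proof (cases "i = j")
    case True
    show ?thesis
    proof (cases "lookup p j \<ge> 1")
      case L: True
      have "lookup p j = Suc (lookup p j - 1)" using L by simp
      hence "complex_of_nat (lookup p j) = of_nat (lookup p j - 1) + 1"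
        by (metis of_nat_Suc add.commute)
      thus ?thesis using True L minus_sg_add_sg[OF L]
        by (simp add: lookup_pder lookup_pvar_mult lookup_add lookup_sg lookup_minus ring_distribs)
    next
      case False
      thus ?thesis using True by (simp add: lookup_pder lookup_pvar_mult lookup_add lookup_sg)
    qed
  next
    case False
    have "lookup p j \<ge> 1 \<Longrightarrow> p + sg i - sg j = p - sg j + sg i"
      by (rule poly_mapping_eqI) (auto simp: lookup_add lookup_minus lookup_sg False)
    thus ?thesis using False
      by (auto simp: lookup_pder lookup_pvar_mult lookup_add lookup_sg lookup_minus)
  qed
qed

lemma pder_sc [simp]: "pder i (sc c) = 0"
proof (rule poly_mapping_eqI)
  fix p
  have "lookup (p + sg i) i \<noteq> 0" by (simp add: lookup_add lookup_sg)
  hence "p + sg i \<noteq> 0" by (metis lookup_zero)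
  thus "lookup (pder i (sc c)) p = lookup 0 p"
    by (simp add: lookup_pder lookup_sc)
qed

lemma pder_1 [simp]: "pder i 1 = 0"
  using pder_sc[of i 1] by simp

subsection \<open>Weights\<close>

lemma pdeg_altdef: "finite A \<Longrightarrow> keys p \<subseteq> A \<Longrightarrow> pdeg p = (\<Sum>i\<in>A. (i+1) * lookup p i)"
  unfolding pdeg_def by (rule sum.mono_neutral_left) (auto simp: in_keys_iff)

lemma pdeg_add: "pdeg (p + q) = pdeg p + pdeg q"
proof -
  let ?A = "keys p \<union> keys q"
  have "keys (p + q) \<subseteq> ?A" by (rule keys_add)
  thus ?thesis
    by (simp add: pdeg_altdef[of ?A] lookup_add algebra_simps sum.distrib)
qed

lemma pdeg_sg [simp]: "pdeg (sg i) = i + 1"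
  by (simp add: pdeg_def sg_def)

lemma pdeg_0 [simp]: "pdeg 0 = 0"
  by (simp add: pdeg_def)

text \<open>The bound is an integer: lowering operators subtract from it freely, and a negative
  bound forces the polynomial to vanish (\<open>wle_neg\<close>). This is how sums of annihilation
  terms are cut off.\<close>

definition wle :: "int \<Rightarrow> pol \<Rightarrow> bool" where
  "wle d g \<longleftrightarrow> (\<forall>p. lookup g p \<noteq> 0 \<longrightarrow> int (pdeg p) \<le> d)"

lemma wle_0 [simp]: "wle d 0"
  by (simp add: wle_def)

lemma wle_add: "wle d f \<Longrightarrow> wle d g \<Longrightarrow> wle d (f + g)"
  unfolding wle_def lookup_add by (metis add.right_neutral)

lemma wle_sum: "(\<And>x. x \<in> A \<Longrightarrow> wle d (f x)) \<Longrightarrow> wle d (sum f A)"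
  by (induction A rule: infinite_finite_induct) (auto intro: wle_add)

lemma wle_sc_mult: "wle d f \<Longrightarrow> wle d (sc c * f)"
  by (auto simp: wle_def)

lemma wle_mono: "wle d f \<Longrightarrow> d \<le> e \<Longrightarrow> wle e f"
  unfolding wle_def by force

lemma wle_neg: "wle d f \<Longrightarrow> d < 0 \<Longrightarrow> f = 0"
  by (rule poly_mapping_eqI) (force simp: wle_def)

lemma wle_pder: "wle d f \<Longrightarrow> wle (d - int i - 1) (pder i f)"
  unfolding wle_def by (force simp: lookup_pder pdeg_add)

definition wt :: "pol \<Rightarrow> nat" where
  "wt g = Max (insert 0 (pdeg ` keys g))"

lemma wle_wt: "wle (int (wt g)) g"
  by (auto simp: wle_def wt_def in_keys_iff intro!: Max_ge)

lemma wt_le: "wle (int d) g \<Longrightarrow> wt g \<le> d"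
  by (auto simp: wle_def wt_def in_keys_iff)

section \<open>Creation and annihilation parts of the vertex operators\<close>

text \<open>\<^const>\<open>pvar\<close> \<open>i\<close> and \<open>ann i\<close> are \<open>\<varpi>(-i-1)\<close> and \<open>\<varpi>(i+1)\<close>. The coefficients \<open>Hs s n\<close> and \<open>Ep s b\<close> of
  the exponentials \<open>exp (s \<Sum>\<^sub>k \<varpi>(-k) z\<^sup>k / k)\<close> and \<open>exp (- s \<Sum>\<^sub>k \<varpi>(k) z\<^bsup>-k\<^esup> / k)\<close> are defined by the
  recursion coming from the logarithmic derivative.\<close>

definition ann :: "nat \<Rightarrow> pol \<Rightarrow> pol" where
  "ann i g = sc (of_nat (Suc i) / 2) * pder i g"

lemma linop_ann: "linop (ann i)"
  unfolding ann_def [abs_def] by (intro linop_scale linop_pder)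

lemmas annD = linopD[OF linop_ann]

lemma ann_commute: "ann i (ann j g) = ann j (ann i g)"
  by (simp add: ann_def linopD[OF linop_pder] pder_commute[of i j] mult.left_commute)

text \<open>The Heisenberg relation: [varpi(n), varpi(-n)] = n (varpi, varpi) = n/2 for n = i + 1,
  which is the source of the factor in \<open>ann\<close>.\<close>

lemma ann_pvar_mult:
  "ann i (pvar j * f) = pvar j * ann i f + (if i = j then sc (of_nat (Suc i) / 2) * f else 0)"
  by (simp add: ann_def pder_pvar_mult ring_distribs mult.left_commute)

lemma ann_sc [simp]: "ann i (sc c) = 0" and ann_1 [simp]: "ann i 1 = 0"
  by (simp_all add: ann_def)

lemma wle_ann: "wle d f \<Longrightarrow> wle (d - int i - 1) (ann i f)"
  unfolding ann_def by (intro wle_sc_mult wle_pder)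

fun Hs :: "int \<Rightarrow> nat \<Rightarrow> pol" where
  "Hs s 0 = 1"
| "Hs s (Suc n) = sc (of_int s / of_nat (Suc n)) * (\<Sum>i\<le>n. pvar i * Hs s (n - i))"

fun Ep :: "int \<Rightarrow> nat \<Rightarrow> pol \<Rightarrow> pol" where
  "Ep s 0 g = g"
| "Ep s (Suc b) g = sc (- of_int s / of_nat (Suc b)) * (\<Sum>i\<le>b. ann i (Ep s (b - i) g))"

text \<open>Contractions shift indices downwards; with the extension by zero to negative indices the
  crossing rules hold without case distinctions.\<close>

definition HZ :: "int \<Rightarrow> int \<Rightarrow> pol" where
  "HZ s c = (if c < 0 then 0 else Hs s (nat c))"

definition EZ :: "int \<Rightarrow> int \<Rightarrow> pol \<Rightarrow> pol" where
  "EZ s b g = (if b < 0 then 0 else Ep s (nat b) g)"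

lemma HZ_neg [simp]: "c < 0 \<Longrightarrow> HZ s c = 0" and HZ_0 [simp]: "HZ s 0 = 1"
  by (simp_all add: HZ_def)

lemma HZ_of_nat [simp]: "HZ s (int n) = Hs s n"
  by (simp add: HZ_def)

lemma EZ_neg [simp]: "b < 0 \<Longrightarrow> EZ s b g = 0" and EZ_0 [simp]: "EZ s 0 g = g"
  by (simp_all add: EZ_def)

lemma EZ_of_nat [simp]: "EZ s (int n) = Ep s n"
  by (simp add: EZ_def fun_eq_iff)

lemma of_nat_mult_sc_divide: "of_nat (Suc n) * (sc (a / of_nat (Suc n)) * x) = sc a * x"
proof -
  have "of_nat (Suc n) * (sc (a / of_nat (Suc n)) * x) = sc (of_nat (Suc n) * (a / of_nat (Suc n))) * x"
    by (simp only: sc_simps mult.assoc)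
  thus ?thesis by (simp del: of_nat_Suc sc_simps)
qed

lemma Hs_Suc: "of_nat (Suc n) * Hs s (Suc n) = of_int s * (\<Sum>i\<le>n. pvar i * Hs s (n - i))"
  unfolding Hs.simps of_nat_mult_sc_divide by simp

lemma Ep_Suc: "of_nat (Suc b) * Ep s (Suc b) g = - of_int s * (\<Sum>i\<le>b. ann i (Ep s (b - i) g))"
  unfolding Ep.simps of_nat_mult_sc_divide by simp

lemma sum_atMost_extend:
  fixes f :: "nat \<Rightarrow> 'a::comm_monoid_add"
  assumes "\<And>i. i > n \<Longrightarrow> i \<le> N \<Longrightarrow> f i = 0" "n \<le> N"
  shows "(\<Sum>i\<le>N. f i) = (\<Sum>i\<le>n. f i)"
  using assms by (intro sum.mono_neutral_right) auto

text \<open>The summation range may exceed the natural one, the surplus terms being zero; one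
  \<open>N\<close> can then serve all summands of a double sum.\<close>

lemma HZ_rec:
  assumes "c \<le> int N + 1"
  shows "of_int c * HZ s c = of_int s * (\<Sum>i\<le>N. pvar i * HZ s (c - 1 - int i))"
proof (cases "c \<le> 0")
  case True
  thus ?thesis by (cases "c = 0") auto
next
  case False
  then obtain n where c: "c = int (Suc n)" by (metis not_le gr0_implies_Suc zero_less_imp_eq_int)
  have "(\<Sum>i\<le>N. pvar i * HZ s (c - 1 - int i)) = (\<Sum>i\<le>n. pvar i * HZ s (c - 1 - int i))"
    using assms by (intro sum_atMost_extend) (auto simp: c)
  also have "\<dots> = (\<Sum>i\<le>n. pvar i * Hs s (n - i))"
    by (intro sum.cong) (auto simp: c HZ_def nat_diff_distrib')
  finally have *: "of_int s * (\<Sum>i\<le>N. pvar i * HZ s (c - 1 - int i)) = of_nat (Suc n) * Hs s (Suc n)"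
    by (simp only: Hs_Suc)
  have "of_int c * HZ s c = of_nat (Suc n) * Hs s (Suc n)"
    unfolding c HZ_of_nat by (simp del: of_nat_Suc Hs.simps)
  thus ?thesis by (simp only: *)
qed

lemma linop_Ep: "linop (Ep s b)"
proof (induction b rule: less_induct)
  case (less b)
  show ?case
  proof (cases b)
    case 0
    have "Ep s 0 = (\<lambda>g. g)" by (simp add: fun_eq_iff)
    thus ?thesis using 0 linop_id by simp
  next
    case (Suc c)
    have *: "Ep s (Suc c) = (\<lambda>g. sc (- of_int s / of_nat (Suc c)) * (\<Sum>i\<le>c. ann i (Ep s (c - i) g)))"
      by (simp only: Ep.simps fun_eq_iff) simp
    thus ?thesis
      unfolding Suc * by (intro linop_scale linop_sum linop_comp[OF linop_ann] less.IH) (simp add: Suc)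
  qed
qed

lemmas EpD = linopD[OF linop_Ep]

lemma linop_EZ: "linop (EZ s b)"
proof -
  have "EZ s b = (if b < 0 then (\<lambda>g. 0) else Ep s (nat b))"
    by (simp add: fun_eq_iff EZ_def)
  thus ?thesis using linop_0 linop_Ep by auto
qed

lemmas EZD = linopD[OF linop_EZ]

lemma EZ_rec:
  assumes "b \<le> int N + 1"
  shows "of_int b * EZ s b g = - of_int s * (\<Sum>i\<le>N. ann i (EZ s (b - 1 - int i) g))"
proof (cases "b \<le> 0")
  case True
  thus ?thesis by (cases "b = 0") (auto simp: annD)
next
  case False
  then obtain n where b: "b = int (Suc n)" by (metis not_le gr0_implies_Suc zero_less_imp_eq_int)
  have "(\<Sum>i\<le>N. ann i (EZ s (b - 1 - int i) g)) = (\<Sum>i\<le>n. ann i (EZ s (b - 1 - int i) g))"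
    using assms by (intro sum_atMost_extend) (auto simp: b annD)
  also have "\<dots> = (\<Sum>i\<le>n. ann i (Ep s (n - i) g))"
    by (intro sum.cong) (auto simp: b EZ_def nat_diff_distrib')
  finally have *: "- of_int s * (\<Sum>i\<le>N. ann i (EZ s (b - 1 - int i) g)) = of_nat (Suc n) * Ep s (Suc n) g"
    by (simp only: Ep_Suc)
  have "of_int b * EZ s b g = of_nat (Suc n) * Ep s (Suc n) g"
    unfolding b EZ_of_nat by (simp del: of_nat_Suc Ep.simps)
  thus ?thesis by (simp only: *)
qed

lemma wle_Ep: "wle d g \<Longrightarrow> wle (d - int b) (Ep s b g)"
proof (induction b rule: less_induct)
  case (less b)
  show ?case
  proof (cases b)
    case 0
    thus ?thesis using less.prems by simp
  next
    case (Suc c)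
    have "wle (d - int b) (ann i (Ep s (c - i) g))" if "i \<le> c" for i
    proof -
      have "wle (d - int (c - i)) (Ep s (c - i) g)"
        using less.IH[of "c - i"] less.prems that Suc by simp
      from wle_ann[OF this, of i] show ?thesis
        using that Suc by (simp add: algebra_simps of_nat_diff)
    qed
    thus ?thesis unfolding Suc Ep.simps by (intro wle_sc_mult wle_sum) auto
  qed
qed

lemma wle_EZ: "wle d g \<Longrightarrow> wle (d - b) (EZ s b g)"
  using wle_Ep[of d g "nat b" s] by (auto simp: EZ_def)

lemma Ep_eq_0: "wle d g \<Longrightarrow> d < int b \<Longrightarrow> Ep s b g = 0"
  using wle_Ep[of d g b s] wle_neg by auto

lemma EZ_eq_0: "wle d g \<Longrightarrow> d < b \<Longrightarrow> EZ s b g = 0"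
  using wle_EZ[of d g b s] wle_neg by auto

lemma ann_Ep: "ann i (Ep s b g) = Ep s b (ann i g)"
proof (induction b rule: less_induct)
  case (less b)
  show ?case
  proof (cases b)
    case (Suc c)
    show ?thesis
      unfolding Suc Ep.simps annD
      by (intro arg_cong2[of _ _ _ _ "(*)"] refl sum.cong)
         (use less Suc in \<open>auto simp: ann_commute[of i]\<close>)
  qed simp
qed

lemma Ep_commute: "Ep s b (Ep t c g) = Ep t c (Ep s b g)"
proof (induction b rule: less_induct)
  case (less b)
  show ?case
  proof (cases b)
    case (Suc c)
    show ?thesis
      unfolding Suc Ep.simps EpD
      by (intro arg_cong2[of _ _ _ _ "(*)"] refl sum.cong)
         (use less Suc in \<open>auto simp: ann_Ep[symmetric]\<close>)
  qed simp
qed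

lemma EZ_commute: "EZ s b (EZ t c g) = EZ t c (EZ s b g)"
  by (auto simp: EZ_def EpD Ep_commute[of s])

lemma Ep_sc: "Ep s b (sc c) = (if b = 0 then sc c else 0)"
proof -
  have "wle 0 (sc c)" by (auto simp: wle_def lookup_sc)
  thus ?thesis using Ep_eq_0[of 0 "sc c" b s] by (cases b) auto
qed

lemma Ep_1: "Ep s b 1 = (if b = 0 then 1 else 0)"
  using Ep_sc[of s b 1] by simp

lemma of_int_pol_cancel:
  fixes x y :: pol
  assumes "of_int c * x = of_int c * y" "c \<noteq> 0"
  shows "x = y"
  using sc_cancel[of "of_int c" x y] assms by simp

context
begin

private lemma aux:
  fixes x :: "'a::comm_ring"
  assumes "x * a = c * n"
  shows "- x * (P * A + a * E - c * B) = P * (- x * A) - c * (n * E) - c * (- x * B)"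
proof -
  have "x * (a * E) = c * (n * E)" using assms by (metis mult.assoc)
  thus ?thesis by (simp add: algebra_simps)
qed

text \<open>Conjugation by exp(- s sum_j varpi(j) z^(-j) / j) translates the generator varpi(-k-1)
  by the scalar - (s/2) z^(-k-1). Both sides, multiplied by b, are compared through their
  recursions.\<close>

lemma EZ_pvar_mult:
  "EZ s b (pvar k * y) = pvar k * EZ s b y - sc (of_int s / 2) * EZ s (b - int k - 1) y"
proof (induction b rule: measure_induct_rule[of nat])
  case (less b)
  show ?case
  proof (cases "b \<le> 0")
    case True
    thus ?thesis by (cases "b = 0") auto
  next
    case False
    define N where "N = nat b + k"
    let ?B = "\<lambda>b. \<Sum>i\<le>N. ann i (EZ s (b - 1 - int i) y)"
    have bN: "b \<le> int N + 1" "b - int k - 1 \<le> int N + 1" "b - 1 - int k \<le> int N"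
      using False by (auto simp: N_def)
    have "of_int b * EZ s b (pvar k * y) = - of_int s * (\<Sum>i\<le>N. ann i (EZ s (b - 1 - int i) (pvar k * y)))"
      by (rule EZ_rec[OF bN(1)])
    also have "(\<Sum>i\<le>N. ann i (EZ s (b - 1 - int i) (pvar k * y))) =
       (\<Sum>i\<le>N. ann i (pvar k * EZ s (b - 1 - int i) y - sc (of_int s / 2) * EZ s (b - 1 - int i - int k - 1) y))"
      by (intro sum.cong refl arg_cong[where f = "ann _"] less.IH) (use False in auto)
    also have "\<dots> = (\<Sum>i\<le>N. pvar k * ann i (EZ s (b - 1 - int i) y)
          + (if i = k then sc (of_nat (Suc i) / 2) * EZ s (b - 1 - int i) y else 0)
          - sc (of_int s / 2) * ann i (EZ s ((b - int k - 1) - 1 - int i) y))"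
      by (intro sum.cong refl) (simp add: annD ann_pvar_mult algebra_simps)
    also have "\<dots> = pvar k * ?B b
          + sc (of_nat (Suc k) / 2) * EZ s (b - 1 - int k) y
          - sc (of_int s / 2) * ?B (b - int k - 1)"
      by (simp add: sum.distrib sum_subtractf sum_distrib_left N_def)
    also have "- of_int s * \<dots> = pvar k * (- of_int s * ?B b)
          - sc (of_int s / 2) * (of_nat (Suc k) * EZ s (b - 1 - int k) y)
          - sc (of_int s / 2) * (- of_int s * ?B (b - int k - 1))"
    proof -
      have "of_int s * sc (of_nat (Suc k) / 2) = sc (of_int s / 2) * of_nat (Suc k)"
      proof -
        have "of_int s * sc (of_nat (Suc k) / 2) = sc (of_int s * (of_nat (Suc k) / 2))"
          by (simp only: sc_simps)
        also have "\<dots> = sc (of_int s / 2 * of_nat (Suc k))" by simp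
        finally show ?thesis by (simp only: sc_simps)
      qed
      thus ?thesis by (rule aux)
    qed
    also have "\<dots> = pvar k * (of_int b * EZ s b y)
          - sc (of_int s / 2) * (of_nat (Suc k) * EZ s (b - 1 - int k) y)
          - sc (of_int s / 2) * (of_int (b - int k - 1) * EZ s (b - int k - 1) y)"
      by (simp only: EZ_rec[OF bN(1)] EZ_rec[OF bN(2)])
    \<comment> \<open>The factors k + 1 from the commutator and b - k - 1 from the recursion add up
      to b.\<close>
    also have "\<dots> = of_int b * (pvar k * EZ s b y - sc (of_int s / 2) * EZ s (b - int k - 1) y)"
      by (simp add: algebra_simps)
    finally show ?thesis
      by (rule of_int_pol_cancel) (use False in auto)
  qed
qed

end

definition kap :: "complex \<Rightarrow> nat \<Rightarrow> complex" where
  "kap \<nu> i = (-1) ^ i * (\<nu> gchoose i)"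

lemma kap_0 [simp]: "kap \<nu> 0 = 1"
  by (simp add: kap_def)

text \<open>\<open>kap\<close> lists the coefficients of (1 - x)^nu, and this is its logarithmic
  derivative, - nu / (1 - x).\<close>

lemma kap_Suc: "of_nat (Suc e) * kap \<nu> (Suc e) = - \<nu> * (\<Sum>j\<le>e. kap \<nu> j)"
proof (induction e)
  case 0
  thus ?case by (simp add: kap_def)
next
  case (Suc e)
  have a: "of_nat (Suc e) * (\<nu> gchoose Suc e) = \<nu> * (\<nu> - 1 gchoose e)" for e
    by (metis gbinomial_absorption)
  have "of_nat (Suc (Suc e)) * kap \<nu> (Suc (Suc e)) - of_nat (Suc e) * kap \<nu> (Suc e)
      = (-1) ^ e * (of_nat (Suc (Suc e)) * (\<nu> gchoose Suc (Suc e)) + of_nat (Suc e) * (\<nu> gchoose Suc e))"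
    by (simp add: kap_def algebra_simps)
  also have "\<dots> = (-1) ^ e * \<nu> * ((\<nu> - 1 gchoose Suc e) + (\<nu> - 1 gchoose e))"
    by (simp only: a) (simp add: algebra_simps)
  also have "(\<nu> - 1 gchoose Suc e) + (\<nu> - 1 gchoose e) = (\<nu> gchoose Suc e)"
    using gbinomial_Suc_Suc[of "\<nu> - 1" e] by simp
  finally have "of_nat (Suc (Suc e)) * kap \<nu> (Suc (Suc e)) = of_nat (Suc e) * kap \<nu> (Suc e) - \<nu> * kap \<nu> (Suc e)"
    by (simp add: kap_def algebra_simps)
  thus ?case by (simp only: Suc sum.atMost_Suc) (simp add: algebra_simps)
qed

lemma kap_1: "kap 1 i = (if i = 0 then 1 else if i = 1 then -1 else 0)"
proof -
  have "(1::complex) gchoose i = of_nat (1 choose i)"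
    by (metis binomial_gbinomial of_nat_1)
  thus ?thesis
    by (auto simp: kap_def binomial_eq_0)
qed

lemma sum_sum_conv:
  fixes f :: "nat \<Rightarrow> nat \<Rightarrow> 'a::comm_monoid_add"
  assumes "\<And>i j. i + j > N \<Longrightarrow> f i j = 0"
  shows "(\<Sum>i\<le>N. \<Sum>j\<le>N. f i j) = (\<Sum>e\<le>N. \<Sum>j\<le>e. f (e - j) j)"
proof -
  have "(\<Sum>i\<le>N. \<Sum>j\<le>N. f i j) = (\<Sum>(i,j)\<in>{..N}\<times>{..N}. f i j)"
    by (simp add: sum.cartesian_product)
  also have "\<dots> = (\<Sum>(i,j)\<in>{(i,j). i + j \<le> N}. f i j)"
    by (rule sum.mono_neutral_right) (use assms in \<open>force+\<close>)
  also have "\<dots> = (\<Sum>(j,i)\<in>{(j,i). j + i \<le> N}. f i j)"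
    by (rule sum.reindex_bij_witness[of _ prod.swap prod.swap]) auto
  also have "\<dots> = (\<Sum>e\<le>N. \<Sum>j\<le>e. f (e - j) j)"
    by (rule sum.triangle_reindex_eq)
  finally show ?thesis .
qed

text \<open>The contraction of two exponentials: \<open>H\<^sup>t(w)\<close> is an eigenvector of the annihilation part up to
  the factor \<open>(1 - w/z)\<^bsup>st/2\<^esup>\<close>, whose coefficients are \<^term>\<open>kap (of_int (s * t) / 2)\<close>.\<close>

lemma EZ_HZ:
  assumes "c \<le> int N"
  shows "EZ s b (HZ t c * y) =
    (\<Sum>i\<le>N. sc (kap (of_int (s * t) / 2) i) * (HZ t (c - int i) * EZ s (b - int i) y))"
  using assms
proof (induction c arbitrary: b rule: measure_induct_rule[of nat])
  case (less c)
  define \<nu> where "\<nu> = (of_int (s * t) / 2 :: complex)"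
  consider "c < 0" | "c = 0" | "c > 0" by linarith
  thus ?case
  proof cases
    case 1
    thus ?thesis by (simp add: EZD)
  next
    case 2
    have "(\<Sum>i\<le>N. sc (kap (of_int (s * t) / 2) i) * (HZ t (c - int i) * EZ s (b - int i) y)) =
          (\<Sum>i\<le>N. if i = 0 then EZ s b y else 0)"
      by (intro sum.cong) (auto simp: 2)
    thus ?thesis using 2 by simp
  next
    case 3
    let ?A = "\<lambda>c. \<Sum>i\<le>N. pvar i * HZ t (c - 1 - int i)"
    let ?k = "\<lambda>e. \<Sum>j\<le>e. kap \<nu> j"
    define Z where "Z = (\<lambda>e. HZ t (c - int e) * EZ s (b - int e) y)"
    have Z0: "Z e = 0" if "e > N" for e
      using that less.prems by (simp add: Z_def)
    have cN: "c \<le> int N + 1" using less.prems by simp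
    have "of_int c * EZ s b (HZ t c * y) = EZ s b (of_int c * HZ t c * y)"
      using EZD(2)[of s b "of_int c" "HZ t c * y"] by (simp add: mult.assoc)
    also have "of_int c * HZ t c * y = of_int t * (\<Sum>i\<le>N. pvar i * (HZ t (c - 1 - int i) * y))"
      by (simp only: HZ_rec[OF cN]) (simp add: sum_distrib_left sum_distrib_right mult.assoc)
    also have "EZ s b \<dots> = of_int t * (\<Sum>i\<le>N. EZ s b (pvar i * (HZ t (c - 1 - int i) * y)))"
      using EZD(2)[of s b "of_int t"] by (simp add: EZD)
    also have "(\<Sum>i\<le>N. EZ s b (pvar i * (HZ t (c - 1 - int i) * y))) =
       (\<Sum>i\<le>N. pvar i * EZ s b (HZ t (c - 1 - int i) * y)
               - sc (of_int s / 2) * EZ s (b - int i - 1) (HZ t (c - 1 - int i) * y))"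
      by (simp add: EZ_pvar_mult)
    also have "\<dots> = (\<Sum>i\<le>N. pvar i * (\<Sum>j\<le>N. sc (kap \<nu> j) * (HZ t (c - 1 - int i - int j) * EZ s (b - int j) y))
        - sc (of_int s / 2) * (\<Sum>j\<le>N. sc (kap \<nu> j) *
            (HZ t (c - 1 - int i - int j) * EZ s (b - int i - 1 - int j) y)))"
      unfolding \<nu>_def
      by (intro sum.cong refl arg_cong2[of _ _ _ _ "(-)"] arg_cong2[of _ _ _ _ "(*)"] less.IH)
         (use 3 less.prems in auto)
    also have "\<dots> = (\<Sum>j\<le>N. sc (kap \<nu> j) * (?A (c - int j) * EZ s (b - int j) y))
        - sc (of_int s / 2) * (\<Sum>i\<le>N. \<Sum>j\<le>N. sc (kap \<nu> j) * Z (Suc (i + j)))"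
    proof -
      have "(\<Sum>i\<le>N. pvar i * (\<Sum>j\<le>N. sc (kap \<nu> j) * (HZ t (c - 1 - int i - int j) * EZ s (b - int j) y)))
         = (\<Sum>i\<le>N. \<Sum>j\<le>N. pvar i * (sc (kap \<nu> j) * (HZ t (c - int j - 1 - int i) * EZ s (b - int j) y)))"
        by (simp add: sum_distrib_left algebra_simps)
      also have "\<dots> = (\<Sum>j\<le>N. \<Sum>i\<le>N. pvar i * (sc (kap \<nu> j) * (HZ t (c - int j - 1 - int i) * EZ s (b - int j) y)))"
        by (rule sum.swap)
      also have "\<dots> = (\<Sum>j\<le>N. sc (kap \<nu> j) * (?A (c - int j) * EZ s (b - int j) y))"
        by (simp add: sum_distrib_left sum_distrib_right mult_ac)
      finally have 1: "(\<Sum>i\<le>N. pvar i * (\<Sum>j\<le>N. sc (kap \<nu> j) * (HZ t (c - 1 - int i - int j) * EZ s (b - int j) y))) = \<dots>" .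
      have 2: "(\<Sum>i\<le>N. sc (of_int s / 2) * (\<Sum>j\<le>N. sc (kap \<nu> j) *
            (HZ t (c - 1 - int i - int j) * EZ s (b - int i - 1 - int j) y))) =
          sc (of_int s / 2) * (\<Sum>i\<le>N. \<Sum>j\<le>N. sc (kap \<nu> j) * Z (Suc (i + j)))"
        by (simp add: sum_distrib_left Z_def algebra_simps)
      show ?thesis by (simp only: sum_subtractf 1 2)
    qed
    \<comment> \<open>Summation along i + j = e produces the partial sums of \<open>kap\<close>, to
      which \<open>kap_Suc\<close> applies.\<close>
    also have "(\<Sum>i\<le>N. \<Sum>j\<le>N. sc (kap \<nu> j) * Z (Suc (i + j))) =
        (\<Sum>e\<le>N. \<Sum>j\<le>e. sc (kap \<nu> j) * Z (Suc e))"
      by (subst sum_sum_conv) (auto simp: Z0 intro!: sum.cong)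
    also have "\<dots> = (\<Sum>e\<le>N. sc (?k e) * Z (Suc e))"
      by (simp add: sc_sum sum_distrib_right)
    also have "of_int t * ((\<Sum>j\<le>N. sc (kap \<nu> j) * (?A (c - int j) * EZ s (b - int j) y))
        - sc (of_int s / 2) * (\<Sum>e\<le>N. sc (?k e) * Z (Suc e))) =
        (\<Sum>j\<le>N. sc (kap \<nu> j) * ((of_int t * ?A (c - int j)) * EZ s (b - int j) y))
        - (\<Sum>e\<le>N. sc (\<nu> * (?k e)) * Z (Suc e))"
    proof -
      have "sc \<nu> = of_int t * sc (of_int s / 2)"
      proof -
        have "\<nu> = of_int t * (of_int s / 2)" by (simp add: \<nu>_def)
        thus ?thesis by (simp only: sc_simps)
      qed
      hence 2: "of_int t * (sc (of_int s / 2) * (\<Sum>e\<le>N. sc (?k e) * Z (Suc e))) =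
          (\<Sum>e\<le>N. sc (\<nu> * (?k e)) * Z (Suc e))"
        by (simp only: sc_simps mult.assoc[symmetric] sum_distrib_left[of "_ * _"])
      have 1: "of_int t * (\<Sum>j\<le>N. sc (kap \<nu> j) * (A j * E j)) =
          (\<Sum>j\<le>N. sc (kap \<nu> j) * ((of_int t * A j) * E j))" for A E :: "nat \<Rightarrow> pol"
        by (subst sum_distrib_left) (intro sum.cong refl, simp only: mult_ac)
      show ?thesis unfolding right_diff_distrib 1 2 ..
    qed
    also have "\<dots> = (\<Sum>j\<le>N. sc (kap \<nu> j) * ((of_int (c - int j) * HZ t (c - int j)) * EZ s (b - int j) y))
        + (\<Sum>e\<le>N. sc (of_nat (Suc e) * kap \<nu> (Suc e)) * Z (Suc e))"
    proof -
      have "of_int t * ?A (c - int j) = of_int (c - int j) * HZ t (c - int j)" for j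
        using HZ_rec[of "c - int j" N t] less.prems by simp
      moreover have "(\<Sum>e\<le>N. sc (\<nu> * (?k e)) * Z (Suc e)) =
         - (\<Sum>e\<le>N. sc (of_nat (Suc e) * kap \<nu> (Suc e)) * Z (Suc e))"
        by (simp only: kap_Suc) (simp add: sum_negf[symmetric])
      ultimately show ?thesis by simp
    qed
    also have "(\<Sum>e\<le>N. sc (of_nat (Suc e) * kap \<nu> (Suc e)) * Z (Suc e)) =
        (\<Sum>e\<le>Suc N. sc (of_nat e * kap \<nu> e) * Z e)"
      by (subst sum.atMost_Suc_shift) simp
    also have "\<dots> = (\<Sum>e\<le>N. sc (of_nat e * kap \<nu> e) * Z e)"
      by (simp add: Z0)
    \<comment> \<open>The weights c - j from the recursion of \<open>HZ\<close> and j from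
      \<open>kap_Suc\<close> add up to c, which is cancelled at the end.\<close>
    also have "(\<Sum>j\<le>N. sc (kap \<nu> j) * ((of_int (c - int j) * HZ t (c - int j)) * EZ s (b - int j) y)) + \<dots> =
        of_int c * (\<Sum>j\<le>N. sc (kap \<nu> j) * Z j)"
      by (simp add: sum_distrib_left Z_def algebra_simps flip: sum.distrib)
    finally show ?thesis
      unfolding Z_def \<nu>_def by (rule of_int_pol_cancel) (use 3 in auto)
  qed
qed

text \<open>The two charges have inner product 1, so the contraction 1 - w/z has only two terms.
  This is the case that governs the commutation with e^alpha.\<close>

lemma EZ_HZ_cross:
  assumes "s * t = 2"
  shows "EZ s b (HZ t c * y) = HZ t c * EZ s b y - HZ t (c - 1) * EZ s (b - 1) y"
proof -
  have \<nu>: "(of_int (s * t) / 2 :: complex) = 1" by (simp only: assms) simp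
  define N where "N = Suc (nat c)"
  have "EZ s b (HZ t c * y) = (\<Sum>i\<le>N. sc (kap 1 i) * (HZ t (c - int i) * EZ s (b - int i) y))"
    by (subst EZ_HZ[of c N]) (simp_all only: \<nu>, simp add: N_def)
  also have "\<dots> = (\<Sum>i\<in>{0,1}. sc (kap 1 i) * (HZ t (c - int i) * EZ s (b - int i) y))"
    by (rule sum.mono_neutral_right) (auto simp: kap_1 N_def)
  finally show ?thesis by (simp add: kap_1)
qed

section \<open>Composition of annihilation exponentials\<close>

lemma convolution_Suc:
  fixes x :: "nat \<Rightarrow> nat \<Rightarrow> 'a::comm_semiring_1"
  shows "of_nat (Suc n) * (\<Sum>c\<le>Suc n. x c (Suc n - c)) =
    (\<Sum>c\<le>n. of_nat (Suc c) * x (Suc c) (n - c)) + (\<Sum>c\<le>n. of_nat (Suc n - c) * x c (Suc n - c))"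
proof -
  have "of_nat (Suc n) * (\<Sum>c\<le>Suc n. x c (Suc n - c)) =
     (\<Sum>c\<le>Suc n. of_nat c * x c (Suc n - c) + of_nat (Suc n - c) * x c (Suc n - c))"
    unfolding sum_distrib_left
    by (intro sum.cong refl) (simp flip: distrib_right of_nat_add del: of_nat_Suc)
  also have "\<dots> = (\<Sum>c\<le>Suc n. of_nat c * x c (Suc n - c)) + (\<Sum>c\<le>Suc n. of_nat (Suc n - c) * x c (Suc n - c))"
    by (rule sum.distrib)
  also have "(\<Sum>c\<le>Suc n. of_nat c * x c (Suc n - c)) = (\<Sum>c\<le>n. of_nat (Suc c) * x (Suc c) (n - c))"
    by (subst sum.atMost_Suc_shift) simp
  also have "(\<Sum>c\<le>Suc n. of_nat (Suc n - c) * x c (Suc n - c)) = (\<Sum>c\<le>n. of_nat (Suc n - c) * x c (Suc n - c))"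
    by simp
  finally show ?thesis .
qed

lemma of_nat_pol_cancel:
  fixes x y :: pol
  assumes "of_nat (Suc c) * x = of_nat (Suc c) * y"
  shows "x = y"
  using of_int_pol_cancel[of "int (Suc c)" x y] assms by (simp del: of_nat_Suc add: of_int_of_nat_eq)

text \<open>Exponents add because annihilation operators commute: by \<open>convolution_Suc\<close>,
  a Leibniz rule, the convolution satisfies the recursion of \<open>Ep (s + t)\<close>.\<close>

lemma Ep_add: "Ep (s + t) n g = (\<Sum>c\<le>n. Ep s c (Ep t (n - c) g))"
proof (induction n rule: less_induct)
  case (less n)
  show ?case
  proof (cases n)
    case (Suc k)
    have IH: "Ep (s + t) (k - i) g = (\<Sum>c\<le>k - i. Ep s c (Ep t (k - i - c) g))" for i
      using less Suc by simp
    define B where "B = (\<Sum>i\<le>k. \<Sum>c\<le>k - i. ann i (Ep s c (Ep t (k - i - c) g)))"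
    have 0: "of_nat (Suc k) * (\<Sum>c\<le>Suc k. Ep s c (Ep t (Suc k - c) g)) =
      (\<Sum>c\<le>k. of_nat (Suc c) * Ep s (Suc c) (Ep t (k - c) g)) +
      (\<Sum>c\<le>k. of_nat (Suc (k - c)) * Ep s c (Ep t (Suc (k - c)) g))"
      by (subst convolution_Suc) (simp add: Suc_diff_le del: of_nat_Suc Ep.simps)
    have "(\<Sum>c\<le>k. \<Sum>i\<le>c. ann i (Ep s (c - i) (Ep t (k - c) g))) = B"
      unfolding B_def sum.Sigma[OF finite_atMost ballI[OF finite_atMost]]
      by (rule sum.reindex_bij_witness[of _ "\<lambda>(i,c). (c + i, i)" "\<lambda>(c,i). (i, c - i)"]) auto
    hence 1: "(\<Sum>c\<le>k. of_nat (Suc c) * Ep s (Suc c) (Ep t (k - c) g)) = - of_int s * B"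
      by (simp only: Ep_Suc sum_distrib_left[symmetric])
    have "of_nat (Suc n) * Ep s c x = Ep s c (of_nat (Suc n) * x)" for n c x
      using EpD(2)[of s c "of_nat (Suc n)" x] by (simp only: sc_simps)
    hence "of_nat (Suc n) * Ep s c (Ep t (Suc n) g) = - of_int t * (\<Sum>i\<le>n. ann i (Ep s c (Ep t (n - i) g)))" for n c
      using EpD(2)[of s c "- of_int t"] by (simp only: Ep_Suc sc_simps EpD ann_Ep)
    hence "(\<Sum>c\<le>k. of_nat (Suc (k - c)) * Ep s c (Ep t (Suc (k - c)) g)) =
        - of_int t * (\<Sum>c\<le>k. \<Sum>i\<le>k - c. ann i (Ep s c (Ep t (k - c - i) g)))"
      by (simp only: sum_distrib_left[symmetric])
    moreover have "(\<Sum>c\<le>k. \<Sum>i\<le>k - c. ann i (Ep s c (Ep t (k - c - i) g))) = B"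
      unfolding B_def sum.Sigma[OF finite_atMost ballI[OF finite_atMost]]
      by (rule sum.reindex_bij_witness[of _ prod.swap prod.swap]) (auto simp: add.commute)
    ultimately have 2: "(\<Sum>c\<le>k. of_nat (Suc (k - c)) * Ep s c (Ep t (Suc (k - c)) g)) = - of_int t * B"
      by (simp only:)
    have "of_nat (Suc k) * Ep (s + t) (Suc k) g = - of_int (s + t) * B"
      unfolding Ep_Suc IH B_def annD(6) ..
    also have "\<dots> = - of_int s * B + - of_int t * B"
      by (simp add: algebra_simps)
    finally have "of_nat (Suc k) * Ep (s + t) (Suc k) g =
        of_nat (Suc k) * (\<Sum>c\<le>Suc k. Ep s c (Ep t (Suc k - c) g))"
      by (simp only: 0 1 2)
    thus ?thesis
      unfolding Suc by (rule of_nat_pol_cancel)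
  qed simp
qed

section \<open>Hasse derivatives of Laurent series\<close>

type_synonym ser = "pol fls"

abbreviation C :: "complex \<Rightarrow> ser" where
  "C c \<equiv> fls_const (sc c)"

lemma fls_times_nth_bounds:
  fixes F G :: ser
  assumes "\<And>i. i < a \<Longrightarrow> fls_nth F i = 0" "\<And>i. i < b \<Longrightarrow> fls_nth G i = 0"
  shows "fls_nth (F * G) n = (\<Sum>i\<in>{a..n - b}. fls_nth F i * fls_nth G (n - i))"
proof -
  define df dg where "df = fls_subdegree F" and "dg = fls_subdegree G"
  have "fls_nth (F * G) n = (\<Sum>i=df..n - dg. fls_nth F i * fls_nth G (n - i))"
    unfolding df_def dg_def by (rule fls_times_nth(2))
  also have "\<dots> = (\<Sum>i\<in>{a..n - b}. fls_nth F i * fls_nth G (n - i))"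
  proof (rule sum.mono_neutral_cong)
    fix i assume "i \<in> {a..n - b} - {df..n - dg}"
    hence "i < df \<or> n - i < dg" by auto
    thus "fls_nth F i * fls_nth G (n - i) = 0" unfolding df_def dg_def by auto
  next
    fix i assume "i \<in> {df..n - dg} - {a..n - b}"
    hence "i < a \<or> n - i < b" by auto
    thus "fls_nth F i * fls_nth G (n - i) = 0" using assms by auto
  qed auto
  finally show ?thesis .
qed

text \<open>The operator D^k / k!. The divided power makes h_k, rather than k! h_k, the constant
  term of the k-th derivative of H(z).\<close>

definition hasse :: "nat \<Rightarrow> ser \<Rightarrow> ser" where
  "hasse k F = Abs_fls (\<lambda>n. sc ((of_int n + of_nat k) gchoose k) * fls_nth F (n + int k))"

lemma hasse_nth [simp]: "fls_nth (hasse k F) n = sc ((of_int n + of_nat k) gchoose k) * fls_nth F (n + int k)"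
proof -
  obtain N where "\<forall>n<N. fls_nth F n = 0" by (elim fls_nth_vanishes_belowE)
  hence "\<forall>n<N - int k. sc ((of_int n + of_nat k) gchoose k) * fls_nth F (n + int k) = 0" by auto
  thus ?thesis unfolding hasse_def by (rule nth_Abs_fls_lower_bound)
qed

text \<open>Differentiation creates no pole: the binomial coefficient of b over k vanishes for 0 <=
  b < k.\<close>

lemma hasse_low:
  assumes "\<And>n. n < 0 \<Longrightarrow> fls_nth F n = 0" "a < 0"
  shows "fls_nth (hasse k F) a = 0"
proof (cases "a + int k < 0")
  case False
  define b where "b = nat (a + int k)"
  have b: "a + int k = int b" "b < k" using assms(2) False by (auto simp: b_def)
  have "(of_int a + of_nat k :: complex) = of_nat b" using b(1) by (metis of_int_add of_int_of_nat_eq)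
  hence "((of_int a + of_nat k :: complex) gchoose k) = 0" using b(2) by (simp flip: binomial_gbinomial)
  thus ?thesis by simp
qed (simp add: assms(1))

lemma hasse_0 [simp]: "hasse 0 F = F"
  by (rule fls_eqI) simp

lemma hasse_add: "hasse k (F + G) = hasse k F + hasse k G"
  by (rule fls_eqI) (simp add: ring_distribs)

lemma C_nth_mult: "fls_nth (C c * F) n = sc c * fls_nth F n"
  by (simp add: fls_mult_const_nth)

lemma hasse_of_int_mult: "hasse k (of_int c * F) = of_int c * hasse k F"
  by (rule fls_eqI) (simp add: mult_ac)

lemma hasse_Suc: "of_nat (Suc k) * hasse (Suc k) F = hasse k (fls_deriv F)"
proof (rule fls_eqI)
  fix n :: int
  have e: "of_nat (Suc k) * ((a::complex) gchoose Suc k) = (a - 1 gchoose k) * a" for a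
    by (metis gbinomial_absorption mult.commute)
  have "sc (of_nat (Suc k)) * sc ((of_int n + of_nat (Suc k)) gchoose (Suc k)) =
    sc ((of_int n + of_nat k) gchoose k) * sc (of_int (n + int k + 1))"
    unfolding sc_simps(4)[symmetric] e by (simp add: algebra_simps)
  thus "fls_nth (of_nat (Suc k) * hasse (Suc k) F) n = fls_nth (hasse k (fls_deriv F)) n"
    unfolding hasse_nth fls_deriv_nth fls_mult_of_nat_nth mult.assoc[symmetric]
    by (simp only: sc_simps) (simp add: algebra_simps)
qed

lemma of_nat_ser_cancel:
  fixes x y :: ser
  assumes "of_nat (Suc c) * x = of_nat (Suc c) * y"
  shows "x = y"
proof (rule fls_eqI)
  fix n
  have "fls_nth (of_nat (Suc c) * x) n = fls_nth (of_nat (Suc c) * y) n" by (simp only: assms)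
  hence "sc (of_nat (Suc c)) * fls_nth x n = sc (of_nat (Suc c)) * fls_nth y n"
    by (simp only: fls_mult_of_nat_nth sc_simps)
  thus "fls_nth x n = fls_nth y n"
    by (rule sc_cancel[rotated]) (simp del: of_nat_Suc)
qed

lemma hasse_mult: "hasse k (F * G) = (\<Sum>j\<le>k. hasse j F * hasse (k - j) G)"
proof (induction k arbitrary: F G)
  case (Suc k)
  have "of_nat (Suc k) * hasse (Suc k) (F * G) = hasse k (fls_deriv F * G) + hasse k (F * fls_deriv G)"
    unfolding hasse_Suc by (simp add: hasse_add add.commute)
  also have "\<dots> = (\<Sum>j\<le>k. (of_nat (Suc j) * hasse (Suc j) F) * hasse (k - j) G) +
     (\<Sum>j\<le>k. hasse j F * (of_nat (Suc (k - j)) * hasse (Suc (k - j)) G))"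
    unfolding Suc hasse_Suc ..
  also have "\<dots> = of_nat (Suc k) * (\<Sum>j\<le>Suc k. hasse j F * hasse (Suc k - j) G)"
    by (subst convolution_Suc[of k "\<lambda>j l. hasse j F * hasse l G"],
        intro arg_cong2[of _ _ _ _ "(+)"] sum.cong refl) (auto simp: Suc_diff_le mult_ac)
  finally show ?case by (rule of_nat_ser_cancel)
qed simp

section \<open>Generating series of the creation operators\<close>

definition Aser :: ser where
  "Aser = fps_to_fls (Abs_fps pvar)"

definition Hser :: "int \<Rightarrow> ser" where
  "Hser s = fps_to_fls (Abs_fps (Hs s))"

abbreviation Xp :: "int \<Rightarrow> ser" where
  "Xp q \<equiv> fls_X_intpow q"

lemma Hser_nth [simp]: "fls_nth (Hser s) n = HZ s n"
  by (simp add: Hser_def HZ_def)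

lemma deriv_Hser: "fls_deriv (Hser s) = of_int s * (Aser * Hser s)"
proof -
  have "fps_deriv (Abs_fps (Hs s)) = of_int s * (Abs_fps pvar * Abs_fps (Hs s))"
  proof (rule fps_ext)
    fix n
    have i: "fps_nth (of_int s * F) n = of_int s * fps_nth F n" for F :: "pol fps"
      by (metis fps_mult_left_const_nth fps_of_int)
    show "fps_nth (fps_deriv (Abs_fps (Hs s))) n = fps_nth (of_int s * (Abs_fps pvar * Abs_fps (Hs s))) n"
      unfolding i using Hs_Suc[of n s] by (simp add: fps_mult_nth atLeast0AtMost del: Hs.simps)
  qed
  thus ?thesis
    by (simp add: Hser_def Aser_def fls_deriv_fps_to_fls fls_times_fps_to_fls fps_to_fls_of_int)
qed

text \<open>A first-order linear equation determines its power series solution from the constant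
  term; used to recognise products and the unit among the \<open>Hser\<close>.\<close>

lemma Hser_unique:
  assumes "fls_deriv F = of_int s * (Aser * F)" "fls_nth F 0 = 1" "\<And>n. n < 0 \<Longrightarrow> fls_nth F n = 0"
  shows "F = Hser s"
proof -
  define f where "f = fls_regpart F"
  have F: "F = fps_to_fls f"
    by (rule fls_eqI) (use assms(3) in \<open>auto simp: f_def\<close>)
  have "fls_deriv (fps_to_fls f) = fps_to_fls (of_int s * (Abs_fps pvar * f))"
    using assms(1) by (simp add: F Aser_def fls_times_fps_to_fls fps_to_fls_of_int)
  hence d: "fps_deriv f = of_int s * (Abs_fps pvar * f)"
    by (simp add: fls_deriv_fps_to_fls)
  have i: "fps_nth (of_int s * F) n = of_int s * fps_nth F n" for F :: "pol fps" and n
    by (metis fps_mult_left_const_nth fps_of_int)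
  have "fps_nth f n = Hs s n" for n
  proof (induction n rule: less_induct)
    case (less n)
    show ?case
    proof (cases n)
      case 0
      thus ?thesis using assms(2) by (simp add: F)
    next
      case (Suc k)
      have "of_nat (Suc k) * fps_nth f (Suc k) = fps_nth (fps_deriv f) k" by simp
      also have "\<dots> = of_int s * (\<Sum>i\<le>k. pvar i * fps_nth f (k - i))"
        unfolding d i by (simp add: fps_mult_nth atLeast0AtMost)
      also have "\<dots> = of_nat (Suc k) * Hs s (Suc k)"
        unfolding Hs_Suc by (simp add: less Suc)
      finally show ?thesis
        unfolding Suc by (rule of_nat_pol_cancel)
    qed
  qed
  hence "f = Abs_fps (Hs s)" by (simp add: fps_eq_iff)
  thus ?thesis by (simp add: F Hser_def)
qed

lemma Hser_add: "Hser s * Hser t = Hser (s + t)"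
proof (rule Hser_unique)
  show "fls_deriv (Hser s * Hser t) = of_int (s + t) * (Aser * (Hser s * Hser t))"
    by (simp add: deriv_Hser algebra_simps)
  have *: "Hser s * Hser t = fps_to_fls (Abs_fps (Hs s) * Abs_fps (Hs t))"
    by (simp add: Hser_def fls_times_fps_to_fls)
  show "fls_nth (Hser s * Hser t) 0 = 1" by (simp add: *)
  show "fls_nth (Hser s * Hser t) n = 0" if "n < 0" for n
    using that by (simp add: *)
qed

text \<open>The factor z^q collects the zero mode z^(beta(0)) and the power z^(-d) that accompanies
  the annihilation term of index d.\<close>

definition Kser :: "int \<Rightarrow> int \<Rightarrow> nat \<Rightarrow> ser" where
  "Kser s q k = hasse k (Xp q * Hser s)"

lemma Kser_nth: "fls_nth (Kser s q k) n = sc ((of_int n + of_nat k) gchoose k) * HZ s (n + int k - q)"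
  unfolding Kser_def hasse_nth fls_X_intpow_times_conv_shift(1) by simp

lemma deriv_Xp_Hser: "fls_deriv (Xp q * Hser s) = of_int q * (Xp (q - 1) * Hser s) + of_int s * (Aser * (Xp q * Hser s))"
proof -
  have "fls_deriv (Xp q) = of_int q * Xp (q - 1)"
    by (simp add: fls_deriv_shift)
  thus ?thesis by (simp add: deriv_Hser algebra_simps)
qed

lemma Kser_Suc:
  "of_nat (Suc k) * Kser s q (Suc k) =
     of_int q * Kser s (q - 1) k + of_int s * (\<Sum>i\<le>k. hasse i Aser * Kser s q (k - i))"
  unfolding Kser_def hasse_Suc deriv_Xp_Hser hasse_add hasse_of_int_mult hasse_mult[of _ Aser] ..

lemma Kser_shift: "(\<Sum>i\<le>k. hasse i (Xp a) * Kser s q (k - i)) = Kser s (a + q) k"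
  unfolding Kser_def hasse_mult[symmetric] mult.assoc[symmetric] fls_X_intpow_times_fls_X_intpow ..

section \<open>Normally ordered products\<close>

definition heis :: "int \<Rightarrow> nat \<Rightarrow> pol \<Rightarrow> pol" where
  "heis m l g = (if l = 0 then sc (of_int m / 2) * g else ann (l - 1) g)"

lemma linop_heis: "linop (heis m l)"
  unfolding heis_def [abs_def] using linop_ann[of "l - 1"] linop_mult by (cases "l = 0") auto

lemma heis_commute: "heis m l (heis m' l' g) = heis m' l' (heis m l g)"
  by (simp add: heis_def annD ann_commute mult.left_commute)

lemma heis_Ep: "heis m l (Ep s b g) = Ep s b (heis m l g)"
  by (simp add: heis_def ann_Ep EpD)

lemma wle_heis: "wle d g \<Longrightarrow> wle (d - int l) (heis m l g)"
  using wle_ann[of d g "l - 1"] by (auto simp: heis_def intro: wle_sc_mult)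

lemma heis_eq_0: "wle d g \<Longrightarrow> d < int l \<Longrightarrow> heis m l g = 0"
  using wle_heis[of d g l m] wle_neg by auto

lemma heis_1: "heis m l 1 = (if l = 0 then sc (of_int m / 2) else 0)"
  by (simp add: heis_def)

type_synonym fld = "pol \<Rightarrow> ser"

definition linF :: "fld \<Rightarrow> bool" where
  "linF F \<longleftrightarrow> (\<forall>f g. F (f + g) = F f + F g) \<and> (\<forall>c f. F (sc c * f) = C c * F f)"

lemma linFI: "(\<And>f g. F (f + g) = F f + F g) \<Longrightarrow> (\<And>c f. F (sc c * f) = C c * F f) \<Longrightarrow> linF F"
  by (simp add: linF_def)

lemma linFD:
  assumes "linF F"
  shows "F (f + g) = F f + F g" "F (sc c * f) = C c * F f" "F 0 = 0" "F (sum h A) = (\<Sum>x\<in>A. F (h x))"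
    "F (f - g) = F f - F g"
proof -
  show a: "F (f + g) = F f + F g" for f g using assms by (simp add: linF_def)
  show s: "F (sc c * f) = C c * F f" for c f using assms by (simp add: linF_def)
  show z: "F 0 = 0" using s[of 0 0] by simp
  show "F (sum h A) = (\<Sum>x\<in>A. F (h x))"
    by (induction A rule: infinite_finite_induct) (auto simp: a z)
  show "F (f - g) = F f - F g" using a[of "f - g" g] by (simp add: algebra_simps)
qed

lemma linF_fls_const: "linF fls_const"
  by (auto intro!: linFI simp: fls_plus_const)

lemma linF_comp: "linF F \<Longrightarrow> linop L \<Longrightarrow> linF (\<lambda>g. F (L g))"
  by (simp add: linF_def linop_def)

lemma linF_add: "linF F \<Longrightarrow> linF G \<Longrightarrow> linF (\<lambda>g. F g + G g)"
  by (simp add: linF_def algebra_simps)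

lemma linF_0: "linF (\<lambda>g. 0)"
  by (simp add: linF_def)

lemma linF_sum: "(\<And>x. x \<in> A \<Longrightarrow> linF (F x)) \<Longrightarrow> linF (\<lambda>g. \<Sum>x\<in>A. F x g)"
  by (induction A rule: infinite_finite_induct) (auto intro: linF_0 linF_add)

lemma linF_mult: "linF F \<Longrightarrow> linF (\<lambda>g. h * F g)"
  by (simp add: linF_def algebra_simps)

lemma linF_of_int: "linF F \<Longrightarrow> F (of_int c * f) = of_int c * F f"
  using linFD(2)[of F "of_int c" f] by (simp add: fls_of_int)

text \<open>\<open>Nop\<close> is the normally ordered product with a Hasse derivative of the Heisenberg field;
  \<open>vop\<close> is the normally ordered product with the \<open>k\<close>-th Hasse derivative of \<open>z\<^sup>e\<close> times the vertex
  operator of charge \<open>s\<close>. Both act on states of charge \<open>m\<close>, and the shift of the charge is left implicit.\<close>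

definition gop :: "(nat \<Rightarrow> ser) \<Rightarrow> (nat \<Rightarrow> pol \<Rightarrow> pol) \<Rightarrow> fld \<Rightarrow> fld" where
  "gop K L F g = (\<Sum>d\<le>wt g. K d * F (L d g))"

definition Nop :: "int \<Rightarrow> nat \<Rightarrow> fld \<Rightarrow> fld" where
  "Nop m i F g = hasse i Aser * F g + gop (\<lambda>l. hasse i (Xp (- int l - 1))) (heis m) F g"

definition vop :: "int \<Rightarrow> int \<Rightarrow> nat \<times> int \<Rightarrow> fld \<Rightarrow> fld" where
  "vop s m ke = gop (\<lambda>d. Kser s (s * m div 2 + snd ke - int d) (fst ke)) (Ep s)"

text \<open>The properties of a family of annihilation operators that make \<open>gop\<close>
  independent of its cut-off.\<close>

definition lowering :: "(nat \<Rightarrow> pol \<Rightarrow> pol) \<Rightarrow> bool" where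
  "lowering L \<longleftrightarrow> (\<forall>d. linop (L d)) \<and> (\<forall>d e g. wle e g \<longrightarrow> wle (e - int d) (L d g))"

lemma lowering_heis: "lowering (heis m)" and lowering_Ep: "lowering (Ep s)"
  by (simp_all add: lowering_def linop_heis linop_Ep wle_heis wle_Ep)

lemma loweringD:
  assumes "lowering L"
  shows "linop (L d)" "wle (int D) g \<Longrightarrow> wle (int D) (L d g)" "wle (int D) g \<Longrightarrow> D < d \<Longrightarrow> L d g = 0"
proof -
  have w: "wle (int D - int d) (L d g)" if "wle (int D) g" for D
    using assms that by (simp add: lowering_def)
  show "linop (L d)" using assms by (simp add: lowering_def)
  show "wle (int D) g \<Longrightarrow> wle (int D) (L d g)" using wle_mono[OF w] by simp
  show "wle (int D) g \<Longrightarrow> D < d \<Longrightarrow> L d g = 0" using wle_neg[OF w] by simp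
qed

lemma gop_eq:
  assumes "lowering L" "wle (int D) g" "linF F"
  shows "gop K L F g = (\<Sum>d\<le>D. K d * F (L d g))"
  unfolding gop_def
  by (rule sum_atMost_extend[symmetric])
     (use assms wt_le loweringD(3)[OF assms(1) wle_wt] in \<open>auto simp: linFD(3)\<close>)

lemma vop_eq:
  assumes "wle (int D) g" "linF F"
  shows "vop s m ke F g = (\<Sum>d\<le>D. Kser s (s * m div 2 + snd ke - int d) (fst ke) * F (Ep s d g))"
  unfolding vop_def gop_eq[OF lowering_Ep assms] ..

lemma common_wle:
  obtains D where "wle (int D) f" "wle (int D) g" "wle (int D) (f + g)"
proof -
  have "wle (int (wt f + wt g)) f" "wle (int (wt f + wt g)) g"
    by (rule wle_mono[OF wle_wt], simp)+
  thus ?thesis using that wle_add by blast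
qed

lemma linF_gop:
  assumes L: "lowering L" and F: "linF F"
  shows "linF (gop K L F)"
proof (rule linFI)
  fix f g
  obtain D where D: "wle (int D) f" "wle (int D) g" "wle (int D) (f + g)"
    by (rule common_wle)
  show "gop K L F (f + g) = gop K L F f + gop K L F g"
    unfolding gop_eq[OF L D(1) F] gop_eq[OF L D(2) F] gop_eq[OF L D(3) F] linFD(1)[OF F]
      linopD(1)[OF loweringD(1)[OF L]] by (simp add: ring_distribs sum.distrib)
next
  fix c f
  have D: "wle (int (wt f)) (sc c * f)" by (intro wle_sc_mult wle_wt)
  show "gop K L F (sc c * f) = C c * gop K L F f"
    unfolding gop_eq[OF L D F] gop_def[of _ _ _ f] linFD(2)[OF F] linopD(2)[OF loweringD(1)[OF L]]
    by (simp add: mult_ac sum_distrib_left)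
qed

lemma gop_add: "gop K L (\<lambda>g. F g + G g) g = gop K L F g + gop K L G g"
  by (simp add: gop_def ring_distribs sum.distrib)

lemma gop_mult: "gop K L (\<lambda>g. h * F g) g = h * gop K L F g"
  by (simp add: gop_def sum_distrib_left mult.left_commute)

lemma gop_gop:
  assumes L: "lowering L" "lowering L'" and F: "linF F" and D: "wle (int D) g"
  shows "gop K L (gop K' L' F) g = (\<Sum>n\<le>D. \<Sum>d\<le>n. K d * (K' (n - d) * F (L' (n - d) (L d g))))"
proof -
  have "gop K L (gop K' L' F) g = (\<Sum>d\<le>D. \<Sum>e\<le>D. K d * (K' e * F (L' e (L d g))))"
    unfolding gop_eq[OF L(1) D linF_gop[OF L(2) F]] gop_eq[OF L(2) loweringD(2)[OF L(1) D] F] sum_distrib_left ..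
  also have "\<dots> = (\<Sum>e\<le>D. \<Sum>d\<le>D. K d * (K' e * F (L' e (L d g))))"
    by (rule sum.swap)
  also have "\<dots> = (\<Sum>n\<le>D. \<Sum>d\<le>n. K d * (K' (n - d) * F (L' (n - d) (L d g))))"
  proof (rule sum_sum_conv)
    fix e d assume *: "D < e + d"
    have "wle (int D - int d) (L d g)" using L(1) D by (simp add: lowering_def)
    hence "wle (int D - int d - int e) (L' e (L d g))" using L(2) by (simp add: lowering_def)
    hence "L' e (L d g) = 0" by (rule wle_neg) (use * in simp)
    thus "K d * (K' e * F (L' e (L d g))) = 0" by (simp add: linFD(3)[OF F])
  qed
  finally show ?thesis .
qed

lemma gop_commute:
  assumes L: "lowering L" "lowering L'" and comm: "\<And>d e g. L d (L' e g) = L' e (L d g)" and F: "linF F"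
  shows "gop K L (gop K' L' F) g = gop K' L' (gop K L F) g"
proof -
  note D = wle_wt[of g]
  show ?thesis
    unfolding gop_eq[OF L(1) D linF_gop[OF L(2) F]] gop_eq[OF L(2) loweringD(2)[OF L(1) D] F]
      gop_eq[OF L(2) D linF_gop[OF L(1) F]] gop_eq[OF L(1) loweringD(2)[OF L(2) D] F] sum_distrib_left comm
    by (subst sum.swap) (simp only: mult.left_commute)
qed

lemma linF_Nop: "linF F \<Longrightarrow> linF (Nop m i F)"
  unfolding Nop_def [abs_def] by (intro linF_add linF_mult linF_gop lowering_heis)

lemma linF_vop: "linF F \<Longrightarrow> linF (vop s m ke F)"
  unfolding vop_def by (rule linF_gop[OF lowering_Ep])

lemma wle_int_Ep: "wle (int D) g \<Longrightarrow> wle (int D) (Ep s b g)"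
  by (rule wle_mono[OF wle_Ep]) auto

lemma Nop_commute:
  assumes "linF F"
  shows "Nop m i (Nop m j F) g = Nop m j (Nop m i F) g"
proof -
  have "gop (\<lambda>l. hasse i (Xp (- int l - 1))) (heis m) (gop (\<lambda>l. hasse j (Xp (- int l - 1))) (heis m) F) g =
        gop (\<lambda>l. hasse j (Xp (- int l - 1))) (heis m) (gop (\<lambda>l. hasse i (Xp (- int l - 1))) (heis m) F) g"
    by (intro gop_commute lowering_heis heis_commute assms)
  thus ?thesis
    by (simp only: Nop_def [abs_def] gop_add gop_mult ring_distribs mult.left_commute add_ac)
qed

lemma Nop_vop:
  assumes "linF F"
  shows "Nop m i (vop s m ke F) g = vop s m ke (Nop m i F) g"
  unfolding Nop_def [abs_def] vop_def gop_add gop_mult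
  by (intro arg_cong2[of _ _ _ _ "(+)"] refl gop_commute lowering_heis lowering_Ep heis_Ep assms)

text \<open>Coefficient form of z d/dz (z^q E(z)) = s (sum_{l>=0} varpi(l) z^(-l)) z^q E(z), where E
  is the annihilation exponential and q = sm/2. The zero mode contributes q, \<open>Ep_Suc\<close>
  contributes - e.\<close>

lemma sum_Ep_heis:
  assumes "even (s * m)"
  shows "of_int s * (\<Sum>l\<le>e. Ep s (e - l) (heis m l g)) = of_int (s * m div 2 - int e) * Ep s e g"
proof -
  have "(of_int s :: complex) * (of_int m / 2) = of_int (s * m div 2)"
  proof -
    obtain q where q: "s * m = 2 * q" using assms by blast
    hence "of_int s * of_int m = 2 * (of_int q :: complex)" by (metis of_int_mult of_int_numeral)
    thus ?thesis by (simp add: q)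
  qed
  hence c: "of_int s * sc (of_int m / 2) = of_int (s * m div 2)"
    by (metis sc_simps(4) sc_simps(8))
  have 0: "of_int s * Ep s e (heis m 0 g) = of_int (s * m div 2) * Ep s e g" for e
    unfolding heis_def by (simp add: EpD c mult.assoc[symmetric])
  show ?thesis
  proof (cases e)
    case 0
    thus ?thesis using \<open>\<And>e. of_int s * Ep s e (heis m 0 g) = _ e\<close>[of 0] by simp
  next
    case (Suc k)
    have "(\<Sum>l\<le>Suc k. Ep s (Suc k - l) (heis m l g)) =
        Ep s (Suc k) (heis m 0 g) + (\<Sum>l\<le>k. ann l (Ep s (k - l) g))"
      by (subst sum.atMost_Suc_shift) (simp add: heis_def ann_Ep del: Ep.simps)
    hence "of_int s * (\<Sum>l\<le>Suc k. Ep s (Suc k - l) (heis m l g)) =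
        of_int s * Ep s (Suc k) (heis m 0 g) - (- of_int s * (\<Sum>l\<le>k. ann l (Ep s (k - l) g)))"
      by (simp add: algebra_simps del: Ep.simps)
    also have "\<dots> = of_int (s * m div 2 - int (Suc k)) * Ep s (Suc k) g"
      by (simp only: 0 Ep_Suc[symmetric]) (simp add: algebra_simps del: Ep.simps)
    finally show ?thesis by (simp only: Suc)
  qed
qed

text \<open>Since \<open>\<partial>\<close> of the vertex operator of charge \<open>s\<close> is its normally ordered product with \<open>s\<close> times the
  Heisenberg field, its Hasse derivatives obey the same recursion as \<^const>\<open>Hs\<close>.\<close>

lemma vop_Suc:
  assumes F: "linF F" and even: "even (s * m)"
  shows "of_nat (Suc k) * vop s m (Suc k, 0) F g = of_int s * (\<Sum>i\<le>k. Nop m i (vop s m (k - i, 0) F) g)"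
proof -
  define D where "D = wt g"
  define q where "q = s * m div 2"
  have D: "wle (int D) g" unfolding D_def by (rule wle_wt)
  have v: "vop s m (k, 0) F g = (\<Sum>d\<le>D. Kser s (q - int d) k * F (Ep s d g))" for k
    using vop_eq[OF D F, of s m "(k,0)"] by (simp add: q_def)
  have 1: "(\<Sum>i\<le>k. hasse i Aser * vop s m (k - i, 0) F g) =
     (\<Sum>d\<le>D. (\<Sum>i\<le>k. hasse i Aser * Kser s (q - int d) (k - i)) * F (Ep s d g))"
    unfolding v sum_distrib_left sum_distrib_right by (subst sum.swap) (simp only: mult.assoc)
  have "(\<Sum>i\<le>k. gop (\<lambda>l. hasse i (Xp (- int l - 1))) (heis m) (vop s m (k - i, 0) F) g) =
     (\<Sum>i\<le>k. \<Sum>n\<le>D. \<Sum>l\<le>n. hasse i (Xp (- int l - 1)) * (Kser s (q - int (n - l)) (k - i) * F (Ep s (n - l) (heis m l g))))"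
    by (simp add: vop_def gop_gop[OF lowering_heis lowering_Ep F D] q_def)
  also have "\<dots> = (\<Sum>n\<le>D. \<Sum>l\<le>n. \<Sum>i\<le>k. hasse i (Xp (- int l - 1)) * (Kser s (q - int (n - l)) (k - i) * F (Ep s (n - l) (heis m l g))))"
    by (rule trans[OF sum.swap], rule sum.cong[OF refl], rule sum.swap)
  \<comment> \<open>The exponents - l - 1 and q - (n - l) add up to q - n - 1, independently of l,
    so the sum over l can be moved onto the states.\<close>
  also have "\<dots> = (\<Sum>n\<le>D. \<Sum>l\<le>n. Kser s (q - int n - 1) k * F (Ep s (n - l) (heis m l g)))"
    unfolding mult.assoc[symmetric] sum_distrib_right[symmetric] Kser_shift
    by (intro sum.cong refl arg_cong2[of _ _ _ _ "(*)"] arg_cong2[of _ _ _ _ "Kser s"]) auto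
  also have "\<dots> = (\<Sum>n\<le>D. Kser s (q - int n - 1) k * F (\<Sum>l\<le>n. Ep s (n - l) (heis m l g)))"
    by (simp add: linFD(4)[OF F] sum_distrib_left)
  finally have 2: "(\<Sum>i\<le>k. gop (\<lambda>l. hasse i (Xp (- int l - 1))) (heis m) (vop s m (k - i, 0) F) g) = \<dots>" .
  have aux: "x * ((\<Sum>d\<le>D. U d * V d) + (\<Sum>d\<le>D. W d * Y d)) = (\<Sum>d\<le>D. (x * U d) * V d) + (\<Sum>d\<le>D. W d * (x * Y d))"
    for x :: ser and U V W Y by (simp add: ring_distribs sum_distrib_left mult_ac)
  have "of_int s * (\<Sum>i\<le>k. Nop m i (vop s m (k - i, 0) F) g) =
     (\<Sum>d\<le>D. (of_int s * (\<Sum>i\<le>k. hasse i Aser * Kser s (q - int d) (k - i))) * F (Ep s d g)) +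
     (\<Sum>n\<le>D. Kser s (q - int n - 1) k * F (of_int s * (\<Sum>l\<le>n. Ep s (n - l) (heis m l g))))"
    by (simp only: Nop_def sum.distrib 1 2 linF_of_int[OF F] aux)
  also have "\<dots> = (\<Sum>d\<le>D. (of_int s * (\<Sum>i\<le>k. hasse i Aser * Kser s (q - int d) (k - i)) +
        of_int (q - int d) * Kser s (q - int d - 1) k) * F (Ep s d g))"
    unfolding sum_Ep_heis[OF even] linF_of_int[OF F] q_def[symmetric]
    by (simp only: ring_distribs sum.distrib) (simp only: mult_ac)
  also have "\<dots> = of_nat (Suc k) * vop s m (Suc k, 0) F g"
    by (simp only: v Kser_Suc add.commute sum_distrib_left mult.assoc[symmetric])
  finally show ?thesis ..
qed

subsection \<open>The field of a polynomial state\<close>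

text \<open>\<open>NR\<close> repeats the recursion of \<^const>\<open>Yr\<close>, which always removes the least index; the order turns out
  to be irrelevant.\<close>

primrec NR :: "int \<Rightarrow> nat \<Rightarrow> (nat \<Rightarrow>\<^sub>0 nat) \<Rightarrow> fld \<Rightarrow> fld" where
  "NR m 0 p F = F"
| "NR m (Suc r) p F = (if p = 0 then F else
     let i = Min (keys p) in Nop m i (NR m r (p - sg i) F))"

definition tdeg :: "(nat \<Rightarrow>\<^sub>0 nat) \<Rightarrow> nat" where
  "tdeg p = (\<Sum>i\<in>keys p. lookup p i)"

lemma tdeg_altdef: "finite A \<Longrightarrow> keys p \<subseteq> A \<Longrightarrow> tdeg p = (\<Sum>i\<in>A. lookup p i)"
  unfolding tdeg_def by (rule sum.mono_neutral_left) (auto simp: in_keys_iff)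

lemma tdeg_add_sg: "tdeg (p + sg i) = Suc (tdeg p)"
proof -
  let ?A = "insert i (keys p)"
  have "keys (p + sg i) \<subseteq> ?A" using keys_add[of p "sg i"] by (auto simp: sg_def)
  hence "tdeg (p + sg i) = (\<Sum>j\<in>?A. lookup p j) + (\<Sum>j\<in>?A. if i = j then 1 else 0)"
    by (subst tdeg_altdef[of ?A]) (auto simp: lookup_add lookup_sg sum.distrib)
  also have "(\<Sum>j\<in>?A. lookup p j) = tdeg p"
    by (subst tdeg_altdef[of ?A]) auto
  finally show ?thesis by simp
qed

lemma tdeg_0 [simp]: "tdeg 0 = 0"
  by (simp add: tdeg_def)

lemma lookup_Min_keys:
  fixes p :: "nat \<Rightarrow>\<^sub>0 nat"
  shows "p \<noteq> 0 \<Longrightarrow> lookup p (Min (keys p)) \<ge> 1"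
proof -
  assume "p \<noteq> 0"
  hence "keys p \<noteq> {}" by (metis ex_in_conv in_keys_iff lookup_zero poly_mapping_eqI)
  from Min_in[OF finite_keys this] show ?thesis by (simp add: in_keys_iff Suc_le_eq)
qed

lemma tdeg_minus_sg: "lookup p i \<ge> 1 \<Longrightarrow> tdeg p = Suc (tdeg (p - sg i))"
  by (metis minus_sg_add_sg tdeg_add_sg)

definition NM :: "int \<Rightarrow> (nat \<Rightarrow>\<^sub>0 nat) \<Rightarrow> fld \<Rightarrow> fld" where
  "NM m p F = NR m (tdeg p) p F"

lemma NM_0 [simp]: "NM m 0 F = F"
  by (simp add: NM_def)

lemma NM_rec: "p \<noteq> 0 \<Longrightarrow> i = Min (keys p) \<Longrightarrow> NM m p F = Nop m i (NM m (p - sg i) F)"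
  using tdeg_minus_sg[OF lookup_Min_keys, of p] by (simp add: NM_def Let_def)

lemma linF_NM: "linF F \<Longrightarrow> linF (NM m p F)"
proof (induction "tdeg p" arbitrary: p)
  case (Suc n)
  hence "p \<noteq> 0" by auto
  from tdeg_minus_sg[OF lookup_Min_keys[OF this]] Suc
  show ?case by (subst NM_rec[OF \<open>p \<noteq> 0\<close> refl]) (auto intro!: linF_Nop)
next
  case 0
  hence "p = 0" using tdeg_minus_sg[OF lookup_Min_keys, of p] by fastforce
  thus ?case using 0 by simp
qed

text \<open>Frees the recursion from removing the least index: normally ordered Heisenberg factors
  commute, so any factor may be moved outermost.\<close>

lemma NM_add_sg:
  assumes "linF F"
  shows "NM m (p + sg i) F = Nop m i (NM m p F)"
proof (induction "tdeg p" arbitrary: p i rule: less_induct)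
  case less
  define j where "j = Min (keys (p + sg i))"
  have "lookup (p + sg i) i \<noteq> 0" by (simp add: lookup_add lookup_sg)
  hence nz: "p + sg i \<noteq> 0" by (metis lookup_zero)
  have rec: "NM m (p + sg i) F = Nop m j (NM m (p + sg i - sg j) F)"
    by (rule NM_rec[OF nz j_def])
  show ?case
  proof (cases "i = j")
    case True
    thus ?thesis using rec by simp
  next
    case False
    have "lookup (p + sg i) j \<ge> 1" unfolding j_def by (rule lookup_Min_keys[OF nz])
    hence pj: "lookup p j \<ge> 1" using False by (simp add: lookup_add lookup_sg)
    hence lt: "tdeg (p - sg j) < tdeg p" using tdeg_minus_sg[of p j] by simp
    have "p + sg i - sg j = p - sg j + sg i"
      by (rule poly_mapping_eqI) (use pj False in \<open>auto simp: lookup_add lookup_minus lookup_sg\<close>)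
    hence "NM m (p + sg i) F = Nop m j (Nop m i (NM m (p - sg j) F))"
      using rec less[OF lt] by simp
    also have "\<dots> = Nop m i (Nop m j (NM m (p - sg j) F))"
      by (intro ext Nop_commute linF_NM assms)
    also have "Nop m j (NM m (p - sg j) F) = NM m (p - sg j + sg j) F"
      by (rule less[OF lt, symmetric])
    finally show ?thesis using minus_sg_add_sg[OF pj] by simp
  qed
qed

text \<open>Linear extension in the state: \<open>NA m f (bop j m)\<close> is the field of f e^(j
  varpi) acting on charge m.\<close>

definition NA :: "int \<Rightarrow> pol \<Rightarrow> fld \<Rightarrow> fld" where
  "NA m f F g = (\<Sum>q\<in>keys f. C (lookup f q) * NM m q F g)"

lemma NA_altdef:
  "finite A \<Longrightarrow> keys f \<subseteq> A \<Longrightarrow> NA m f F g = (\<Sum>q\<in>A. C (lookup f q) * NM m q F g)"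
  unfolding NA_def by (rule sum.mono_neutral_left) (auto simp: in_keys_iff)

lemma linF_NA_left: "linF (\<lambda>f. NA m f F g)"
proof (rule linFI)
  fix f f' :: pol
  let ?A = "keys f \<union> keys f'"
  show "NA m (f + f') F g = NA m f F g + NA m f' F g"
    using keys_add[of f f'] by (simp add: NA_altdef[of ?A] lookup_add ring_distribs sum.distrib flip: fls_plus_const)
next
  fix c f
  have "keys (sc c * f) \<subseteq> keys f" by (auto simp: in_keys_iff)
  thus "NA m (sc c * f) F g = C c * NA m f F g"
    by (simp add: NA_altdef[of "keys f"] sum_distrib_left mult.assoc flip: fls_const_mult_const)
qed

lemma linF_NA: "linF F \<Longrightarrow> linF (NA m f F)"
  unfolding NA_def [abs_def] by (intro linF_sum linF_mult linF_NM)

lemma NA_single: "NA m (single p 1) F = NM m p F"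
  by (rule ext) (simp add: NA_def)

lemma NA_1 [simp]: "NA m 1 F = F"
  using NA_single[of m 0 F] by simp

lemma linF_eqI:
  assumes "linF L" "linF M" "\<And>p. L (single p 1) = M (single p 1)"
  shows "L f = M f"
proof -
  have "L (single p c) = M (single p c)" for p c
    by (subst (1 2) single_eq_sc) (simp add: linFD(2)[OF assms(1)] linFD(2)[OF assms(2)] assms(3))
  thus ?thesis
    by (subst (1 2) poly_mapping_sum_singles) (simp add: linFD(4)[OF assms(1)] linFD(4)[OF assms(2)])
qed

lemma linF_Nop_arg:
  assumes "\<And>g. linF (\<lambda>f. G f g)"
  shows "linF (\<lambda>f. Nop m i (G f) g)"
  unfolding Nop_def [abs_def] gop_def by (intro linF_add linF_sum linF_mult assms)

lemma linF_vop_arg: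
  assumes "\<And>g. linF (\<lambda>f. G f g)"
  shows "linF (\<lambda>f. vop s m ke (G f) g)"
  unfolding vop_def gop_def [abs_def] by (intro linF_sum linF_mult assms)

lemma NA_pvar_mult:
  assumes "linF F"
  shows "NA m (pvar i * f) F g = Nop m i (NA m f F) g"
proof (rule linF_eqI[of "\<lambda>f. NA m (pvar i * f) F g" "\<lambda>f. Nop m i (NA m f F) g"])
  show "linF (\<lambda>f. NA m (pvar i * f) F g)"
    by (rule linF_comp[OF linF_NA_left linop_mult])
  show "linF (\<lambda>f. Nop m i (NA m f F) g)"
    by (intro linF_Nop_arg linF_NA_left)
  show "NA m (pvar i * single p 1) F g = Nop m i (NA m (single p 1) F) g" for p
    unfolding pvar_mult_single NA_single NM_add_sg[OF assms] ..
qed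

lemma NA_vop:
  assumes "linF F"
  shows "NA m f (vop s m ke F) g = vop s m ke (NA m f F) g"
proof (rule linF_eqI[of "\<lambda>f. NA m f (vop s m ke F) g" "\<lambda>f. vop s m ke (NA m f F) g"])
  show "linF (\<lambda>f. NA m f (vop s m ke F) g)" by (rule linF_NA_left)
  show "linF (\<lambda>f. vop s m ke (NA m f F) g)" by (intro linF_vop_arg linF_NA_left)
  have "NM m p (vop s m ke F) g = vop s m ke (NM m p F) g" for p g
  proof (induction "tdeg p" arbitrary: p g)
    case 0
    hence "p = 0" using tdeg_minus_sg[OF lookup_Min_keys, of p] by fastforce
    thus ?case by simp
  next
    case (Suc n)
    hence "p \<noteq> 0" by auto
    define i where "i = Min (keys p)"
    have p: "p = p - sg i + sg i" "n = tdeg (p - sg i)"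
      using minus_sg_add_sg[OF lookup_Min_keys[OF \<open>p \<noteq> 0\<close>]] tdeg_minus_sg[OF lookup_Min_keys[OF \<open>p \<noteq> 0\<close>]] Suc
      by (simp_all add: i_def)
    have "NM m (p - sg i + sg i) (vop s m ke F) g = Nop m i (vop s m ke (NM m (p - sg i) F)) g"
      unfolding NM_add_sg[OF linF_vop[OF assms]] by (simp add: Suc.hyps(1)[OF p(2), abs_def] fun_eq_iff)
    also have "\<dots> = vop s m ke (NM m (p - sg i + sg i) F) g"
      unfolding NM_add_sg[OF assms] by (rule Nop_vop[OF linF_NM[OF assms]])
    finally show ?case using p(1) by simp
  qed
  thus "NA m (single p 1) (vop s m ke F) g = vop s m ke (NA m (single p 1) F) g" for p
    unfolding NA_single .
qed

text \<open>The recursions \<open>Hs_Suc\<close> and \<open>vop_Suc\<close> coincide. This is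
  translation covariance: h_k e^(s varpi) is a divided derivative of the state e^(s varpi), hence
  its field a Hasse derivative, also next to further normally ordered factors.\<close>

lemma NA_Hs:
  assumes "linF F" "even (s * m)"
  shows "NA m (Hs s k * f) (vop s m (0, 0) F) g = vop s m (k, 0) (NA m f F) g"
proof (induction k arbitrary: g rule: less_induct)
  case (less k)
  show ?case
  proof (cases k)
    case 0
    thus ?thesis by (simp add: NA_vop[OF assms(1)])
  next
    case (Suc n)
    let ?V = "vop s m (0, 0) F"
    have V: "linF ?V" by (rule linF_vop[OF assms(1)])
    have "of_nat (Suc n) * NA m (Hs s (Suc n) * f) ?V g = NA m (of_nat (Suc n) * Hs s (Suc n) * f) ?V g"
      using linFD(2)[OF linF_NA_left, of m "of_nat (Suc n)" "Hs s (Suc n) * f" ?V g]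
      by (simp add: mult.assoc fls_of_nat fls_plus_const[symmetric] del: Hs.simps of_nat_Suc)
    also have "of_nat (Suc n) * Hs s (Suc n) * f = of_int s * (\<Sum>i\<le>n. pvar i * (Hs s (n - i) * f))"
      unfolding Hs_Suc by (simp add: sum_distrib_right mult.assoc)
    also have "NA m \<dots> ?V g = of_int s * (\<Sum>i\<le>n. Nop m i (NA m (Hs s (n - i) * f) ?V) g)"
      by (simp only: linF_of_int[OF linF_NA_left] linFD(4)[OF linF_NA_left] NA_pvar_mult[OF V])
    also have "\<dots> = of_int s * (\<Sum>i\<le>n. Nop m i (vop s m (n - i, 0) (NA m f F)) g)"
      using less.IH Suc by (intro arg_cong2[of _ _ _ _ "(*)"] sum.cong refl arg_cong2[of _ _ _ _ "Nop m _"] ext) auto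
    also have "\<dots> = of_nat (Suc n) * vop s m (Suc n, 0) (NA m f F) g"
      by (rule vop_Suc[OF linF_NA[OF assms(1)] assms(2), symmetric])
    finally show ?thesis unfolding Suc by (rule of_nat_ser_cancel)
  qed
qed

text \<open>A letter (k, e) stands for the k-th Hasse derivative of z^e times the vertex operator of
  charge s. The powers z^e arise when factors z - w are expanded.\<close>

primrec wop :: "int \<Rightarrow> int \<Rightarrow> (nat \<times> int) list \<Rightarrow> fld" where
  "wop s m [] = fls_const"
| "wop s m (ke # ks) = vop s m ke (wop s m ks)"

lemma linF_wop: "linF (wop s m ks)"
  by (induction ks) (auto intro: linF_fls_const linF_vop)

abbreviation plain :: "nat list \<Rightarrow> (nat \<times> int) list" where
  "plain ks \<equiv> map (\<lambda>k. (k, 0)) ks"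

lemma NA_prod_Hs:
  assumes "even (s * m)"
  shows "NA m (prod_list (map (Hs s) ks)) (wop s m (plain (replicate (length ks) 0))) = wop s m (plain ks)"
proof (induction ks)
  case (Cons k ks)
  show ?case
    by (rule ext) (simp add: NA_Hs[OF linF_wop assms] Cons.IH[simplified])
qed simp

text \<open>Normal ordering suppresses the contraction, so creation parts, annihilation parts and
  zero modes multiply separately.\<close>

lemma vop_vop_0:
  assumes F: "linF F" and even: "even (s * m)" "even (t * m)"
  shows "vop s m (0, 0) (vop t m (0, 0) F) g = vop (s + t) m (0, 0) F g"
proof -
  note D = wle_wt[of g]
  have K: "Kser s a 0 * Kser t b 0 = Kser (s + t) (a + b) 0" for a b
  proof -
    have "Kser s a 0 * Kser t b 0 = (Xp a * Xp b) * (Hser s * Hser t)"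
      by (simp only: Kser_def hasse_0 mult_ac)
    thus ?thesis by (simp only: Hser_add fls_X_intpow_times_fls_X_intpow Kser_def hasse_0)
  qed
  have q: "(s + t) * m div 2 = s * m div 2 + t * m div 2"
    using even by (auto elim!: evenE simp: algebra_simps)
  have "vop s m (0, 0) (vop t m (0, 0) F) g =
     (\<Sum>n\<le>wt g. \<Sum>d\<le>n. Kser (s + t) ((s + t) * m div 2 - int n) 0 * F (Ep s d (Ep t (n - d) g)))"
    unfolding vop_def gop_gop[OF lowering_Ep lowering_Ep F D] mult.assoc[symmetric] K q Ep_commute[of t _ s] fst_conv
    by (intro sum.cong refl arg_cong2[of _ _ _ _ "(*)"] arg_cong2[of _ _ _ _ "Kser _"]) auto
  also have "\<dots> = vop (s + t) m (0, 0) F g"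
    by (simp add: vop_eq[OF D F] Ep_add linFD(4)[OF F] sum_distrib_left)
  finally show ?thesis .
qed

definition bop :: "int \<Rightarrow> int \<Rightarrow> fld" where
  "bop j m = vop j m (0, 0) fls_const"

lemma linF_bop: "linF (bop j m)"
  unfolding bop_def by (intro linF_vop linF_fls_const)

lemma Hs_0_Suc: "Hs 0 (Suc n) = 0" and Ep_0_Suc: "Ep 0 (Suc n) g = 0"
  by simp_all

lemma bop_0: "bop 0 m = fls_const"
proof
  fix g
  have "vop 0 m (0, 0) fls_const g = (\<Sum>d\<le>wt g. if d = 0 then Kser 0 0 0 * fls_const g else 0)"
    unfolding vop_def gop_def by (intro sum.cong refl) (auto simp: gr0_conv_Suc Ep_0_Suc simp del: Ep.simps(2))
  also have "Kser 0 0 0 = 1"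
    by (rule fls_eqI) (auto simp: Kser_nth HZ_def gr0_conv_Suc Hs_0_Suc simp del: Hs.simps(2)
        dest!: zero_less_imp_eq_int[of "_::int", OF le_neq_trans[OF leI]])
  finally show "bop 0 m g = fls_const g" by (simp add: bop_def)
qed

lemma wop_zeros:
  assumes "even (s * m)"
  shows "wop s m (plain (replicate r 0)) = bop (s * int r) m"
proof (induction r)
  case 0
  thus ?case by (simp add: bop_0)
next
  case (Suc r)
  have e: "even (s * int r * m)" using assms by auto
  show ?case
  proof
    fix g
    have "wop s m (plain (replicate (Suc r) 0)) g = vop s m (0, 0) (vop (s * int r) m (0, 0) fls_const) g"
      using Suc by (simp add: bop_def)
    also have "\<dots> = bop (s * int (Suc r)) m g"
      by (subst vop_vop_0[OF linF_fls_const assms e]) (simp add: bop_def algebra_simps)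
    finally show "wop s m (plain (replicate (Suc r) 0)) g = bop (s * int (Suc r)) m g" .
  qed
qed

text \<open>The field of a product of h_k is a word. The case s = 1 serves the commutant, s = 2 the
  subalgebra W.\<close>

lemma NA_bop_prod_Hs:
  assumes "even (s * m)"
  shows "NA m (prod_list (map (Hs s) ks)) (bop (s * int (length ks)) m) = wop s m (plain ks)"
  using NA_prod_Hs[OF assms, of ks] wop_zeros[OF assms, of "length ks"] by simp

section \<open>Comparison with the concrete model\<close>

definition mk :: "(int \<Rightarrow> pol) \<Rightarrow> vec" where
  "mk G = (\<lambda>(m, p). lookup (G m) p)"

definition cmp :: "int \<Rightarrow> vec \<Rightarrow> pol" where
  "cmp m v = Abs_poly_mapping (\<lambda>p. v (m, p))"

lemma mk_apply [simp]: "mk G (m, p) = lookup (G m) p"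
  by (simp add: mk_def)

lemma cmp_mk [simp]: "cmp m (mk G) = G m"
  by (simp add: cmp_def mk_def)

lemma mk_cmp: "fsupp v \<Longrightarrow> mk (\<lambda>m. cmp m v) = v"
proof (rule ext, clarify)
  fix m p assume "fsupp v"
  hence "finite (snd ` {k. v k \<noteq> 0})" by (simp add: fsupp_def)
  hence "finite {p. v (m, p) \<noteq> 0}" by (rule rev_finite_subset) force
  thus "mk (\<lambda>m. cmp m v) (m, p) = v (m, p)" by (simp add: cmp_def)
qed

lemma mk_eq_iff [simp]: "mk G = mk G' \<longleftrightarrow> G = G'"
proof
  assume "mk G = mk G'"
  hence "cmp m (mk G) = cmp m (mk G')" for m by (simp only:)
  thus "G = G'" by (simp add: fun_eq_iff)
qed simp

abbreviation chs :: "(int \<Rightarrow> pol) \<Rightarrow> int set" where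
  "chs G \<equiv> {m. G m \<noteq> 0}"

lemma supp_mk: "{k. mk G k \<noteq> 0} = Sigma (chs G) (\<lambda>m. keys (G m))"
  by (auto simp: in_keys_iff)

lemma pol_nonzero_lookup: "(f::pol) \<noteq> 0 \<Longrightarrow> \<exists>p. lookup f p \<noteq> 0"
  by (metis lookup_zero poly_mapping_eqI)

lemma fsupp_mk: "fsupp (mk G) \<longleftrightarrow> finite (chs G)"
proof
  assume "fsupp (mk G)"
  hence "finite (fst ` {k. mk G k \<noteq> 0})" by (simp add: fsupp_def)
  moreover have "chs G \<subseteq> fst ` {k. mk G k \<noteq> 0}"
    using pol_nonzero_lookup by (force simp: image_iff)
  ultimately show "finite (chs G)" by (rule rev_finite_subset)
qed (auto simp: fsupp_def supp_mk)

definition good :: "(int \<Rightarrow> pol) \<Rightarrow> bool" where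
  "good G \<longleftrightarrow> finite (chs G) \<and> (\<forall>m. odd m \<longrightarrow> G m = 0)"

lemma mk_in_VA1: "mk G \<in> VA1 \<longleftrightarrow> good G"
proof -
  have "(\<forall>m p. lookup (G m) p \<noteq> 0 \<longrightarrow> even m) \<longleftrightarrow> (\<forall>m. odd m \<longrightarrow> G m = 0)"
    by (metis lookup_zero pol_nonzero_lookup)
  thus ?thesis by (simp add: VA1_def good_def fsupp_mk)
qed

lemma VA1_eq: "v \<in> VA1 \<longleftrightarrow> (\<exists>G. v = mk G \<and> good G)"
proof
  assume v: "v \<in> VA1"
  hence "mk (\<lambda>m. cmp m v) = v" by (intro mk_cmp) (simp add: VA1_def)
  thus "\<exists>G. v = mk G \<and> good G" using v mk_in_VA1[of "\<lambda>m. cmp m v"]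
    by (intro exI[of _ "\<lambda>m. cmp m v"]) auto
qed (auto simp: mk_in_VA1)

lemma hm_neg_mk: "hm (- int i - 1) (mk G) = mk (\<lambda>m. pvar i * G m)"
  by (rule ext) (auto simp: hm_def lookup_pvar_mult sg_def)

lemma hm_nonneg_mk: "hm (int l) (mk G) = mk (\<lambda>m. heis m l (G m))"
proof -
  have "nat (int l - 1) = l - Suc 0" by auto
  thus ?thesis by (intro ext) (auto simp: hm_def heis_def ann_def lookup_pder sg_def)
qed

lemma good_hm: "good G \<Longrightarrow> good (\<lambda>m. heis m l (G m))"
  unfolding good_def
  by (auto simp: linopD(3)[OF linop_heis] elim: rev_finite_subset)

subsection \<open>Exponentials of commuting operators\<close>

definition vlin :: "(vec \<Rightarrow> vec) \<Rightarrow> bool" where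
  "vlin A \<longleftrightarrow> (\<forall>(S::(nat \<Rightarrow>\<^sub>0 nat) set) c w. finite S \<longrightarrow>
     A (\<lambda>k. \<Sum>m\<in>S. c m * w m k) = (\<lambda>k. \<Sum>m\<in>S. c m * A (w m) k))"

text \<open>The number n of factors is kept apart from the weight, so that all weights occurring in
  the recursion of \<open>expcoef\<close> can be compared at one n.\<close>

definition opw :: "(nat \<Rightarrow> vec \<Rightarrow> vec) \<Rightarrow> nat \<Rightarrow> (nat \<Rightarrow>\<^sub>0 nat) \<Rightarrow> vec \<Rightarrow> vec" where
  "opw A n m = foldr (\<lambda>i f. (A i ^^ lookup m i) \<circ> f) [0..<n] id"

definition cfw :: "(nat \<Rightarrow> complex) \<Rightarrow> nat \<Rightarrow> (nat \<Rightarrow>\<^sub>0 nat) \<Rightarrow> complex" where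
  "cfw cf n m = (\<Prod>i<n. cf i ^ lookup m i / of_nat (fact (lookup m i)))"

lemma foldr_comp: "foldr (\<lambda>i f. g i \<circ> f) xs h = foldr (\<lambda>i f. g i \<circ> f) xs id \<circ> h"
  by (induction xs) (auto simp: comp_assoc)

lemma opw_0 [simp]: "opw A 0 m = id"
  by (simp add: opw_def)

lemma opw_Suc: "opw A (Suc n) m v = opw A n m ((A n ^^ lookup m n) v)"
  unfolding opw_def by (simp, subst foldr_comp) simp

lemma opw_extend: "a \<le> n \<Longrightarrow> (\<And>i. i \<ge> a \<Longrightarrow> lookup m i = 0) \<Longrightarrow> opw A n m = opw A a m"
  by (induction n rule: dec_induct) (auto simp: opw_Suc fun_eq_iff)

lemma cfw_extend: "a \<le> n \<Longrightarrow> (\<And>i. i \<ge> a \<Longrightarrow> lookup m i = 0) \<Longrightarrow> cfw cf n m = cfw cf a m"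
  unfolding cfw_def by (rule prod.mono_neutral_right) auto

lemma funpow_commute:
  assumes "\<And>v. f (g v) = g (f v)"
  shows "f ((g ^^ n) v) = (g ^^ n) (f v)"
  by (induction n) (simp_all add: assms)

lemma opw_commute:
  assumes "\<And>i j v. A i (A j v) = A j (A i v)"
  shows "A i (opw A n m v) = opw A n m (A i v)"
proof (induction n arbitrary: v)
  case (Suc n)
  have "A i ((A n ^^ k) v) = (A n ^^ k) (A i v)" for k
    by (rule funpow_commute) (rule assms)
  thus ?case by (simp add: opw_Suc Suc)
qed simp

lemma opw_add_sg:
  assumes "\<And>i j v. A i (A j v) = A j (A i v)" "i < n"
  shows "opw A n (m + sg i) v = A i (opw A n m v)"
  using assms(2)
proof (induction n arbitrary: v)
  case (Suc n)
  show ?case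
  proof (cases "i = n")
    case True
    have "opw A n (m + sg n) = opw A n m"
      unfolding opw_def by (intro foldr_cong) (auto simp: lookup_add lookup_sg)
    moreover have "A n (opw A n m v) = opw A n m (A n v)" for v
      by (rule opw_commute) (rule assms(1))
    ultimately show ?thesis using True
      by (simp add: opw_Suc lookup_add lookup_sg)
  next
    case False
    thus ?thesis using Suc by (simp add: opw_Suc lookup_add lookup_sg)
  qed
qed simp

lemma cfw_add_sg:
  assumes "i < n"
  shows "of_nat (lookup m i + 1) * cfw cf n (m + sg i) = cf i * cfw cf n m"
proof -
  have eq: "{..<n} = insert i ({..<n} - {i})" using assms by auto
  have rest: "(\<Prod>j\<in>{..<n} - {i}. cf j ^ lookup (m + sg i) j / of_nat (fact (lookup (m + sg i) j)))
      = (\<Prod>j\<in>{..<n} - {i}. cf j ^ lookup m j / of_nat (fact (lookup m j)))"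
    by (intro prod.cong) (auto simp: lookup_add lookup_sg)
  have f: "(of_nat (x + 1) :: complex) * (a ^ (x + 1) / of_nat (fact (x + 1))) = a * (a ^ x / of_nat (fact x))" for x a
  proof -
    have "(of_nat (fact (x + 1)) :: complex) = of_nat (x + 1) * of_nat (fact x)"
      by (simp only: add.commute[of x] plus_1_eq_Suc fact_Suc of_nat_mult of_nat_id)
    moreover have "(of_nat (x + 1) :: complex) \<noteq> 0" by (simp only: of_nat_eq_0_iff)
    ultimately show ?thesis by (simp only: power_add power_one_right) (simp del: of_nat_add)
  qed
  show ?thesis
    unfolding cfw_def
    by (subst (1 2) eq, subst (1 2) prod.insert)
       (simp_all only: finite_Diff finite_lessThan rest lookup_add lookup_sg if_True mult.assoc[symmetric] f refl,
        auto)
qed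

lemma parts_altdef: "parts a = {m. pdeg m = a}"
  by (simp add: parts_def pdeg_def)

lemma lookup_le_pdeg: "(i + 1) * lookup m i \<le> pdeg m"
proof (cases "i \<in> keys m")
  case True
  thus ?thesis unfolding pdeg_def by (intro member_le_sum[of i _ "\<lambda>i. (i + 1) * lookup m i"]) auto
qed (simp add: in_keys_iff)

lemma lookup_parts: "m \<in> parts a \<Longrightarrow> i \<ge> a \<Longrightarrow> lookup m i = 0"
  using lookup_le_pdeg[of i m] by (cases "lookup m i") (auto simp: parts_altdef)

lemma finite_parts: "finite (parts a)"
proof -
  have "finite {f. \<forall>x. (x \<in> {..<a} \<longrightarrow> f x \<in> {..a}) \<and> (x \<notin> {..<a} \<longrightarrow> f x = (0::nat))}"
    by (rule finite_set_of_finite_funs) auto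
  moreover have "lookup ` parts a \<subseteq> {f. \<forall>x. (x \<in> {..<a} \<longrightarrow> f x \<in> {..a}) \<and> (x \<notin> {..<a} \<longrightarrow> f x = 0)}"
  proof (clarify, intro allI conjI impI)
    fix m i assume m: "m \<in> parts a"
    show "lookup m i \<in> {..a}"
      using lookup_le_pdeg[of i m] m by (auto simp: parts_altdef)
    show "lookup m i = 0" if "i \<notin> {..<a}" using lookup_parts[OF m] that by auto
  qed
  ultimately have "finite (lookup ` parts a)" by (rule rev_finite_subset)
  thus ?thesis
    by (rule finite_imageD) (auto intro!: inj_onI poly_mapping_eqI)
qed

lemma expcoef_altdef:
  assumes "a \<le> n"
  shows "expcoef A cf a v = (\<lambda>k. \<Sum>m\<in>parts a. cfw cf n m * opw A n m v k)"
proof -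
  have "cfw cf n m = cfw cf a m" "opw A n m = opw A a m" if "m \<in> parts a" for m
    using cfw_extend[OF assms] opw_extend[OF assms] lookup_parts[OF that] by blast+
  thus ?thesis
    unfolding expcoef_def by (intro ext sum.cong refl) (simp add: cfw_def opw_def)
qed

lemma expcoef_0: "expcoef A cf 0 v = v"
proof -
  have "parts 0 = {0}"
    using lookup_parts[of _ 0] by (auto simp: parts_altdef intro!: poly_mapping_eqI)
  thus ?thesis by (simp add: expcoef_altdef[of 0 0] cfw_def)
qed

text \<open>Euler's identity: the weight b + 1 = sum_i (i + 1) m_i is distributed over the factors,
  and lowering m_i by one identifies the i-th share with a term of weight b - i.\<close>

lemma expcoef_Suc:
  assumes comm: "\<And>i j v. A i (A j v) = A j (A i v)" and lin: "\<And>i. vlin (A i)"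
  shows "of_nat (Suc b) * expcoef A cf (Suc b) v k =
    (\<Sum>i\<le>b. of_nat (Suc i) * cf i * A i (expcoef A cf (b - i) v) k)"
proof -
  let ?n = "Suc b"
  define T where "T = (\<lambda>m. cfw cf ?n m * opw A ?n m v k)"
  have 1: "(\<Sum>m\<in>parts ?n. of_nat (lookup m i) * T m) = cf i * A i (expcoef A cf (b - i) v) k"
    if i: "i \<le> b" for i
  proof -
    have "(\<Sum>m\<in>parts ?n. of_nat (lookup m i) * T m) =
          (\<Sum>m\<in>{m\<in>parts ?n. lookup m i \<ge> 1}. of_nat (lookup m i) * T m)"
      by (rule sum.mono_neutral_right) (auto simp: finite_parts not_less_eq_eq)
    also have "\<dots> = (\<Sum>m\<in>parts (b - i). of_nat (lookup (m + sg i) i) * T (m + sg i))"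
    proof (rule sum.reindex_bij_witness[of _ "\<lambda>m. m + sg i" "\<lambda>m. m - sg i"])
      fix m assume m: "m \<in> {m\<in>parts ?n. lookup m i \<ge> 1}"
      hence e: "m - sg i + sg i = m" by (simp add: minus_sg_add_sg)
      show "m - sg i + sg i = m" by (rule e)
      have "pdeg (m - sg i) + pdeg (sg i) = ?n" unfolding pdeg_add[symmetric] e using m by (simp add: parts_altdef)
      thus "m - sg i \<in> parts (b - i)" by (simp add: parts_altdef)
      show "of_nat (lookup (m - sg i + sg i) i) * T (m - sg i + sg i) = of_nat (lookup m i) * T m"
        by (simp only: e)
    next
      fix m assume "m \<in> parts (b - i)"
      thus "m + sg i \<in> {m\<in>parts ?n. lookup m i \<ge> 1}"
        using i by (simp add: parts_altdef pdeg_add lookup_add lookup_sg)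
    qed auto
    also have "\<dots> = (\<Sum>m\<in>parts (b - i). cf i * (cfw cf ?n m * A i (opw A ?n m v) k))"
    proof (intro sum.cong refl)
      fix m
      have "of_nat (lookup (m + sg i) i) * T (m + sg i) =
         (of_nat (lookup m i + 1) * cfw cf ?n (m + sg i)) * A i (opw A ?n m v) k"
        using i opw_add_sg[of A, OF comm] by (simp add: T_def lookup_add lookup_sg)
      also have "\<dots> = cf i * (cfw cf ?n m * A i (opw A ?n m v) k)"
        using i by (subst cfw_add_sg) auto
      finally show "of_nat (lookup (m + sg i) i) * T (m + sg i) = \<dots>" .
    qed
    also have "\<dots> = cf i * A i (expcoef A cf (b - i) v) k"
      using lin[of i] finite_parts[of "b - i"]
      by (simp add: expcoef_altdef[of "b - i" ?n] vlin_def sum_distrib_left)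
    finally show ?thesis .
  qed
  have "of_nat ?n * expcoef A cf ?n v k = (\<Sum>m\<in>parts ?n. of_nat (pdeg m) * T m)"
    by (simp add: expcoef_altdef[of ?n ?n] T_def sum_distrib_left parts_altdef del: of_nat_Suc)
  also have "\<dots> = (\<Sum>m\<in>parts ?n. \<Sum>i\<le>b. of_nat (Suc i) * (of_nat (lookup m i) * T m))"
  proof (intro sum.cong refl)
    fix m assume "m \<in> parts ?n"
    hence "keys m \<subseteq> {..b}"
      using lookup_parts[of m ?n] by (metis atMost_iff in_keys_iff not_less_eq_eq subsetI)
    hence "pdeg m = (\<Sum>i\<le>b. (i + 1) * lookup m i)" by (intro pdeg_altdef) auto
    thus "of_nat (pdeg m) * T m = (\<Sum>i\<le>b. of_nat (Suc i) * (of_nat (lookup m i) * T m))"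
      by (simp add: sum_distrib_left sum_distrib_right algebra_simps)
  qed
  also have "\<dots> = (\<Sum>i\<le>b. of_nat (Suc i) * (\<Sum>m\<in>parts ?n. of_nat (lookup m i) * T m))"
    by (subst sum.swap) (simp add: sum_distrib_left)
  also have "\<dots> = (\<Sum>i\<le>b. of_nat (Suc i) * (cf i * A i (expcoef A cf (b - i) v) k))"
    by (intro sum.cong refl) (simp only: 1 atMost_iff)
  finally show ?thesis by (simp add: mult.assoc)
qed

lemma vlin_hm: "vlin (hm n)"
  unfolding vlin_def
proof (intro allI impI ext, clarify)
  fix S :: "(nat \<Rightarrow>\<^sub>0 nat) set" and c w m p
  show "hm n (\<lambda>k. \<Sum>x\<in>S. c x * w x k) (m, p) = (\<Sum>x\<in>S. c x * hm n (w x) (m, p))"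
    by (auto simp: hm_def sum_distrib_left mult_ac intro!: sum.cong)
qed

lemma hm_neg_commute: "hm (- int i - 1) (hm (- int j - 1) v) = hm (- int j - 1) (hm (- int i - 1) v)"
  by (cases "i = j", simp)
     (auto simp: hm_def fun_eq_iff lookup_minus lookup_single when_def diff_diff_add add.commute)

lemma hm_pos_commute: "hm (int i + 1) (hm (int j + 1) v) = hm (int j + 1) (hm (int i + 1) v)"
  by (cases "i = j", simp)
     (auto simp: hm_def fun_eq_iff lookup_add lookup_single when_def add_ac mult_ac)

lemma Eminus_mk: "Eminus j a (mk G) = mk (\<lambda>m. Hs j a * G m)"
proof (induction a rule: less_induct)
  case (less a)
  show ?case
  proof (cases a)
    case 0
    thus ?thesis by (simp add: Eminus_def expcoef_0)
  next
    case (Suc b)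
    have "of_nat (Suc b) * Eminus j (Suc b) (mk G) (m, p) =
       of_nat (Suc b) * mk (\<lambda>m. Hs j (Suc b) * G m) (m, p)" for m p
    proof -
      have "of_nat (Suc b) * Eminus j (Suc b) (mk G) (m, p) =
         (\<Sum>i\<le>b. of_nat (Suc i) * (of_int j / of_nat (i + 1)) * hm (- int i - 1) (Eminus j (b - i) (mk G)) (m, p))"
        unfolding Eminus_def by (rule expcoef_Suc[OF hm_neg_commute vlin_hm])
      also have "\<dots> = (\<Sum>i\<le>b. of_int j * lookup (pvar i * (Hs j (b - i) * G m)) p)"
        using less Suc by (intro sum.cong refl) (simp add: hm_neg_mk del: of_nat_Suc)
      also have "\<dots> = lookup (sc (of_int j) * (\<Sum>i\<le>b. pvar i * Hs j (b - i)) * G m) p"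
        by (simp only: mult.assoc lookup_sc_mult sum_distrib_right lookup_sum sum_distrib_left)
      also have "sc (of_int j) * (\<Sum>i\<le>b. pvar i * Hs j (b - i)) * G m = sc (of_nat (Suc b)) * (Hs j (Suc b) * G m)"
        using Hs_Suc[of b j] by (simp only: sc_simps mult.assoc[symmetric])
      finally show ?thesis by (simp only: lookup_sc_mult mk_apply)
    qed
    thus ?thesis unfolding Suc fun_eq_iff by (auto simp del: of_nat_Suc Hs.simps)
  qed
qed

lemma Eplus_mk: "Eplus j b (mk G) = mk (\<lambda>m. Ep j b (G m))"
proof (induction b rule: less_induct)
  case (less a)
  show ?case
  proof (cases a)
    case 0
    thus ?thesis by (simp add: Eplus_def expcoef_0)
  next
    case (Suc b)
    have "of_nat (Suc b) * Eplus j (Suc b) (mk G) (m, p) =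
       of_nat (Suc b) * mk (\<lambda>m. Ep j (Suc b) (G m)) (m, p)" for m p
    proof -
      have "of_nat (Suc b) * Eplus j (Suc b) (mk G) (m, p) =
         (\<Sum>i\<le>b. of_nat (Suc i) * (- of_int j / of_nat (i + 1)) * hm (int i + 1) (Eplus j (b - i) (mk G)) (m, p))"
        unfolding Eplus_def by (rule expcoef_Suc[OF hm_pos_commute vlin_hm])
      also have "\<dots> = (\<Sum>i\<le>b. - of_int j * lookup (ann i (Ep j (b - i) (G m))) p)"
      proof (intro sum.cong refl)
        fix i assume "i \<in> {..b}"
        hence "hm (int i + 1) (Eplus j (b - i) (mk G)) = mk (\<lambda>m. ann i (Ep j (b - i) (G m)))"
          using less Suc hm_nonneg_mk[of "Suc i"] by (simp add: heis_def add.commute)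
        thus "of_nat (Suc i) * (- of_int j / of_nat (i + 1)) * hm (int i + 1) (Eplus j (b - i) (mk G)) (m, p)
          = - of_int j * lookup (ann i (Ep j (b - i) (G m))) p"
          by (simp del: of_nat_Suc)
      qed
      also have "\<dots> = lookup (sc (- of_int j) * (\<Sum>i\<le>b. ann i (Ep j (b - i) (G m)))) p"
        by (simp only: lookup_sc_mult lookup_sum sum_distrib_left)
      also have "sc (- of_int j) * (\<Sum>i\<le>b. ann i (Ep j (b - i) (G m))) = sc (of_nat (Suc b)) * Ep j (Suc b) (G m)"
        using Ep_Suc[of b j "G m"] by (simp only: sc_simps)
      finally show ?thesis by (simp only: lookup_sc_mult mk_apply)
    qed
    thus ?thesis unfolding Suc fun_eq_iff by (auto simp del: of_nat_Suc Ep.simps)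
  qed
qed

subsection \<open>Vertex operators\<close>

definition pt :: "int \<Rightarrow> pol \<Rightarrow> int \<Rightarrow> pol" where
  "pt m g = (\<lambda>m'. if m' = m then g else 0)"

lemma pt_same [simp]: "pt m g m = g"
  by (simp add: pt_def)

lemma delta_mk: "delta (m, p) = mk (pt m (single p 1))"
proof (rule ext, clarify)
  fix m' p'
  show "delta (m, p) (m', p') = mk (pt m (single p 1)) (m', p')"
    by (cases "m' = m") (auto simp: delta_def pt_def lookup_single when_def)
qed

lemma vacuum_mk: "vacuum = mk (pt 0 1)"
  by (simp add: vacuum_def delta_mk)

lemma wt_single [simp]: "wt (single p 1) = pdeg p"
  by (simp add: wt_def)

definition EM :: "int \<Rightarrow> int \<Rightarrow> int \<Rightarrow> pol \<Rightarrow> pol" where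
  "EM j N m g = (\<Sum>b\<le>wt g. (let a2 = 2 * int b - j * m - N - 2 in
     if even a2 \<and> a2 \<ge> 0 then Hs j (nat (a2 div 2)) * Ep j b g else 0))"

lemma EM_eq:
  assumes "wle (int D) g"
  shows "EM j N m g = (\<Sum>b\<le>D. (let a2 = 2 * int b - j * m - N - 2 in
     if even a2 \<and> a2 \<ge> 0 then Hs j (nat (a2 div 2)) * Ep j b g else 0))"
  unfolding EM_def
  by (rule sum_atMost_extend[symmetric]) (use assms wt_le Ep_eq_0[OF wle_wt] in \<open>auto simp: Let_def\<close>)

lemma linop_EM: "linop (EM j N m)"
proof (rule linopI)
  fix f g
  obtain D where D: "wle (int D) f" "wle (int D) g" "wle (int D) (f + g)" by (rule common_wle)
  show "EM j N m (f + g) = EM j N m f + EM j N m g"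
    unfolding EM_eq[OF D(1)] EM_eq[OF D(2)] EM_eq[OF D(3)] sum.distrib[symmetric] Let_def
    by (intro sum.cong refl) (auto simp: EpD ring_distribs)
next
  fix c f
  have D: "wle (int (wt f)) (sc c * f)" by (intro wle_sc_mult wle_wt)
  show "EM j N m (sc c * f) = sc c * EM j N m f"
    unfolding EM_eq[OF D] EM_def[of _ _ _ f] sum_distrib_left Let_def
    by (intro sum.cong refl) (auto simp: EpD mult.left_commute)
qed

lemma ebasis_mk: "ebasis j N (m, p) = mk (pt (m + j) (EM j N m (single p 1)))"
proof (rule ext, clarify)
  fix M q
  have E: "Eminus j a (Eplus j b (delta (m + j, p))) =
      mk (pt (m + j) (Hs j a * Ep j b (single p 1)))" for a b
    by (auto simp: delta_mk Eplus_mk Eminus_mk pt_def fun_eq_iff EpD)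
  show "ebasis j N (m, p) (M, q) = mk (pt (m + j) (EM j N m (single p 1))) (M, q)"
    unfolding ebasis_def EM_def wt_single
    by (auto simp: E pt_def lookup_sum atLeast0AtMost Let_def intro!: sum.cong sum.neutral)
qed

lemma linop_expand:
  assumes "linop L"
  shows "L g = (\<Sum>p\<in>keys g. sc (lookup g p) * L (single p 1))"
proof -
  have "L g = L (\<Sum>p\<in>keys g. sc (lookup g p) * single p 1)"
    by (subst poly_mapping_sum_singles[of g]) (simp add: single_eq_sc[symmetric])
  thus ?thesis by (simp add: linopD[OF assms])
qed

lemma emode_mk:
  assumes "finite (chs G)"
  shows "emode j N (mk G) = mk (\<lambda>M. EM j N (M - j) (G (M - j)))"
proof (rule ext, clarify)
  fix M q
  have "emode j N (mk G) (M, q) =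
     (\<Sum>m\<in>chs G. \<Sum>p\<in>keys (G m). lookup (G m) p * ebasis j N (m, p) (M, q))"
    unfolding emode_def supp_mk using assms by (subst sum.Sigma) (auto intro!: sum.cong)
  also have "\<dots> = (\<Sum>m\<in>chs G. if m = M - j then lookup (EM j N m (G m)) q else 0)"
  proof (intro sum.cong refl)
    fix m
    show "(\<Sum>p\<in>keys (G m). lookup (G m) p * ebasis j N (m, p) (M, q)) =
       (if m = M - j then lookup (EM j N m (G m)) q else 0)"
    proof (cases "m = M - j")
      case True
      thus ?thesis
        by (subst linop_expand[OF linop_EM, of _ _ _ "G m"]) (simp add: ebasis_mk lookup_sum)
    qed (auto simp: ebasis_mk pt_def intro!: sum.neutral)
  qed
  also have "\<dots> = lookup (EM j N (M - j) (G (M - j))) q"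
    using assms by (simp add: linopD[OF linop_EM])
  finally show "emode j N (mk G) (M, q) = mk (\<lambda>M. EM j N (M - j) (G (M - j))) (M, q)" by simp
qed

text \<open>For even jm the powers of z are integral and the modes are coefficients of a Laurent
  series. An odd jm occurs in the outer operator of \<open>phi\<close>, which is computed from
  \<open>EM\<close> directly.\<close>

lemma EM_even:
  assumes "even (j * m)"
  shows "EM j (2 * n) m g = fls_nth (bop j m g) (- n - 1)"
proof -
  obtain q where q: "j * m = 2 * q" using assms by blast
  have "fls_nth (bop j m g) (- n - 1) = (\<Sum>d\<le>wt g. HZ j (- n - 1 - q + int d) * Ep j d g)"
    unfolding bop_def vop_def gop_def fls_nth_sum
    by (intro sum.cong refl) (simp add: fls_mult_const_nth Kser_nth q algebra_simps)
  also have "\<dots> = EM j (2 * n) m g"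
    unfolding EM_def Let_def
  proof (intro sum.cong refl)
    fix d
    define x where "x = - n - 1 - q + int d"
    have "2 * int d - j * m - 2 * n - 2 = 2 * x" by (simp add: q x_def)
    thus "HZ j (- n - 1 - q + int d) * Ep j d g =
      (if even (2 * int d - j * m - 2 * n - 2) \<and> 0 \<le> 2 * int d - j * m - 2 * n - 2
          then Hs j (nat ((2 * int d - j * m - 2 * n - 2) div 2)) * Ep j d g else 0)"
      unfolding x_def[symmetric] by (simp add: HZ_def)
  qed
  finally show ?thesis ..
qed

lemma evlimI: "(\<And>M. M \<ge> N \<Longrightarrow> f M = x) \<Longrightarrow> evlim f = x"
  unfolding evlim_def
proof (rule the_equality)
  show "\<exists>N. \<forall>M\<ge>N. f M = x" if "\<And>M. M \<ge> N \<Longrightarrow> f M = x" using that by blast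
  fix y assume N: "\<And>M. M \<ge> N \<Longrightarrow> f M = x" and "\<exists>N. \<forall>M\<ge>N. f M = y"
  then obtain N' where "\<forall>M\<ge>N'. f M = y" by blast
  thus "y = x" using N[of "max N N'"] by simp
qed

lemma gchoose_neg_Suc: "(-1) ^ l * ((- of_nat (Suc i) :: complex) gchoose l) = of_nat ((i + l) choose l)"
proof -
  have "(- of_nat (Suc i) :: complex) gchoose l = (-1) ^ l * (of_nat (Suc i) + of_nat l - 1 gchoose l)"
    by (subst gbinomial_minus) simp
  also have "(of_nat (Suc i) + of_nat l - 1 :: complex) = of_nat (i + l)" by simp
  finally show ?thesis by (simp add: binomial_gbinomial mult.assoc[symmetric] flip: power_mult_distrib)
qed

text \<open>The partial sums are eventually constant, as \<open>evlim\<close> requires. The first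
  summand collects the creation part of the i-th Hasse derivative of varpi(z), cut off because F g
  has a lowest power; the second collects the annihilation part, cut off by the weight of g.\<close>

lemma iterate_formula:
  assumes F: "linF F"
  shows "\<exists>N. \<forall>I\<ge>N. (\<Sum>l\<le>I. sc (of_nat ((i + l) choose l)) *
      (pvar (i + l) * fls_nth (F g) (- (n + int l) - 1) +
        sc ((-1) ^ i) * fls_nth (F (heis m l g)) (- (- int i - 1 + n - int l) - 1))) =
      fls_nth (Nop m i F g) (- n - 1)"
proof -
  obtain N0 where N0: "\<forall>a<N0. fls_nth (F g) a = 0" by (elim fls_nth_vanishes_belowE)
  define N where "N = max (wt g) (nat (- n - 1 - N0))"
  show ?thesis
  proof (intro exI[of _ N] allI impI)
    fix I assume I: "N \<le> I"
    have 1: "fls_nth (hasse i Aser * F g) (- n - 1) =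
       (\<Sum>l\<le>I. sc (of_nat ((i + l) choose l)) * (pvar (i + l) * fls_nth (F g) (- (n + int l) - 1)))"
    proof -
      have A: "fls_nth (hasse i Aser) (int l) = sc (of_nat ((i + l) choose l)) * pvar (i + l)" for l
      proof -
        have "((of_int (int l) + of_nat i :: complex) gchoose i) = of_nat ((i + l) choose l)"
          using binomial_symmetric[of l "i + l"] by (simp add: binomial_gbinomial add.commute)
        thus ?thesis by (simp add: Aser_def nat_add_distrib add.commute del: sc_simps)
      qed
      have "fls_nth (hasse i Aser) a = 0" if "a < 0" for a
        by (rule hasse_low[OF _ that]) (simp add: Aser_def)
      hence "fls_nth (hasse i Aser * F g) (- n - 1) =
         (\<Sum>a\<in>{0..- n - 1 - N0}. fls_nth (hasse i Aser) a * fls_nth (F g) (- n - 1 - a))"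
        by (rule fls_times_nth_bounds) (use N0 in auto)
      also have "\<dots> = (\<Sum>a\<in>int ` {..I}. fls_nth (hasse i Aser) a * fls_nth (F g) (- n - 1 - a))"
      proof (rule sum.mono_neutral_left)
        have "- n - 1 - N0 \<le> int I" using I by (auto simp: N_def nat_le_iff)
        thus "{0..- n - 1 - N0} \<subseteq> int ` {..I}"
          by (auto simp: image_iff intro!: bexI[of _ "nat _"])
        show "\<forall>a\<in>int ` {..I} - {0..- n - 1 - N0}. fls_nth (hasse i Aser) a * fls_nth (F g) (- n - 1 - a) = 0"
          using N0 by auto
      qed simp
      also have "\<dots> = (\<Sum>l\<le>I. fls_nth (hasse i Aser) (int l) * fls_nth (F g) (- n - 1 - int l))"
        by (subst sum.reindex) auto
      finally show ?thesis by (simp only: A) (simp add: algebra_simps)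
    qed
    have 2: "(\<Sum>l\<le>wt g. fls_nth (hasse i (Xp (- int l - 1)) * F (heis m l g)) (- n - 1)) =
       (\<Sum>l\<le>I. sc (of_nat ((i + l) choose l)) * (sc ((-1) ^ i) * fls_nth (F (heis m l g)) (- (- int i - 1 + n - int l) - 1)))"
    proof -
      have X: "hasse i (Xp (- int l - 1)) = C (of_nat ((i + l) choose l) * (-1) ^ i) * Xp (- int l - 1 - int i)" for l
      proof (rule fls_eqI)
        fix a
        show "fls_nth (hasse i (Xp (- int l - 1))) a = fls_nth (C (of_nat ((i + l) choose l) * (-1) ^ i) * Xp (- int l - 1 - int i)) a"
        proof (cases "a + int i = - int l - 1")
          case True
          have "(of_int a + of_nat i :: complex) = of_int (a + int i)" by simp
          also have "\<dots> = - of_nat (Suc l)" unfolding True by simp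
          finally have e: "(of_int a + of_nat i :: complex) = - of_nat (Suc l)" .
          have "((- of_nat (Suc l) :: complex) gchoose i) = (-1) ^ i * ((-1) ^ i * ((- of_nat (Suc l) :: complex) gchoose i))"
            by (simp add: mult.assoc[symmetric] flip: power_mult_distrib)
          also have "\<dots> = (-1) ^ i * of_nat ((i + l) choose l)"
            by (simp only: gchoose_neg_Suc) (metis add.commute binomial_symmetric diff_add_inverse le_add1)
          finally show ?thesis using True by (simp add: C_nth_mult e mult.commute del: sc_simps of_nat_Suc)
        next
          case False
          hence "a \<noteq> - int l - 1 - int i" by simp
          thus ?thesis using False by (simp add: C_nth_mult)
        qed
      qed
      have "(\<Sum>l\<le>wt g. fls_nth (hasse i (Xp (- int l - 1)) * F (heis m l g)) (- n - 1)) =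
            (\<Sum>l\<le>I. fls_nth (hasse i (Xp (- int l - 1)) * F (heis m l g)) (- n - 1))"
        by (rule sum_atMost_extend[symmetric])
           (use I heis_eq_0[OF wle_wt] in \<open>auto simp: N_def linFD(3)[OF F]\<close>)
      also have "\<dots> = (\<Sum>l\<le>I. sc (of_nat ((i + l) choose l)) * (sc ((-1) ^ i) * fls_nth (F (heis m l g)) (- (- int i - 1 + n - int l) - 1)))"
        unfolding X mult.assoc fls_X_intpow_times_conv_shift(1) C_nth_mult fls_shift_nth
        by (intro sum.cong refl) (simp add: algebra_simps)
      finally show ?thesis .
    qed
    show "(\<Sum>l\<le>I. sc (of_nat ((i + l) choose l)) *
      (pvar (i + l) * fls_nth (F g) (- (n + int l) - 1) +
        sc ((-1) ^ i) * fls_nth (F (heis m l g)) (- (- int i - 1 + n - int l) - 1))) =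
      fls_nth (Nop m i F g) (- n - 1)"
      unfolding Nop_def gop_def fls_plus_nth fls_nth_sum 1 2 ring_distribs sum.distrib ..
  qed
qed

lemma Yr_mk:
  assumes "even j" "good G" "tdeg p = r"
  shows "Yr r (j, p) n (mk G) =
     mk (\<lambda>M. fls_nth (NM (M - j) p (bop j (M - j)) (G (M - j))) (- n - 1))"
  using assms(2,3)
proof (induction r arbitrary: p n G)
  case 0
  have p: "p = 0" using tdeg_minus_sg[OF lookup_Min_keys, of p] 0 by fastforce
  have "finite (chs G)" using 0 by (simp add: good_def)
  thus ?case using assms(1) by (simp add: p emode_mk EM_even)
next
  case (Suc r)
  hence p: "p \<noteq> 0" by auto
  define i where "i = Min (keys p)"
  define w where "w = p - sg i"
  define Fm where "Fm = (\<lambda>m. NM m w (bop j m))"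
  have F: "linF (Fm m)" for m unfolding Fm_def by (intro linF_NM linF_bop)
  have tw: "tdeg w = r" using tdeg_minus_sg[OF lookup_Min_keys[OF p]] Suc by (simp add: w_def i_def)
  have IH: "Yr r (j, w) n (mk G') = mk (\<lambda>M. fls_nth (Fm (M - j) (G' (M - j))) (- n - 1))" if "good G'" for n G'
    unfolding Fm_def by (rule Suc.IH[OF that tw])
  let ?P = "\<lambda>I k'. \<Sum>l\<le>I. (-1) ^ l * (of_int (- (int i + 1)) gchoose l) *
      (hm (- (int i + 1) - int l) (Yr r (j, w) (n + int l) (mk G)) k'
       - (-1) ^ nat (int i + 1) * Yr r (j, w) (- (int i + 1) + n - int l) (hm (int l) (mk G)) k')"
  define S where "S = (\<lambda>I m. \<Sum>l\<le>I. sc (of_nat ((i + l) choose l)) *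
      (pvar (i + l) * fls_nth (Fm m (G m)) (- (n + int l) - 1) +
        sc ((-1) ^ i) * fls_nth (Fm m (heis m l (G m))) (- (- int i - 1 + n - int l) - 1)))"
  have "\<forall>m. \<exists>N. \<forall>I\<ge>N. S I m = fls_nth (Nop m i (Fm m) (G m)) (- n - 1)"
    unfolding S_def using iterate_formula[OF F] by blast
  then obtain N where N: "\<And>m I. I \<ge> N m \<Longrightarrow> S I m = fls_nth (Nop m i (Fm m) (G m)) (- n - 1)"
    by metis
  have fin: "finite (chs G)" using Suc by (simp add: good_def)
  \<comment> \<open>Each charge has its own threshold; finitely many charges occur, and on the
    others all terms vanish.\<close>
  define N' where "N' = Max (insert 0 (N ` chs G))"
  have S: "S I m = fls_nth (Nop m i (Fm m) (G m)) (- n - 1)" if "I \<ge> N'" for I m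
  proof (cases "G m = 0")
    case True
    thus ?thesis
      by (simp add: S_def linFD(3)[OF F] linFD(3)[OF linF_Nop[OF F]] linopD(3)[OF linop_heis])
  next
    case False
    hence "N m \<le> N'" using fin by (auto simp: N'_def intro!: Max_ge)
    thus ?thesis using N that by simp
  qed
  have "Yr (Suc r) (j, p) n (mk G) = evlim ?P"
    by (simp only: Yr.simps snd_conv fst_conv p if_False Let_def i_def[symmetric] w_def sg_def)
  also have "\<dots> = mk (\<lambda>M. fls_nth (Nop (M - j) i (Fm (M - j)) (G (M - j))) (- n - 1))"
  proof (rule evlimI[of N'], rule ext, clarify)
    fix I M q assume I: "I \<ge> N'"
    have c: "(-1) ^ l * (of_int (- (int i + 1)) gchoose l) = (of_nat ((i + l) choose l) :: complex)" for l
      using gchoose_neg_Suc[of l i] by (simp add: algebra_simps)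
    have h: "hm (- (int i + 1) - int l) (Yr r (j, w) (n + int l) (mk G)) (M, q) =
       lookup (pvar (i + l) * fls_nth (Fm (M - j) (G (M - j))) (- (n + int l) - 1)) q" for l
    proof -
      have e: "- (int i + 1) - int l = - int (i + l) - 1" by simp
      show ?thesis unfolding e IH[OF Suc.prems(1)] hm_neg_mk by simp
    qed
    have y: "Yr r (j, w) (- (int i + 1) + n - int l) (hm (int l) (mk G)) (M, q) =
       lookup (fls_nth (Fm (M - j) (heis (M - j) l (G (M - j)))) (- (- int i - 1 + n - int l) - 1)) q" for l
      unfolding hm_nonneg_mk IH[OF good_hm[OF Suc.prems(1)]] by simp
    \<comment> \<open>Turns the difference in the iterate formula into the sum in
      \<open>S\<close>.\<close>
    have s: "(-1::complex) ^ nat (int i + 1) = - ((-1) ^ i)"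
      by (simp add: nat_add_distrib)
    have "?P I (M, q)
        = lookup (S I (M - j)) q"
      unfolding c h y s S_def lookup_sum lookup_sc_mult lookup_add by simp
    also have "\<dots> = mk (\<lambda>M. fls_nth (Nop (M - j) i (Fm (M - j)) (G (M - j))) (- n - 1)) (M, q)"
      using S[OF I] by simp
    finally show "?P I (M, q)
        = mk (\<lambda>M. fls_nth (Nop (M - j) i (Fm (M - j)) (G (M - j))) (- n - 1)) (M, q)" .
  qed
  also have "\<dots> = mk (\<lambda>M. fls_nth (NM (M - j) p (bop j (M - j)) (G (M - j))) (- n - 1))"
    by (simp add: NM_rec[OF p i_def] Fm_def w_def)
  finally show ?case .
qed

text \<open>The n-th product of f e^(j varpi) with g e^(m varpi), the factor e^((j+m) varpi) being
  left implicit.\<close>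

definition prodn :: "int \<Rightarrow> int \<Rightarrow> int \<Rightarrow> pol \<Rightarrow> pol \<Rightarrow> pol" where
  "prodn n j m f g = fls_nth (NA m f (bop j m) g) (- n - 1)"

theorem vmode_mk:
  assumes "good V" "good G"
  shows "vmode (mk V) n (mk G) = mk (\<lambda>M. \<Sum>j\<in>chs V. prodn n j (M - j) (V j) (G (M - j)))"
proof (rule ext, clarify)
  fix M q
  have fin: "finite (chs V)" using assms by (simp add: good_def)
  have "vmode (mk V) n (mk G) (M, q) =
     (\<Sum>j\<in>chs V. \<Sum>p\<in>keys (V j). lookup (V j) p * Ybasis (j, p) n (mk G) (M, q))"
    unfolding vmode_def supp_mk using fin by (subst sum.Sigma) (auto intro!: sum.cong)
  also have "\<dots> = (\<Sum>j\<in>chs V. lookup (prodn n j (M - j) (V j) (G (M - j))) q)"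
  proof (intro sum.cong refl)
    fix j assume "j \<in> chs V"
    hence j: "even j" using assms by (auto simp: good_def)
    have Y: "Ybasis (j, p) n (mk G) (M, q) =
        lookup (fls_nth (NM (M - j) p (bop j (M - j)) (G (M - j))) (- n - 1)) q" for p
      using Yr_mk[OF j assms(2) refl, of p n] by (simp add: Ybasis_def tdeg_def)
    show "(\<Sum>p\<in>keys (V j). lookup (V j) p * Ybasis (j, p) n (mk G) (M, q)) =
       lookup (prodn n j (M - j) (V j) (G (M - j))) q"
      unfolding Y prodn_def NA_def fls_nth_sum C_nth_mult lookup_sum lookup_sc_mult ..
  qed
  finally show "vmode (mk V) n (mk G) (M, q) =
      mk (\<lambda>M. \<Sum>j\<in>chs V. prodn n j (M - j) (V j) (G (M - j))) (M, q)"
    by (simp add: lookup_sum)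
qed

section \<open>Spans of words in the modes of the vertex operators\<close>

text \<open>Since \<open>Hs s 0 = 1\<close>, the number \<open>t\<close> only bounds the degree in the coefficients of \<open>H\<^sup>s\<close>; likewise \<open>N\<close>
  bounds the weight.\<close>

inductive Wd :: "int \<Rightarrow> nat \<Rightarrow> nat \<Rightarrow> pol \<Rightarrow> bool" for s where
  base: "Wd s 0 N (sc c)"
| step: "Wd s t N x \<Longrightarrow> Wd s (Suc t) (N + c) (Hs s c * x)"
| add: "Wd s t N x \<Longrightarrow> Wd s t N y \<Longrightarrow> Wd s t N (x + y)"

lemma Wd_mono: "Wd s t N x \<Longrightarrow> N \<le> M \<Longrightarrow> Wd s t M x"
proof (induction arbitrary: M rule: Wd.induct)
  case (step t N x c)
  hence "Wd s t (M - c) x" by simp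
  from Wd.step[OF this, of c] step show ?case by simp
qed (auto intro: Wd.intros)

lemma Wd_scale: "Wd s t N x \<Longrightarrow> Wd s t N (sc a * x)"
proof (induction rule: Wd.induct)
  case (base N c)
  thus ?case using Wd.base[of s N "a * c"] by simp
next
  case (step t N x c)
  from Wd.step[OF this(2), of c] show ?case by (simp add: mult.left_commute)
next
  case (add t N x y)
  thus ?case by (simp add: ring_distribs Wd.add)
qed

lemma Wd_0: "Wd s t N 0"
proof (induction t)
  case 0
  thus ?case using Wd.base[of s N 0] by simp
next
  case (Suc t)
  from Wd.step[OF this, of 0] show ?case by simp
qed

lemma Wd_Suc: "Wd s t N x \<Longrightarrow> Wd s (Suc t) N x"
  using Wd.step[of s t N x 0] by simp

definition WZ :: "int \<Rightarrow> nat \<Rightarrow> int \<Rightarrow> pol \<Rightarrow> bool" where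
  "WZ s t n x \<longleftrightarrow> (if n < 0 then x = 0 else Wd s t (nat n) x)"

lemma WZ_0: "WZ s t n 0" and WZ_scale: "WZ s t n x \<Longrightarrow> WZ s t n (sc a * x)"
  and WZ_add: "WZ s t n x \<Longrightarrow> WZ s t n y \<Longrightarrow> WZ s t n (x + y)"
  by (auto simp: WZ_def intro: Wd_0 Wd_scale Wd.add)

lemma WZ_sum: "(\<And>i. i \<in> A \<Longrightarrow> WZ s t n (f i)) \<Longrightarrow> WZ s t n (sum f A)"
  by (induction A rule: infinite_finite_induct) (auto intro: WZ_0 WZ_add)

lemma WZ_step: "WZ s t n x \<Longrightarrow> WZ s (Suc t) (n + c) (HZ s c * x)"
proof (cases "c < 0 \<or> n < 0")
  case False
  assume "WZ s t n x"
  with False have "Wd s (Suc t) (nat n + nat c) (Hs s (nat c) * x)"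
    by (intro Wd.step) (auto simp: WZ_def)
  thus ?thesis using False by (simp add: WZ_def HZ_def nat_add_distrib)
qed (auto simp: WZ_def intro: Wd_0)

text \<open>By the contraction rule an annihilation operator only lowers the indices of the letters:
  the number of letters is kept and the weight drops by b.\<close>

lemma WZ_EZ: "Wd t k N x \<Longrightarrow> WZ t k (int N - b) (EZ s b x)"
proof (induction arbitrary: b rule: Wd.induct)
  case (base N c)
  have "b = 0 \<or> EZ s b (sc c) = 0" by (auto simp: EZ_def Ep_sc)
  thus ?case using WZ_0 by (auto simp: WZ_def intro: Wd.base)
next
  case (step k N x c)
  have "EZ s b (HZ t (int c) * x) =
    (\<Sum>i\<le>c. sc (kap (of_int (s * t) / 2) i) * (HZ t (int c - int i) * EZ s (b - int i) x))"
    by (rule EZ_HZ) simp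
  moreover have "WZ t (Suc k) (int (N + c) - b) (HZ t (int c - int i) * EZ s (b - int i) x)" for i
    using WZ_step[OF step.IH[of "b - int i"], of "int c - int i"] by (simp add: algebra_simps)
  ultimately show ?case by (auto intro!: WZ_sum WZ_scale)
next
  case (add k N x y)
  thus ?case by (simp add: EZD WZ_add)
qed

lemma Wd_Ep: "Wd t k N x \<Longrightarrow> Wd t k (N - d) (Ep s d x)"
  using WZ_EZ[of t k N x "int d" s] by (cases "d \<le> N") (auto simp: WZ_def nat_diff_distrib' Wd_0)

definition Ws :: "int \<Rightarrow> nat \<Rightarrow> pol \<Rightarrow> bool" where
  "Ws s t x \<longleftrightarrow> (\<exists>N. Wd s t N x)"

lemma Ws_add: "Ws s t x \<Longrightarrow> Ws s t y \<Longrightarrow> Ws s t (x + y)"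
  unfolding Ws_def by (meson Wd.add Wd_mono nat_le_linear)

lemma Ws_0: "Ws s t 0" and Ws_sc: "Ws s 0 (sc a)"
  unfolding Ws_def by (rule exI, rule Wd_0) (rule exI, rule Wd.base)

lemma Ws_scale: "Ws s t x \<Longrightarrow> Ws s t (sc a * x)"
  unfolding Ws_def by (erule exE, rule exI, rule Wd_scale)

lemma Ws_Ep: "Ws s t x \<Longrightarrow> Ws s t (Ep s' d x)"
  unfolding Ws_def by (erule exE, rule exI, rule Wd_Ep)

lemma Ws_Suc: "Ws s t x \<Longrightarrow> Ws s (Suc t) x"
  unfolding Ws_def by (erule exE, rule exI, rule Wd_Suc)

lemma Ws_Hs: "Ws s t x \<Longrightarrow> Ws s (Suc t) (Hs s c * x)"
  unfolding Ws_def by (erule exE, rule exI, rule Wd.step)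

lemma Ws_HZ: "Ws s t x \<Longrightarrow> Ws s (Suc t) (HZ s c * x)"
  by (auto simp: HZ_def Ws_0 Ws_Hs)

lemma Ws_sum: "(\<And>i. i \<in> A \<Longrightarrow> Ws s t (f i)) \<Longrightarrow> Ws s t (sum f A)"
  by (induction A rule: infinite_finite_induct) (auto intro: Ws_0 Ws_add)

lemma Ws_word: "Ws s (length ks) (prod_list (map (Hs s) ks))"
  using Ws_sc[of s 1] by (induction ks) (auto intro: Ws_Hs)

lemma Ws_induct [consumes 1, case_names word add scale]:
  assumes "Ws s t x"
    and word: "\<And>ks. length ks = t \<Longrightarrow> P (prod_list (map (Hs s) ks))"
    and add: "\<And>x y. P x \<Longrightarrow> P y \<Longrightarrow> P (x + y)"
    and scale: "\<And>c x. P x \<Longrightarrow> P (sc c * x)"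
  shows "P x"
proof -
  from assms(1) obtain N where "Wd s t N x" by (auto simp: Ws_def)
  \<comment> \<open>Letters already removed are carried along in \<open>ls\<close>, because P is not
    assumed to be stable under multiplication by a letter.\<close>
  hence "P (prod_list (map (Hs s) ls) * x)" if "\<And>ks. length ks = length ls + t \<Longrightarrow> P (prod_list (map (Hs s) ks))" for ls
    using that
  proof (induction arbitrary: ls rule: Wd.induct)
    case (base N c)
    thus ?case using scale[of "prod_list (map (Hs s) ls)" c] by (simp add: mult.commute)
  next
    case (step t N x c)
    have "P (prod_list (map (Hs s) (ls @ [c])) * x)"
      by (rule step.IH) (use step.prems in simp)
    thus ?case by (simp add: mult.assoc)
  next
    case (add t N x y)
    thus ?case by (simp add: ring_distribs assms(3))
  qed
  from this[of "[]"] word show ?thesis by simp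
qed

lemma Kser_low: "i < q - int k \<Longrightarrow> fls_nth (Kser s q k) i = 0"
  by (simp add: Kser_nth)

lemma fls_low:
  fixes F :: ser
  obtains b where "\<And>i. i < b \<Longrightarrow> fls_nth F i = 0"
  using fls_nth_vanishes_belowE[of F] by blast

lemma Ws_Kser_mult:
  assumes "\<And>n. Ws s t (fls_nth F n)"
  shows "Ws s (Suc t) (fls_nth (Kser s q k * F) n)"
proof -
  obtain b where b: "\<And>i. i < b \<Longrightarrow> fls_nth F i = 0" by (rule fls_low[of F]) blast
  have "fls_nth (Kser s q k * F) n = (\<Sum>i\<in>{q - int k..n - b}. fls_nth (Kser s q k) i * fls_nth F (n - i))"
    by (rule fls_times_nth_bounds) (auto intro: Kser_low b)
  thus ?thesis
    by (auto simp: Kser_nth mult.assoc intro!: Ws_sum Ws_scale Ws_HZ assms)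
qed

lemma Ws_wop: "Ws s t g \<Longrightarrow> Ws s (t + length ls) (fls_nth (wop s m ls g) n)"
proof (induction ls arbitrary: g n)
  case Nil
  thus ?case by (simp add: Ws_0)
next
  case (Cons ke ls)
  thus ?case
    by (auto simp: vop_def gop_def fls_nth_sum intro!: Ws_sum Ws_Kser_mult Ws_Ep)
qed

subsection \<open>Commutation\<close>

text \<open>Operators depending on a second variable are applied one coefficient at a time, which
  avoids series in two variables.\<close>

definition cmap :: "(pol \<Rightarrow> pol) \<Rightarrow> ser \<Rightarrow> ser" where
  "cmap L F = Abs_fls (\<lambda>n. L (fls_nth F n))"

lemma cmap_nth: "linop L \<Longrightarrow> fls_nth (cmap L F) n = L (fls_nth F n)"
proof -
  assume L: "linop L"
  obtain b where b: "\<And>i. i < b \<Longrightarrow> fls_nth F i = 0" by (rule fls_low[of F]) blast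
  hence "\<forall>n<b. L (fls_nth F n) = 0" by (simp add: linopD[OF L])
  thus ?thesis unfolding cmap_def by (rule nth_Abs_fls_lower_bound)
qed

lemma cmap_sum: "linop L \<Longrightarrow> cmap L (sum f A) = (\<Sum>x\<in>A. cmap L (f x))"
  by (rule fls_eqI) (simp add: cmap_nth fls_nth_sum linopD)

lemma fls_nth_sum_list: "fls_nth (sum_list (map f xs)) n = (\<Sum>x\<leftarrow>xs. fls_nth (f x) n)"
  by (induction xs) auto

lemma linF_sum_list: "linF L \<Longrightarrow> L (sum_list (map f xs)) = (\<Sum>x\<leftarrow>xs. L (f x))"
  by (induction xs) (auto simp: linFD)

lemma sum_list_uminus: "(\<Sum>x\<leftarrow>xs. - f x) = - (\<Sum>x\<leftarrow>xs. f x :: 'a::ab_group_add)"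
  by (induction xs) auto

lemma sum_sum_list: "(\<Sum>i\<in>A. \<Sum>x\<leftarrow>xs. f i x) = (\<Sum>x\<leftarrow>xs. \<Sum>i\<in>A. f i x)"
  by (induction xs) (auto simp: sum.distrib)

text \<open>Lifts a crossing rule from the coefficients of H to the series: lowering an index by t
  is multiplication by the t-th power of the variable, which \<open>Kser\<close> absorbs into q
  under the Hasse derivative.\<close>

lemma cmap_Kser_mult:
  assumes L: "linop L" "\<And>x. linop (L' x)"
    and cross: "\<And>c y. L (HZ s c * y) = (\<Sum>x\<leftarrow>xs. sc (u x) * (HZ s (c - int (t x)) * L' x y))"
  shows "cmap L (Kser s q k * F) = (\<Sum>x\<leftarrow>xs. C (u x) * (Kser s (q + int (t x)) k * cmap (L' x) F))"
proof (rule fls_eqI)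
  fix n
  obtain b where b: "\<And>i. i < b \<Longrightarrow> fls_nth F i = 0" by (rule fls_low[of F]) blast
  have b': "fls_nth (cmap (L' x) F) i = 0" if "i < b" for i x
    using b[OF that] by (simp add: cmap_nth L linopD[OF L(2)])
  have low: "fls_nth (Kser s (q + int j) k) i = 0" if "i < q - int k" for i j
    by (rule Kser_low) (use that in simp)
  let ?J = "{q - int k..n - b}"
  have "fls_nth (cmap L (Kser s q k * F)) n = (\<Sum>i\<in>?J. L (fls_nth (Kser s q k) i * fls_nth F (n - i)))"
    by (simp add: cmap_nth[OF L(1)] fls_times_nth_bounds[of "q - int k" "Kser s q k" b, OF Kser_low b] linopD(6)[OF L(1)])
  also have "\<dots> = (\<Sum>i\<in>?J. \<Sum>x\<leftarrow>xs. sc (u x) * (fls_nth (Kser s (q + int (t x)) k) i * fls_nth (cmap (L' x) F) (n - i)))"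
  proof (intro sum.cong refl)
    fix i
    have "L (fls_nth (Kser s q k) i * fls_nth F (n - i)) =
       sc ((of_int i + of_nat k) gchoose k) * L (HZ s (i + int k - q) * fls_nth F (n - i))"
      by (simp add: Kser_nth mult.assoc linopD(2)[OF L(1)])
    also have "\<dots> = (\<Sum>x\<leftarrow>xs. sc (u x) * (fls_nth (Kser s (q + int (t x)) k) i * fls_nth (cmap (L' x) F) (n - i)))"
      unfolding cross sum_list_const_mult[symmetric]
      by (intro arg_cong[where f = sum_list] map_cong refl)
         (simp add: Kser_nth cmap_nth[OF L(2)] diff_diff_eq mult_ac)
    finally show "L (fls_nth (Kser s q k) i * fls_nth F (n - i)) = \<dots>" .
  qed
  also have "\<dots> = (\<Sum>x\<leftarrow>xs. sc (u x) * (\<Sum>i\<in>?J. fls_nth (Kser s (q + int (t x)) k) i * fls_nth (cmap (L' x) F) (n - i)))"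
    by (simp add: sum_sum_list sum_distrib_left)
  also have "\<dots> = fls_nth (\<Sum>x\<leftarrow>xs. C (u x) * (Kser s (q + int (t x)) k * cmap (L' x) F)) n"
    unfolding fls_nth_sum_list C_nth_mult
    by (subst fls_times_nth_bounds[of "q - int k" _ b, OF low b']) auto
  finally show "fls_nth (cmap L (Kser s q k * F)) n = \<dots>" .
qed

text \<open>Moving a normally ordered product of vertex operators of charge \<open>2\<close> past one vertex operator
  of charge \<open>1\<close> produces a factor \<open>z - w\<close> for each of its letters. \<open>xpd\<close> lists the terms of the expanded
  product: sign, power of \<open>w\<close>, and the letters multiplied by the chosen powers of \<open>z\<close>.\<close>

primrec xpd :: "(nat \<times> int) list \<Rightarrow> (complex \<times> nat \<times> (nat \<times> int) list) list" where
  "xpd [] = [(1, 0, [])]"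
| "xpd (ke # ls) = map (\<lambda>(c, t, l). (c, t, (fst ke, snd ke + 1) # l)) (xpd ls) @
     map (\<lambda>(c, t, l). (- c, Suc t, ke # l)) (xpd ls)"

lemma xpd_bounds: "(c, t, l) \<in> set (xpd ls) \<Longrightarrow> t \<le> length ls \<and> length l = length ls"
  by (induction ls arbitrary: c t l) fastforce+

lemma vop_expand:
  assumes "linF F" "wle (int D) g"
  shows "vop s m ke F g = (\<Sum>d\<le>D. Kser s (s * m div 2 + snd ke - int d) (fst ke) * F (EZ s (int d) g))"
  using vop_eq[OF assms(2,1)] by simp

text \<open>A shift u of the annihilation index becomes a shift of the exponent in h; the range is
  enlarged by r so that all u up to r share one sum.\<close>

lemma sum_EZ_shift:
  assumes "\<And>d. h d 0 = (0::ser)" "wle (int D) g" "u \<le> r"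
  shows "(\<Sum>d\<le>D + r. h d (EZ s (int d - int u) g)) = (\<Sum>d\<le>D. h (d + u) (Ep s d g))"
proof -
  have "(\<Sum>d\<le>D. h (d + u) (Ep s d g)) = (\<Sum>d\<in>{u..D + u}. h d (EZ s (int d - int u) g))"
    by (rule sum.reindex_bij_witness[of _ "\<lambda>d. d - u" "\<lambda>d. d + u"]) (auto simp: of_nat_diff[symmetric])
  also have "\<dots> = (\<Sum>d\<le>D + r. h d (EZ s (int d - int u) g))"
  proof (rule sum.mono_neutral_left)
    show "\<forall>d\<in>{..D + r} - {u..D + u}. h d (EZ s (int d - int u) g) = 0"
    proof
      fix d assume "d \<in> {..D + r} - {u..D + u}"
      hence "int d - int u < 0 \<or> int D < int d - int u" by auto
      hence "EZ s (int d - int u) g = 0" using EZ_eq_0[OF assms(2)] by auto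
      thus "h d (EZ s (int d - int u) g) = 0" by (simp add: assms(1))
    qed
  qed (use assms(3) in auto)
  finally show ?thesis ..
qed

text \<open>Each letter of charge 2 crosses H(w) with a factor z - w: the contraction is 1 - w/z,
  and the additional unit of charge on the left-hand side supplies the factor z. The power t of w
  lowers the index of \<open>HZ\<close>.\<close>

lemma wop_cross:
  "wop 2 (m + 1) ls (HZ 1 c * y) =
     (\<Sum>(\<sigma>, t, l)\<leftarrow>xpd ls. C \<sigma> * (fls_const (HZ 1 (c - int t)) * wop 2 m l y))"
proof (induction ls arbitrary: c y)
  case Nil
  thus ?case by simp
next
  case (Cons ke ls)
  obtain k e where ke: "ke = (k, e)" by (cases ke)
  let ?F = "wop 2 (m + 1) ls"
  define K where "K = (\<lambda>q. Kser 2 q k)"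
  define D where "D = wt y + wt (HZ 1 c * y)"
  have D: "wle (int D) y" "wle (int (D + 1)) (HZ 1 c * y)"
    unfolding D_def by (rule wle_mono[OF wle_wt], simp)+
  note F = linF_wop[of 2 "m + 1" ls]
  have "wop 2 (m + 1) (ke # ls) (HZ 1 c * y) =
     (\<Sum>d\<le>D + 1. K (m + 1 + e - int d) * ?F (EZ 2 (int d) (HZ 1 c * y)))"
    by (simp only: wop.simps vop_expand[OF F D(2)]) (simp add: ke K_def)
  also have "\<dots> = (\<Sum>d\<le>D + 1. K (m + 1 + e - int d) * ?F (HZ 1 c * EZ 2 (int d - int 0) y)) -
      (\<Sum>d\<le>D + 1. K (m + 1 + e - int d) * ?F (HZ 1 (c - 1) * EZ 2 (int d - int 1) y))"
    by (simp only: EZ_HZ_cross[of 2 1, simplified] linFD(5)[OF F] right_diff_distrib sum_subtractf) simp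
  also have "(\<Sum>d\<le>D + 1. K (m + 1 + e - int d) * ?F (HZ 1 c * EZ 2 (int d - int 0) y)) =
     (\<Sum>d\<le>D. K (m + 1 + e - int (d + 0)) * ?F (HZ 1 c * Ep 2 d y))"
    by (rule sum_EZ_shift[OF _ D(1)]) (auto simp: linFD(3)[OF F])
  also have "(\<Sum>d\<le>D + 1. K (m + 1 + e - int d) * ?F (HZ 1 (c - 1) * EZ 2 (int d - int 1) y)) =
     (\<Sum>d\<le>D. K (m + 1 + e - int (d + 1)) * ?F (HZ 1 (c - 1) * Ep 2 d y))"
    by (rule sum_EZ_shift[OF _ D(1)]) (auto simp: linFD(3)[OF F])
  finally have eq: "wop 2 (m + 1) (ke # ls) (HZ 1 c * y) =
     (\<Sum>d\<le>D. K (m + (e + 1) - int d) * ?F (HZ 1 c * Ep 2 d y)) -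
     (\<Sum>d\<le>D. K (m + e - int d) * ?F (HZ 1 (c - 1) * Ep 2 d y))"
    by (simp add: algebra_simps)
  have *: "(\<Sum>d\<le>D. K (m + e' - int d) * ?F (HZ 1 c' * Ep 2 d y)) =
     (\<Sum>(\<sigma>, t, l)\<leftarrow>xpd ls. C \<sigma> * (fls_const (HZ 1 (c' - int t)) * wop 2 m ((k, e') # l) y))" for e' c'
  proof -
    have v: "wop 2 m ((k, e') # l) y = (\<Sum>d\<le>D. K (m + e' - int d) * wop 2 m l (Ep 2 d y))" for l
      by (simp only: wop.simps vop_expand[OF linF_wop D(1)]) (simp add: K_def)
    have "(\<Sum>d\<le>D. K (m + e' - int d) * ?F (HZ 1 c' * Ep 2 d y)) =
       (\<Sum>d\<le>D. \<Sum>(\<sigma>, t, l)\<leftarrow>xpd ls. C \<sigma> * (fls_const (HZ 1 (c' - int t)) * (K (m + e' - int d) * wop 2 m l (Ep 2 d y))))"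
      unfolding Cons.IH sum_list_const_mult[symmetric]
      by (intro sum.cong refl arg_cong[where f = sum_list] map_cong) (auto simp: mult_ac)
    also have "\<dots> = (\<Sum>(\<sigma>, t, l)\<leftarrow>xpd ls. C \<sigma> * (fls_const (HZ 1 (c' - int t)) * wop 2 m ((k, e') # l) y))"
      unfolding sum_sum_list v sum_distrib_left case_prod_unfold ..
    finally show ?thesis .
  qed
  show ?case
    unfolding eq * by (simp add: ke comp_def case_prod_unfold algebra_simps sum_list_uminus)
qed

text \<open>In the opposite order each letter gives 1 - z/w = - w^(-1) (z - w). Written through the
  same expansion \<open>xpd\<close>, r letters cost the sign (-1)^r and shift the index by r -
  t.\<close>

lemma EZ_wop_cross:
  "EZ 1 b (fls_nth (wop 2 m ls g) a) =
     (\<Sum>(\<sigma>, t, l)\<leftarrow>xpd ls. sc ((-1) ^ length ls * \<sigma>) * fls_nth (wop 2 m l (EZ 1 (b - (int (length ls) - int t)) g)) a)"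
proof -
  have "cmap (EZ 1 b) (wop 2 m ls g) =
     (\<Sum>(\<sigma>, t, l)\<leftarrow>xpd ls. C ((-1) ^ length ls * \<sigma>) * wop 2 m l (EZ 1 (b - (int (length ls) - int t)) g))"
  proof (induction ls arbitrary: b g)
    case Nil
    show ?case by (rule fls_eqI) (simp add: cmap_nth[OF linop_EZ] EZD)
  next
    case (Cons ke ls)
    obtain k e where ke: "ke = (k, e)" by (cases ke)
    define r where "r = length ls"
    define q where "q = 2 * m div 2"
    have q: "q = m" by (simp add: q_def)
    define D where "D = wt g"
    have D: "wle (int D) g" unfolding D_def by (rule wle_wt)
    have cr: "cmap (EZ 1 b) (Kser 2 q k * F) = Kser 2 q k * cmap (EZ 1 b) F - Kser 2 (q + 1) k * cmap (EZ 1 (b - 1)) F" for q F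
    proof -
      have "EZ 1 b (HZ 2 c * y) = (\<Sum>x\<leftarrow>[0, 1]. sc ((-1) ^ x) * (HZ 2 (c - int x) * EZ 1 (b - int x) y))" for c y
        by (simp add: EZ_HZ_cross[of 1 2])
      from cmap_Kser_mult[OF linop_EZ linop_EZ this, of q k F] show ?thesis by simp
    qed
    have *: "(\<Sum>d\<le>D. Kser 2 (m + e' - int d) k * cmap (EZ 1 b') (wop 2 m ls (Ep 2 d g))) =
      (\<Sum>(\<sigma>, t, l)\<leftarrow>xpd ls. C ((-1) ^ r * \<sigma>) * wop 2 m ((k, e') # l) (EZ 1 (b' - (int r - int t)) g))" for e' b'
    proof -
      have v: "wop 2 m ((k, e') # l) (EZ 1 b'' g) = (\<Sum>d\<le>D. Kser 2 (m + e' - int d) k * wop 2 m l (EZ 1 b'' (Ep 2 d g)))" for l b''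
      proof -
        have "wle (int D) (EZ 1 b'' g)"
          by (cases "b'' < 0") (auto intro: wle_mono[OF wle_EZ[OF D]])
        thus ?thesis
          by (simp only: wop.simps vop_expand[OF linF_wop]) (simp add: EZ_commute[of 1] flip: EZ_of_nat)
      qed
      have "(\<Sum>d\<le>D. Kser 2 (m + e' - int d) k * cmap (EZ 1 b') (wop 2 m ls (Ep 2 d g))) =
        (\<Sum>d\<le>D. \<Sum>(\<sigma>, t, l)\<leftarrow>xpd ls. C ((-1) ^ r * \<sigma>) * (Kser 2 (m + e' - int d) k * wop 2 m l (EZ 1 (b' - (int r - int t)) (Ep 2 d g))))"
        unfolding Cons.IH r_def[symmetric] sum_list_const_mult[symmetric]
        by (intro sum.cong refl arg_cong[where f = sum_list] map_cong) (auto simp: mult_ac)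
      also have "\<dots> = (\<Sum>(\<sigma>, t, l)\<leftarrow>xpd ls. C ((-1) ^ r * \<sigma>) * wop 2 m ((k, e') # l) (EZ 1 (b' - (int r - int t)) g))"
        unfolding sum_sum_list v sum_distrib_left case_prod_unfold ..
      finally show ?thesis .
    qed
    have "cmap (EZ 1 b) (wop 2 m (ke # ls) g) =
      (\<Sum>d\<le>D. Kser 2 (m + e - int d) k * cmap (EZ 1 b) (wop 2 m ls (Ep 2 d g))) -
      (\<Sum>d\<le>D. Kser 2 (m + (e + 1) - int d) k * cmap (EZ 1 (b - 1)) (wop 2 m ls (Ep 2 d g)))"
      by (simp only: wop.simps vop_expand[OF linF_wop D] cmap_sum[OF linop_EZ])
         (simp add: ke cr sum_subtractf algebra_simps)
    thus ?case
      unfolding * by (simp add: ke comp_def case_prod_unfold r_def algebra_simps sum_list_uminus)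
  qed
  hence "fls_nth (cmap (EZ 1 b) (wop 2 m ls g)) a = fls_nth
     (\<Sum>(\<sigma>, t, l)\<leftarrow>xpd ls. C ((-1) ^ length ls * \<sigma>) * wop 2 m l (EZ 1 (b - (int (length ls) - int t)) g)) a"
    by (simp only:)
  thus ?thesis
    by (simp add: cmap_nth[OF linop_EZ] fls_nth_sum_list case_prod_unfold C_nth_mult del: sc_simps)
qed

lemma linop_nth: "linF F \<Longrightarrow> linop (\<lambda>y. fls_nth (F y) a)"
  by (rule linopI) (simp_all add: linFD C_nth_mult)

text \<open>Both orders give one and the same normally ordered product times a polynomial, the
  product of all z - w or of all w - z. There are no poles, hence no commutator terms, and each pair
  of letters contributes one sign.\<close>

lemma wop_commute_sign:
  "cmap (\<lambda>y. fls_nth (wop 2 (m + int (length ks)) ls y) a) (wop 1 m ks g) =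
   C ((-1) ^ (length ls * length ks)) * wop 1 (m + 2 * int (length ls)) ks (fls_nth (wop 2 m ls g) a)"
proof (induction ks arbitrary: g ls)
  case Nil
  show ?case by (rule fls_eqI) (simp add: cmap_nth[OF linop_nth[OF linF_wop]] linFD(3)[OF linF_wop])
next
  case (Cons ke ks)
  obtain k e where ke: "ke = (k, e)" by (cases ke)
  define r j where "r = length ls" and "j = length ks"
  define q where "q = m div 2"
  \<comment> \<open>The charge 2r gained from \<open>ls\<close> adds r to the exponent of w, which
    cancels the w^(-r) of \<open>EZ_wop_cross\<close>.\<close>
  have q2: "(m + 2 * int r) div 2 = q + int r" by (simp add: q_def)
  define x where "x = fls_nth (wop 2 m ls g) a"
  define D where "D = wt g + wt x"
  have D: "wle (int D) g" "wle (int (D + r)) x"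
    unfolding D_def by (rule wle_mono[OF wle_wt], simp)+
  define L where "L = (\<lambda>i ls y. fls_nth (wop 2 i ls y) a)"
  have linL: "linop (L i ls)" for i ls unfolding L_def by (rule linop_nth[OF linF_wop])
  define T where "T = (\<lambda>(\<sigma>, t, l). \<Sum>d\<le>D. C \<sigma> * (Kser 1 (q + e - int d + int t) k *
      wop 1 (m + 2 * int r) ks (L m l (Ep 1 d g))))"
  have cross: "L (m + int j + 1) ls (HZ 1 c * y) =
     (\<Sum>x\<leftarrow>xpd ls. sc (fst x) * (HZ 1 (c - int (fst (snd x))) * L (m + int j) (snd (snd x)) y))" for c y
    unfolding L_def wop_cross fls_nth_sum_list case_prod_unfold C_nth_mult by simp
  have IH: "cmap (L (m + int j) l) (wop 1 m ks g') = C ((-1) ^ (r * j)) * wop 1 (m + 2 * int r) ks (L m l g')"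
    if "length l = r" for l g'
    using Cons.IH[of l g'] that by (simp add: L_def j_def)
  have "cmap (L (m + int (length (ke # ks))) ls) (wop 1 m (ke # ks) g) =
     (\<Sum>d\<le>D. cmap (L (m + int j + 1) ls) (Kser 1 (q + e - int d) k * wop 1 m ks (Ep 1 d g)))"
    by (simp only: wop.simps vop_expand[OF linF_wop D(1)] cmap_sum[OF linL])
       (simp add: ke q_def j_def algebra_simps)
  also have "\<dots> = (\<Sum>d\<le>D. \<Sum>x\<leftarrow>xpd ls. C (fst x) * (Kser 1 (q + e - int d + int (fst (snd x))) k *
       cmap (L (m + int j) (snd (snd x))) (wop 1 m ks (Ep 1 d g))))"
    by (subst cmap_Kser_mult[OF linL linL cross]) simp
  also have "\<dots> = (\<Sum>d\<le>D. \<Sum>x\<leftarrow>xpd ls. C (fst x) * (Kser 1 (q + e - int d + int (fst (snd x))) k *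
       (C ((-1) ^ (r * j)) * wop 1 (m + 2 * int r) ks (L m (snd (snd x)) (Ep 1 d g)))))"
  proof (intro sum.cong refl arg_cong[where f = sum_list] map_cong arg_cong2[of _ _ _ _ "(*)"] IH)
    fix x assume "x \<in> set (xpd ls)"
    thus "length (snd (snd x)) = r" using xpd_bounds[of "fst x" "fst (snd x)" "snd (snd x)" ls] by (simp add: r_def)
  qed
  also have "\<dots> = C ((-1) ^ (r * j)) * (\<Sum>x\<leftarrow>xpd ls. T x)"
    unfolding sum_sum_list T_def case_prod_unfold sum_list_const_mult[symmetric] sum_distrib_left
    by (intro arg_cong[where f = sum_list] map_cong refl sum.cong) (simp only: mult_ac)
  finally have lhs: "cmap (L (m + int (length (ke # ks))) ls) (wop 1 m (ke # ks) g) = \<dots>" .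
  have "wop 1 (m + 2 * int r) (ke # ks) x =
     (\<Sum>d\<le>D + r. Kser 1 (q + int r + e - int d) k * wop 1 (m + 2 * int r) ks (EZ 1 (int d) x))"
    by (simp only: wop.simps vop_expand[OF linF_wop D(2)]) (simp add: ke q2)
  also have "\<dots> = (\<Sum>d\<le>D + r. \<Sum>(\<sigma>, t, l)\<leftarrow>xpd ls. C ((-1) ^ r * \<sigma>) * (Kser 1 (q + int r + e - int d) k *
       wop 1 (m + 2 * int r) ks (L m l (EZ 1 (int d - (int r - int t)) g))))"
    unfolding x_def EZ_wop_cross linF_sum_list[OF linF_wop] sum_list_const_mult[symmetric]
    by (intro sum.cong refl arg_cong[where f = sum_list] map_cong)
       (auto simp: linFD(2)[OF linF_wop] r_def L_def mult_ac simp del: sc_simps)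
  also have "\<dots> = (\<Sum>x\<leftarrow>xpd ls. C ((-1) ^ r) * T x)"
    unfolding sum_sum_list
  proof (intro arg_cong[where f = sum_list] map_cong refl, clarify)
    fix \<sigma> t l assume "(\<sigma>, t, l) \<in> set (xpd ls)"
    hence t: "t \<le> r" using xpd_bounds[of \<sigma> t l ls] by (simp add: r_def)
    have z: "wop 1 (m + 2 * int r) ks (L m l 0) = 0"
      by (simp add: linopD(3)[OF linL] linFD(3)[OF linF_wop])
    have "(\<Sum>d\<le>D + r. C ((-1) ^ r * \<sigma>) * (Kser 1 (q + int r + e - int d) k *
       wop 1 (m + 2 * int r) ks (L m l (EZ 1 (int d - int (r - t)) g)))) =
      (\<Sum>d\<le>D. C ((-1) ^ r * \<sigma>) * (Kser 1 (q + int r + e - int (d + (r - t))) k *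
       wop 1 (m + 2 * int r) ks (L m l (Ep 1 d g))))"
      by (rule sum_EZ_shift[OF _ D(1)]) (auto simp: z)
    also have "\<dots> = C ((-1) ^ r) * T (\<sigma>, t, l)"
      using t by (simp add: T_def sum_distrib_left mult.assoc of_nat_diff algebra_simps flip: fls_const_mult_const)
    finally show "(\<Sum>d\<le>D + r. C ((-1) ^ r * \<sigma>) * (Kser 1 (q + int r + e - int d) k *
       wop 1 (m + 2 * int r) ks (L m l (EZ 1 (int d - (int r - int t)) g)))) = C ((-1) ^ r) * T (\<sigma>, t, l)"
      using t by (simp add: of_nat_diff)
  qed
  finally have rhs: "wop 1 (m + 2 * int r) (ke # ks) x = C ((-1) ^ r) * (\<Sum>x\<leftarrow>xpd ls. T x)"
    by (simp only: sum_list_const_mult)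
  have sgn: "(-1) ^ (r * length (ke # ks)) * (-1) ^ r = ((-1) ^ (r * j) :: complex)"
  proof -
    have "r * length (ke # ks) + r = r * j + 2 * r" by (simp add: j_def)
    thus ?thesis by (simp only: power_add[symmetric]) (simp add: power_add power_mult)
  qed
  have "C ((-1) ^ (r * length (ke # ks))) * wop 1 (m + 2 * int r) (ke # ks) x =
     (C ((-1) ^ (r * length (ke # ks))) * C ((-1) ^ r)) * (\<Sum>x\<leftarrow>xpd ls. T x)"
    by (simp only: rhs mult.assoc)
  also have "C ((-1) ^ (r * length (ke # ks))) * C ((-1) ^ r) = C ((-1) ^ (r * j))"
    by (simp only: fls_const_mult_const sc_simps(4)[symmetric] sgn)
  finally show ?case
    using lhs by (simp only: r_def x_def L_def)
qed

lemma wop_commute: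
  assumes "even (length ks)"
  shows "fls_nth (wop 2 (m + int (length ks)) ls (fls_nth (wop 1 m ks g) b)) a =
     fls_nth (wop 1 (m + 2 * int (length ls)) ks (fls_nth (wop 2 m ls g) a)) b"
proof -
  have "fls_nth (cmap (\<lambda>y. fls_nth (wop 2 (m + int (length ks)) ls y) a) (wop 1 m ks g)) b =
     fls_nth (wop 1 (m + 2 * int (length ls)) ks (fls_nth (wop 2 m ls g) a)) b"
    unfolding wop_commute_sign using assms by simp
  thus ?thesis by (simp add: cmap_nth[OF linop_nth[OF linF_wop]])
qed

section \<open>Products of states\<close>

lemma linop_prodn_left: "linop (\<lambda>f. prodn n j m f g)"
  unfolding prodn_def by (rule linop_nth[OF linF_NA_left])

lemmas prodnD_left = linopD[OF linop_prodn_left]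

lemma linop_prodn_right: "linop (prodn n j m f)"
  unfolding prodn_def [abs_def] by (intro linop_nth linF_NA linF_bop)

lemmas prodnD_right = linopD[OF linop_prodn_right]

lemma prodn_word:
  assumes "even (s * m)" "length ks = r"
  shows "prodn n (s * int r) m (prod_list (map (Hs s) ks)) g = fls_nth (wop s m (plain ks) g) (- n - 1)"
  using NA_bop_prod_Hs[OF assms(1), of ks] assms(2) by (simp add: prodn_def)

lemma prodn_commute:
  assumes "even m" "even j" "Ws 2 r u" "Ws 1 j v"
  shows "prodn n (2 * int r) (m + int j) u (prodn n' (int j) m v g) =
    prodn n' (int j) (m + 2 * int r) v (prodn n (2 * int r) m u g)"
  using assms(3)
proof (induction rule: Ws_induct)
  case (word ls)
  show ?case using assms(4)
  proof (induction rule: Ws_induct)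
    case (word ks)
    have "prodn n' (int j) m' (prod_list (map (Hs 1) ks)) g' = fls_nth (wop 1 m' (plain ks) g') (- n' - 1)"
      if "even m'" for m' g'
      using prodn_word[of 1 m' ks j n' g'] that word by simp
    thus ?case
      using assms(1,2) word \<open>length ls = r\<close> wop_commute[of "plain ks" m "plain ls" g "- n' - 1" "- n - 1"]
      by (simp add: prodn_word)
  next
    case (add x y)
    thus ?case by (simp add: prodnD_left(1) prodnD_right(1))
  next
    case (scale c x)
    thus ?case by (simp add: prodnD_left(2) prodnD_right(2))
  qed
next
  case (add x y)
  thus ?case by (simp add: prodnD_left(1) prodnD_right(1))
next
  case (scale c x)
  thus ?case by (simp add: prodnD_left(2) prodnD_right(2))
qed

lemma Ws_prodn:
  assumes "even (s * m)" "Ws s r f" "Ws s t g"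
  shows "Ws s (t + r) (prodn n (s * int r) m f g)"
  using assms(2)
proof (induction rule: Ws_induct)
  case (word ks)
  show ?case
    unfolding prodn_word[OF assms(1) word] using Ws_wop[OF assms(3), of "plain ks"] word by simp
qed (auto simp: prodnD_left(1) prodnD_left(2) intro: Ws_add Ws_scale)

subsection \<open>Vectors annihilated by the nonnegative modes\<close>

lemma ann_zero_imp_const:
  assumes "\<And>i. ann i g = 0"
  shows "g = sc (lookup g 0)"
proof (rule poly_mapping_eqI)
  fix p
  show "lookup g p = lookup (sc (lookup g 0)) p"
  proof (cases "p = 0")
    case False
    define i where "i = Min (keys p)"
    have p: "p - sg i + sg i = p" unfolding i_def by (rule minus_sg_add_sg[OF lookup_Min_keys[OF False]])
    have "sc (of_nat (Suc i) / 2) * pder i g = sc (of_nat (Suc i) / 2) * 0"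
      using assms[of i] by (simp add: ann_def)
    hence "pder i g = 0" by (rule sc_cancel[rotated]) (simp del: of_nat_Suc)
    hence "of_nat (lookup (p - sg i) i + 1) * lookup g (p - sg i + sg i) = 0"
      by (metis lookup_pder lookup_zero)
    hence "lookup g p = 0" unfolding p mult_eq_0_iff of_nat_eq_0_iff by simp
    thus ?thesis using False by (simp add: lookup_sc)
  qed (simp add: lookup_sc)
qed

text \<open>On k letters the substitution h_c to h_c - h_(c-1)/z has as top coefficient the word
  with every index lowered once and the sign (-1)^k. Replacing each h_c by - h_(c+1) inverts
  this.\<close>

lemma Ws_raise:
  assumes "Wd 1 k N f"
  shows "\<exists>g. Ws 1 k g \<and> Ep 2 k g = f \<and> (\<forall>c>k. Ep 2 c g = 0)"
  using assms
proof (induction rule: Wd.induct)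
  case (base N c)
  thus ?case using Ws_sc[of 1 c] by (intro exI[of _ "sc c"]) (auto simp: Ep_sc)
next
  case (step t N x c)
  then obtain g where g: "Ws 1 t g" "Ep 2 t g = x" "\<And>c. c > t \<Longrightarrow> Ep 2 c g = 0" by blast
  have cr: "Ep 2 (Suc b) (Hs 1 (Suc c) * g) = Hs 1 (Suc c) * Ep 2 (Suc b) g - Hs 1 c * Ep 2 b g" for b
  proof -
    have e: "int (Suc n) - 1 = int n" for n by simp
    show ?thesis using EZ_HZ_cross[of 2 1 "int (Suc b)" "int (Suc c)" g]
      unfolding e EZ_of_nat HZ_of_nat by (simp del: Ep.simps Hs.simps)
  qed
  let ?h = "- (Hs 1 (Suc c) * g)"
  have "Ws 1 (Suc t) (sc (-1) * (Hs 1 (Suc c) * g))" by (intro Ws_scale Ws_Hs g)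
  hence "Ws 1 (Suc t) ?h" by (simp del: Hs.simps)
  moreover have "Ep 2 (Suc t) ?h = Hs 1 c * x"
    by (simp only: EpD(4) cr g(2) g(3)[OF lessI]) simp
  moreover have "Ep 2 b ?h = 0" if b: "b > Suc t" for b
  proof -
    obtain b' where b': "b = Suc b'" "b' > t" using b by (cases b) auto
    have z: "Ep 2 (Suc b') g = 0" "Ep 2 b' g = 0" using b'(2) by (auto intro!: g(3) simp del: Ep.simps)
    show ?thesis unfolding b'(1) EpD(4) cr z by simp
  qed
  ultimately show ?case by blast
next
  case (add t N x y)
  then obtain g h where "Ws 1 t g" "Ep 2 t g = x" "\<forall>c>t. Ep 2 c g = 0"
     "Ws 1 t h" "Ep 2 t h = y" "\<forall>c>t. Ep 2 c h = 0" by blast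
  thus ?case by (intro exI[of _ "g + h"]) (auto simp: EpD(1) intro: Ws_add)
qed

text \<open>If \<open>Ep 2 m\<close> is the last operator not killing \<open>g\<close>, then \<open>Ep 2 m g\<close> lies in the same kernel but has smaller
  weight; raising every index of its words by one gives an element with the same image under \<open>Ep 2 m\<close>.\<close>

lemma Ep_kernel:
  assumes "\<And>c. c > m \<Longrightarrow> Ep 2 c g = 0"
  shows "Ws 1 m g"
  using assms
proof (induction m arbitrary: g)
  case 0
  have "ann b g = 0" for b
  proof -
    have "0 = of_nat (Suc b) * Ep 2 (Suc b) g" using 0[of "Suc b"] by (simp del: Ep.simps)
    also have "\<dots> = - of_int 2 * (\<Sum>i\<le>b. ann i (Ep 2 (b - i) g))" by (rule Ep_Suc)
    \<comment> \<open>All terms with i < b contain an \<open>Ep 2\<close> of positive index and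
      vanish.\<close>
    also have "(\<Sum>i\<le>b. ann i (Ep 2 (b - i) g)) = (\<Sum>i\<le>b. if i = b then ann b g else 0)"
      by (intro sum.cong refl) (use 0 in \<open>auto simp: annD(3)\<close>)
    finally have "sc 2 * ann b g = sc 2 * 0" by simp
    thus ?thesis by (rule sc_cancel[rotated]) simp
  qed
  hence "g = sc (lookup g 0)" by (rule ann_zero_imp_const)
  thus ?case by (metis Ws_sc)
next
  case (Suc m)
  show ?case using Suc.prems
  proof (induction "wt g" arbitrary: g rule: less_induct)
    case less
    define f where "f = Ep 2 (Suc m) g"
    have f0: "Ep 2 c f = 0" if "c > Suc m" for c
      unfolding f_def Ep_commute[of 2 c] less.prems[OF that] by (rule EpD(3))
    have wf: "wle (int (wt g) - int (Suc m)) f" unfolding f_def by (intro wle_Ep wle_wt)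
    have "Ws 1 (Suc m) f"
    proof (cases "wt g < Suc m")
      case True
      hence "f = 0" by (intro wle_neg[OF wf]) simp
      thus ?thesis by (simp add: Ws_0)
    next
      case False
      hence "wle (int (wt g - Suc m)) f" using wf by (simp add: of_nat_diff)
      hence "wt f \<le> wt g - Suc m" by (rule wt_le)
      hence "wt f < wt g" using False by simp
      from less.hyps[OF this f0] show ?thesis .
    qed
    then obtain h where h: "Ws 1 (Suc m) h" "Ep 2 (Suc m) h = f" "\<And>c. c > Suc m \<Longrightarrow> Ep 2 c h = 0"
      using Ws_raise unfolding Ws_def by meson
    \<comment> \<open>Subtracting h removes the top coefficient, which leads back to the outer
      induction.\<close>
    have "Ep 2 c (g - h) = 0" if "c > m" for c
      using less.prems[of c] h(2) h(3)[of c] that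
      by (cases "c = Suc m") (auto simp: EpD(5) f_def simp del: Ep.simps)
    hence "Ws 1 (Suc m) (g - h)" by (intro Ws_Suc Suc.IH)
    from Ws_add[OF this h(1)] show ?case by simp
  qed
qed

section \<open>The sector of charge two\<close>

text \<open>On \<open>H(x) H(y)\<close> the operators \<open>Ep 2 1\<close> and \<open>Ep 2 2\<close> act as multiplication by \<open>-(x + y)\<close> and \<open>x y\<close>, so
  \<open>qop\<close> acts as \<open>(x - y)\<^sup>2\<close>. Hence \<open>psi n\<close> reads off the part of weight \<open>2n\<close> of \<open>(x - y)\<^sup>2\<^sup>n\<close>, and it kills
  derivatives because \<open>x - y\<close> is translation invariant.\<close>

definition qop :: "pol \<Rightarrow> pol" where
  "qop g = EZ 2 1 (EZ 2 1 g) - 4 * EZ 2 2 g"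

definition psi :: "nat \<Rightarrow> pol \<Rightarrow> complex" where
  "psi n g = lookup ((qop ^^ n) g) 0"

lemma linop_qop: "linop qop"
  unfolding qop_def [abs_def]
  by (rule linopI) (simp_all add: EZD ring_distribs mult.left_commute)

lemma linop_qop_pow: "linop (qop ^^ n)"
proof (induction n)
  case 0
  thus ?case using linop_id by (simp add: id_def)
next
  case (Suc n)
  thus ?case using linop_comp[OF linop_qop Suc] by (simp add: comp_def)
qed

lemma psi_add: "psi n (f + g) = psi n f + psi n g"
  and psi_scale: "psi n (sc c * f) = c * psi n f"
  and psi_0: "psi n 0 = 0"
  by (simp_all add: psi_def linopD[OF linop_qop_pow] lookup_add)

lemma psi_sum: "psi n (sum f A) = (\<Sum>x\<in>A. psi n (f x))"
  by (induction A rule: infinite_finite_induct) (auto simp: psi_add psi_0)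

lemma qop_HZ: "qop (HZ 1 c * HZ 1 d) =
  HZ 1 (c - 2) * HZ 1 d - 2 * (HZ 1 (c - 1) * HZ 1 (d - 1)) + HZ 1 c * HZ 1 (d - 2)"
proof -
  have cr: "EZ 2 b (HZ 1 c * y) = HZ 1 c * EZ 2 b y - HZ 1 (c - 1) * EZ 2 (b - 1) y" for b c y
    by (rule EZ_HZ_cross) simp
  have "EZ 2 b 1 = (if b = 0 then 1 else 0)" for b
    by (simp add: EZ_def Ep_1)
  hence "EZ 2 1 (HZ 1 d) = - HZ 1 (d - 1)" "EZ 2 2 (HZ 1 d) = 0" for d
    using cr[of 1 d 1] cr[of 2 d 1] by simp_all
  thus ?thesis
    by (simp add: qop_def cr EZD algebra_simps)
qed

lemma lookup_Hs_mult_0: "lookup (Hs s (Suc n) * f) 0 = 0"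
proof -
  have "Hs s (Suc n) * f = sc (of_int s / of_nat (Suc n)) * (\<Sum>i\<le>n. pvar i * (Hs s (n - i) * f))"
    by (simp add: sum_distrib_right mult.assoc del: of_nat_Suc)
  thus ?thesis by (simp only: lookup_sc_mult lookup_sum lookup_pvar_mult) simp
qed

text \<open>Coefficient of x^c y^d in (x - y)^(2n), with integer indices because
  \<open>qop_HZ\<close> lowers them by up to two.\<close>

definition bz :: "nat \<Rightarrow> int \<Rightarrow> int \<Rightarrow> complex" where
  "bz n c d = (if c \<ge> 0 \<and> c + d = 2 * int n then (-1) ^ nat c * of_nat ((2 * n) choose nat c) else 0)"

lemma psi_HZ: "psi n (HZ 1 c * HZ 1 d) = bz n c d"
proof (induction n arbitrary: c d)
  case 0
  show ?case
  proof (cases "c > 0 \<or> d > 0")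
    case True
    have "lookup (HZ 1 c * f) 0 = 0" if "c > 0" for c f
    proof -
      obtain k where "c = int (Suc k)" using \<open>c > 0\<close> by (metis gr0_implies_Suc zero_less_imp_eq_int)
      thus ?thesis using lookup_Hs_mult_0[of 1 k f] by (simp only: HZ_of_nat)
    qed
    hence "lookup (HZ 1 c * HZ 1 d) 0 = 0" using True by (metis mult.commute)
    thus ?thesis using True by (auto simp: psi_def bz_def binomial_eq_0)
  next
    case False
    thus ?thesis by (cases "c = 0 \<and> d = 0") (auto simp: psi_def bz_def)
  qed
next
  case (Suc n)
  have "psi (Suc n) g = psi n (qop g)" for g
    by (simp add: psi_def funpow_swap1)
  hence "psi (Suc n) (HZ 1 c * HZ 1 d) = psi n (qop (HZ 1 c * HZ 1 d))" .
  also have "\<dots> = bz n (c - 2) d - 2 * bz n (c - 1) (d - 1) + bz n c (d - 2)"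
  proof -
    have "psi n (a - 2 * b + e) = psi n a - 2 * psi n b + psi n e" for a b e
    proof -
      have eq: "a - 2 * b + e = a + (sc (-2) * b + e)" by simp
      show ?thesis unfolding eq psi_add psi_scale by simp
    qed
    thus ?thesis by (simp only: qop_HZ Suc)
  qed
  also have "\<dots> = bz (Suc n) c d"
  proof (cases "c \<ge> 0 \<and> c + d = 2 * int (Suc n)")
    case True
    then obtain a where a: "c = int a" using nonneg_int_cases by blast
    \<comment> \<open>Pascal's rule is applied twice, which requires c - 2 to be a natural number; c
      = 0 and c = 1 are treated directly.\<close>
    consider "a = 0" | "a = 1" | b where "a = Suc (Suc b)" by (metis One_nat_def not0_implies_Suc)
    thus ?thesis
    proof cases
      case 3
      have "nat (c - 2) = b" "nat (c - 1) = Suc b" "nat c = Suc (Suc b)" using a 3 by auto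
      thus ?thesis using True a 3 by (simp add: bz_def algebra_simps)
    qed (use True a in \<open>auto simp: bz_def\<close>)
  qed (auto simp: bz_def)
  finally show ?case .
qed

lemma psi_Hs: "psi n (Hs 1 a * Hs 1 b) = (if a + b = 2 * n then (-1) ^ a * of_nat ((2 * n) choose a) else 0)"
proof -
  have "(int a + int b = 2 * int n) = (a + b = 2 * n)" by linarith
  thus ?thesis using psi_HZ[of n "int a" "int b"] by (simp add: bz_def)
qed

text \<open>The polynomial of phi_n (\<open>phi_mk\<close>): the inner mode produces h_n, and the
  outer operator meets it with the contraction (1 - w/z)^(1/2), whence the coefficients
  \<open>kap (1/2)\<close>.\<close>

definition phipol :: "nat \<Rightarrow> pol" where
  "phipol n = (\<Sum>l\<le>n. sc (kap (1/2) l) * (Hs 1 (n + l) * Hs 1 (n - l)))"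

definition phiwt :: "nat \<Rightarrow> complex" where
  "phiwt n = (\<Sum>l\<le>n. kap (1/2) l * ((-1) ^ (n + l) * of_nat ((2 * n) choose (n + l))))"

text \<open>By Vandermonde's convolution the sum is (-1)^n times the binomial coefficient of 2n +
  1/2 over n, none of whose factors vanishes because 2n + 1/2 is not an integer.\<close>

lemma phiwt_nonzero: "phiwt n \<noteq> 0"
proof -
  have "phiwt n = (-1) ^ n * (\<Sum>l\<le>n. ((1/2) gchoose l) * (of_nat (2 * n) gchoose (n - l)))"
  proof -
    have "kap (1/2) l * ((-1) ^ (n + l) * of_nat ((2 * n) choose (n + l))) =
       (-1) ^ n * (((1/2) gchoose l) * (of_nat (2 * n) gchoose (n - l)))" if "l \<le> n" for l
    proof -
      have "(2 * n) choose (n + l) = (2 * n) choose (n - l)"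
        using that by (subst binomial_symmetric) (auto intro!: arg_cong2[of _ _ _ _ "(choose)"])
      moreover have "(-1) ^ l * (-1) ^ l = (1::complex)" by (simp flip: power_mult_distrib)
      moreover have "kap (1/2) l * ((-1) ^ (n + l) * x) = ((-1) ^ l * (-1) ^ l) * ((-1) ^ n * (((1/2) gchoose l) * x))" for x
        by (simp add: kap_def power_add mult_ac)
      moreover have "(of_nat (2 * n) gchoose (n - l) :: complex) = of_nat ((2 * n) choose (n - l))"
        by (simp only: binomial_gbinomial)
      ultimately show ?thesis by (simp only: mult_1)
    qed
    thus ?thesis by (simp add: phiwt_def sum_distrib_left)
  qed
  also have "(\<Sum>l\<le>n. ((1/2) gchoose l) * (of_nat (2 * n) gchoose (n - l))) = ((1/2 + of_nat (2 * n) :: complex) gchoose n)"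
    using gbinomial_Vandermonde[of "1/2 :: complex" "of_nat (2 * n)" n] by (simp add: atLeast0AtMost)
  also have "(1/2 + of_nat (2 * n) :: complex) gchoose n \<noteq> 0"
  proof
    assume "(1/2 + of_nat (2 * n) :: complex) gchoose n = 0"
    then obtain i where "(1/2 + of_nat (2 * n) :: complex) - of_nat i = 0"
      by (auto simp: gbinomial_prod_rev)
    hence "(of_nat (4 * n + 1) :: complex) = of_nat (2 * i)" by (simp add: field_simps)
    hence "4 * n + 1 = 2 * i" by (simp only: of_nat_eq_iff)
    thus False by presburger
  qed
  hence "(-1) ^ n * ((1/2 + of_nat (2 * n) :: complex) gchoose n) \<noteq> 0" by simp
  finally show ?thesis .
qed

lemma psi_phipol: "psi n (phipol k) = (if k = n then phiwt n else 0)"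
proof -
  have "psi n (phipol k) = (\<Sum>l\<le>k. kap (1/2) l * (if k = n then (-1) ^ (n + l) * of_nat ((2 * n) choose (n + l)) else 0))"
    unfolding phipol_def psi_sum psi_scale psi_Hs by (intro sum.cong refl) auto
  thus ?thesis by (auto simp: phiwt_def)
qed

subsection \<open>Derivatives\<close>

lemma deriv_hasse: "fls_deriv (hasse k F) = of_nat (Suc k) * hasse (Suc k) F"
proof (rule fls_eqI)
  fix n :: int
  have "(of_nat (Suc k) :: complex) * (a gchoose (Suc k)) = (a - of_nat k) * (a gchoose k)" for a
    using gbinomial_mult_1[of a k] by (simp add: algebra_simps)
  from this[of "of_int n + 1 + of_nat k"]
  have "sc (of_nat (Suc k)) * sc ((of_int n + 1 + of_nat k) gchoose (Suc k)) =
    sc (of_int (n + 1)) * sc ((of_int n + 1 + of_nat k) gchoose k)"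
    by (simp only: sc_simps(4)[symmetric]) (simp del: sc_simps of_nat_Suc)
  moreover have "of_int n + of_nat (Suc k) = (of_int n + 1 + of_nat k :: complex)"
    "of_int (n + 1) + of_nat k = (of_int n + 1 + of_nat k :: complex)" by simp_all
  ultimately show "fls_nth (fls_deriv (hasse k F)) n = fls_nth (of_nat (Suc k) * hasse (Suc k) F) n"
    unfolding hasse_nth fls_deriv_nth fls_mult_of_nat_nth mult.assoc[symmetric]
    by (simp only: sc_simps) (simp add: algebra_simps)
qed

lemma deriv_sum: "fls_deriv (sum f A) = (\<Sum>x\<in>A. fls_deriv (f x :: ser))"
  by (induction A rule: infinite_finite_induct) auto

lemma deriv_vop: "fls_deriv (vop s m (k, 0) F g) =
    of_nat (Suc k) * vop s m (Suc k, 0) F g + vop s m (k, 0) (\<lambda>g. fls_deriv (F g)) g"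
  unfolding vop_def gop_def deriv_sum fls_deriv_mult Kser_def deriv_hasse sum_distrib_left sum.distrib[symmetric]
  by (intro sum.cong refl) (simp add: algebra_simps del: of_nat_Suc)

lemma vop_of_nat: "vop s m ke (\<lambda>g. of_nat n * F g) g = of_nat n * vop s m ke F g"
  by (simp add: vop_def gop_def sum_distrib_left mult_ac)

lemma vop_zero: "vop s m ke (\<lambda>g. 0) g = 0"
  by (simp add: vop_def gop_def)

lemma deriv_wop2: "fls_deriv (wop s m (plain [a, b]) g) =
    of_nat (Suc a) * wop s m (plain [Suc a, b]) g + of_nat (Suc b) * wop s m (plain [a, Suc b]) g"
proof -
  have "fls_deriv (wop s m (plain [b]) g) = of_nat (Suc b) * wop s m (plain [Suc b]) g" for g
    by (simp only: list.map wop.simps deriv_vop fls_deriv_const vop_zero add_0_right)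
  thus ?thesis
    by (simp only: list.map wop.simps deriv_vop) (simp only: vop_of_nat)
qed

definition psub :: "(pol \<Rightarrow> bool) \<Rightarrow> bool" where
  "psub S \<longleftrightarrow> S 0 \<and> (\<forall>f g. S f \<longrightarrow> S g \<longrightarrow> S (f + g)) \<and> (\<forall>c f. S f \<longrightarrow> S (sc c * f))"

lemma psubD:
  assumes "psub S"
  shows "S 0" "S f \<Longrightarrow> S g \<Longrightarrow> S (f + g)" "S f \<Longrightarrow> S (sc c * f)" "S f \<Longrightarrow> S g \<Longrightarrow> S (f - g)"
    "(\<And>x. x \<in> A \<Longrightarrow> S (h x)) \<Longrightarrow> S (sum h A)"
proof -
  show 0: "S 0" and a: "S f \<Longrightarrow> S g \<Longrightarrow> S (f + g)" and s: "S f \<Longrightarrow> S (sc c * f)" for f g c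
    using assms by (auto simp: psub_def)
  show "S f \<Longrightarrow> S g \<Longrightarrow> S (f - g)" using a[of f "sc (-1) * g"] s[of g "-1"] by simp
  show "(\<And>x. x \<in> A \<Longrightarrow> S (h x)) \<Longrightarrow> S (sum h A)"
    by (induction A rule: infinite_finite_induct) (auto intro: 0 a)
qed

lemma psub_cancel: "psub S \<Longrightarrow> c \<noteq> 0 \<Longrightarrow> S (sc c * f) \<Longrightarrow> S f"
  using psubD(3)[of S "sc c * f" "inverse c"] by simp

text \<open>Modulo derivatives all \<open>X a b\<close> with \<open>a + b = M\<close> are multiples of \<open>X 0 M\<close>; the multiples vanish for
  odd \<open>M\<close> by symmetry, and for even \<open>M\<close> the generator is a nonzero multiple.\<close>

lemma span_generators:
  assumes S: "psub S"
    and sym: "\<And>a b k. X a b k = X b a k"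
    and der: "\<And>a b k. of_nat (Suc k) * X a b (Suc k) = of_nat (Suc a) * X (Suc a) b k + of_nat (Suc b) * X a (Suc b) k"
    and gen: "\<And>n k. S (\<Sum>l\<le>n. sc (kap (1/2) l) * X (n + l) (n - l) k)"
  shows "S (X a b k)"
proof (induction "a + b" arbitrary: a b k rule: less_induct)
  case less
  define M where "M = a + b"
  have IH: "S (X a b k)" if "a + b < M" for a b k using less that by (simp add: M_def)
  \<comment> \<open>The derivative \<open>X a b (Suc k)\<close> has total index M - 1 and lies in S
    by induction; this is what working modulo derivatives amounts to.\<close>
  have step: "S (sc (of_nat (Suc a)) * X (Suc a) b k + sc (of_nat (Suc b)) * X a (Suc b) k)" if "Suc (a + b) = M" for a b k
  proof -
    have "S (sc (of_nat (Suc k)) * X a b (Suc k))" using that by (intro psubD(3)[OF S] IH) simp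
    thus ?thesis using der[of k a b] by (simp only: sc_simps)
  qed
  have red: "S (X a b k - sc ((-1) ^ a * of_nat (M choose a)) * X 0 M k)" if "a + b = M" for a b k
    using that
  proof (induction a arbitrary: b)
    case 0
    thus ?case using psubD(1)[OF S] by simp
  next
    case (Suc a)
    define u where "u = (-1) ^ a * (of_nat (M choose a) :: complex)"
    define u' where "u' = (-1) ^ Suc a * (of_nat (M choose Suc a) :: complex)"
    have "S (X a (Suc b) k - sc u * X 0 M k)"
      unfolding u_def by (rule Suc.IH) (use Suc.prems in simp)
    note h = this
    have "S (sc (of_nat (Suc a)) * X (Suc a) b k + sc (of_nat (Suc b)) * X a (Suc b) k -
        sc (of_nat (Suc b)) * (X a (Suc b) k - sc u * X 0 M k))"
      by (rule psubD(4)[OF S step psubD(3)[OF S h]]) (use Suc.prems in simp)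
    also have "sc (of_nat (Suc a)) * X (Suc a) b k + sc (of_nat (Suc b)) * X a (Suc b) k -
        sc (of_nat (Suc b)) * (X a (Suc b) k - sc u * X 0 M k) =
        sc (of_nat (Suc a)) * X (Suc a) b k + sc (of_nat (Suc b) * u) * X 0 M k"
      by (simp add: algebra_simps del: of_nat_Suc)
    also have "of_nat (Suc b) * u = - (of_nat (Suc a) * u')"
    proof -
      have "Suc a * (M choose Suc a) = Suc b * (M choose a)"
      proof -
        have "M - a = Suc b" using Suc.prems by simp
        thus ?thesis using binomial_absorb_comp[of M a] binomial_absorption[of a M]
          by (metis Suc_times_binomial_eq binomial_absorption mult.commute)
      qed
      hence "(of_nat (Suc a) * of_nat (M choose Suc a) :: complex) = of_nat (Suc b) * of_nat (M choose a)"
        by (simp only: of_nat_mult[symmetric])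
      thus ?thesis by (simp add: u_def u'_def algebra_simps del: of_nat_Suc)
    qed
    also have "sc (of_nat (Suc a)) * X (Suc a) b k + sc (- (of_nat (Suc a) * u')) * X 0 M k =
        sc (of_nat (Suc a)) * (X (Suc a) b k - sc u' * X 0 M k)"
      by (simp add: algebra_simps del: of_nat_Suc)
    finally show ?case
      unfolding u'_def by (rule psub_cancel[OF S, rotated]) (simp del: of_nat_Suc)
  qed
  have "S (X 0 M k)"
  proof (cases "even M")
    case False
    \<comment> \<open>For odd M, \<open>red\<close> gives X M 0 = - X 0 M modulo S, while by
      symmetry the two are equal.\<close>
    have "S (X M 0 k - sc ((-1) ^ M * of_nat (M choose M)) * X 0 M k)" by (rule red) simp
    hence "S (sc 2 * X 0 M k)" using False sym[of M 0 k] by simp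
    thus ?thesis by (rule psub_cancel[OF S, rotated]) simp
  next
    case True
    then obtain n where n: "M = 2 * n" by blast
    have "S (sc (kap (1/2) l) * (X (n + l) (n - l) k - sc ((-1) ^ (n + l) * of_nat (M choose (n + l))) * X 0 M k))" if "l \<le> n" for l
      using that by (intro psubD(3)[OF S] red) (simp add: n)
    hence "S (\<Sum>l\<le>n. sc (kap (1/2) l) * (X (n + l) (n - l) k - sc ((-1) ^ (n + l) * of_nat (M choose (n + l))) * X 0 M k))"
      by (intro psubD(5)[OF S]) auto
    from psubD(4)[OF S gen[of n k] this]
    have "S (\<Sum>l\<le>n. sc (kap (1/2) l) * (sc ((-1) ^ (n + l) * of_nat (M choose (n + l))) * X 0 M k))"
      by (simp only: right_diff_distrib sum_subtractf) simp
    also have "(\<Sum>l\<le>n. sc (kap (1/2) l) * (sc ((-1) ^ (n + l) * of_nat (M choose (n + l))) * X 0 M k)) = sc (phiwt n) * X 0 M k"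
      unfolding phiwt_def sc_sum sum_distrib_right n sc_simps(4) mult.assoc ..
    finally show ?thesis by (rule psub_cancel[OF S phiwt_nonzero])
  qed
  hence "S (X a b k - sc ((-1) ^ a * of_nat (M choose a)) * X 0 M k + sc ((-1) ^ a * of_nat (M choose a)) * X 0 M k)"
    by (intro psubD(2)[OF S] psubD(3)[OF S] red) (simp_all add: M_def)
  thus ?case by simp
qed

lemma wop2_sym: "even m \<Longrightarrow> wop 1 m (plain [a, b]) g = wop 1 m (plain [b, a]) g"
  using NA_bop_prod_Hs[of 1 m "[a, b]"] NA_bop_prod_Hs[of 1 m "[b, a]"] by (simp add: mult.commute)

lemma deriv_wop2_nth: "of_int (k + 1) * fls_nth (wop s m (plain [a, b]) g) (k + 1) =
    of_nat (Suc a) * fls_nth (wop s m (plain [Suc a, b]) g) k + of_nat (Suc b) * fls_nth (wop s m (plain [a, Suc b]) g) k"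
  using arg_cong[OF deriv_wop2, of "\<lambda>F. fls_nth F k" s m a b g]
  by (simp only: fls_deriv_nth fls_plus_nth fls_mult_of_nat_nth)

lemma Kser_nonneg: "r \<ge> 0 \<Longrightarrow> i < 0 \<Longrightarrow> fls_nth (Kser s r k) i = 0"
  unfolding Kser_def by (rule hasse_low) (simp_all add: fls_X_intpow_times_conv_shift(1))

lemma Kser_nth_0: "fls_nth (Kser s r k) 0 = HZ s (int k - r)"
  by (simp add: Kser_nth flip: binomial_gbinomial)

lemma Kser_Kser_nth:
  assumes "r \<ge> 0" "r' \<ge> 0"
  shows "fls_nth (Kser s r a * (Kser s r' b * fls_const x)) 0 = HZ s (int a - r) * (HZ s (int b - r') * x)"
    "n < 0 \<Longrightarrow> fls_nth (Kser s r a * (Kser s r' b * fls_const x)) n = 0"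
proof -
  have "fls_nth (Kser s r a * (Kser s r' b * fls_const x)) n = (\<Sum>i\<in>{0..n - 0}. fls_nth (Kser s r a) i * fls_nth (Kser s r' b * fls_const x) (n - i))" for n
    by (rule fls_times_nth_bounds) (auto simp: Kser_nonneg assms)
  thus "fls_nth (Kser s r a * (Kser s r' b * fls_const x)) 0 = HZ s (int a - r) * (HZ s (int b - r') * x)"
    "n < 0 \<Longrightarrow> fls_nth (Kser s r a * (Kser s r' b * fls_const x)) n = 0"
    by (simp_all add: Kser_nth_0)
qed

lemma wt_1 [simp]: "wt 1 = 0"
  using wt_single[of 0] by simp

lemma wop2_vacuum: "wop 1 0 (plain [a, b]) 1 = Kser 1 0 a * (Kser 1 0 b * fls_const 1)"
  by (simp add: vop_def gop_def)

text \<open>By \<open>deriv_wop2_nth\<close> a coefficient of positive degree is, up to a nonzero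
  factor, a combination of coefficients one degree lower. At degree one the two values of
  \<open>psi n\<close> cancel by the absorption identity for binomials; higher degrees follow
  recursively.\<close>

lemma psi_derivative: "psi n (fls_nth (wop 1 0 (plain [a, b]) 1) (int (Suc z))) = 0"
proof (induction z arbitrary: a b)
  case 0
  have w: "fls_nth (wop 1 0 (plain [a, b]) 1) 0 = Hs 1 a * Hs 1 b" for a b
    unfolding wop2_vacuum by (subst Kser_Kser_nth) auto
  have i1: "int (Suc 0) = 0 + 1" by simp
  have "fls_nth (wop 1 0 (plain [a, b]) 1) (0 + 1) = of_int (0 + 1) * fls_nth (wop 1 0 (plain [a, b]) 1) (0 + 1)"
    by simp
  also note deriv_wop2_nth[of 0 1 0 a b 1]
  finally have e: "fls_nth (wop 1 0 (plain [a, b]) 1) (int (Suc 0)) = sc (of_nat (Suc a)) * (Hs 1 (Suc a) * Hs 1 b) + sc (of_nat (Suc b)) * (Hs 1 a * Hs 1 (Suc b))"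
    by (simp only: w i1 sc_simps)
  show ?case
  proof (cases "Suc (a + b) = 2 * n")
    case True
    have "Suc a * ((2 * n) choose Suc a) = Suc b * ((2 * n) choose a)"
    proof -
      have "2 * n - a = Suc b" using True by simp
      thus ?thesis using binomial_absorb_comp[of "2 * n" a] binomial_absorption[of a "2 * n"] by simp
    qed
    hence "(of_nat (Suc a) * of_nat ((2 * n) choose Suc a) :: complex) = of_nat (Suc b) * of_nat ((2 * n) choose a)"
      by (simp only: of_nat_mult[symmetric])
    thus ?thesis unfolding e psi_add psi_scale psi_Hs using True by (simp add: algebra_simps del: of_nat_Suc)
  next
    case False
    thus ?thesis unfolding e psi_add psi_scale psi_Hs by simp
  qed
next
  case (Suc z)
  have "int (Suc (Suc z)) = int (Suc z) + 1" by simp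
  hence "sc (of_int (int (Suc z) + 1)) * fls_nth (wop 1 0 (plain [a, b]) 1) (int (Suc (Suc z))) =
    sc (of_nat (Suc a)) * fls_nth (wop 1 0 (plain [Suc a, b]) 1) (int (Suc z)) +
    sc (of_nat (Suc b)) * fls_nth (wop 1 0 (plain [a, Suc b]) 1) (int (Suc z))"
    using deriv_wop2_nth[of "int (Suc z)" 1 0 a b 1] by (simp only: sc_simps)
  hence "psi n (sc (of_int (int (Suc z) + 1)) * fls_nth (wop 1 0 (plain [a, b]) 1) (int (Suc (Suc z)))) = 0"
    by (simp only: psi_add psi_scale Suc) simp
  moreover have "(of_int (int (Suc z) + 1) :: complex) = of_nat (Suc (Suc z))" by simp
  ultimately show ?case unfolding psi_scale by (simp del: of_nat_Suc)
qed

lemma prodn_pair: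
  assumes "even m"
  shows "prodn n 2 m (Hs 1 a * Hs 1 b) g = fls_nth (wop 1 m (plain [a, b]) g) (- n - 1)"
  using prodn_word[of 1 m "[a, b]" 2 n g] assms by simp

lemma prodn_phipol:
  assumes "even m"
  shows "prodn n 2 m (phipol i) g =
    (\<Sum>l\<le>i. sc (kap (1/2) l) * fls_nth (wop 1 m (plain [i + l, i - l]) g) (- n - 1))"
  unfolding phipol_def prodnD_left(6) prodnD_left(2) prodn_pair[OF assms] ..

text \<open>On the vacuum a mode of phi_i gives zero (index above -1), phi_i itself (index -1) or
  derivatives (index below -1). \<open>psi n\<close> kills derivatives and, reading weight 2n,
  misses phi_i.\<close>

lemma psi_prodn_phipol:
  assumes "i \<noteq> n"
  shows "psi n (prodn k 2 0 (phipol i) 1) = 0"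
proof -
  consider z where "- k - 1 = int (Suc z)" | "- k - 1 = 0" | "- k - 1 < 0"
    by (metis linorder_neqE_linordered_idom not0_implies_Suc of_nat_0 of_nat_0_less_iff zero_less_imp_eq_int less_irrefl)
  thus ?thesis
  proof cases
    case 1
    show ?thesis unfolding prodn_phipol[OF even_zero] 1 psi_sum psi_scale psi_derivative by simp
  next
    case 2
    have "fls_nth (wop 1 0 (plain [a, b]) 1) 0 = Hs 1 a * Hs 1 b" for a b
      unfolding wop2_vacuum by (subst Kser_Kser_nth) auto
    hence "prodn k 2 0 (phipol i) 1 = phipol i"
      unfolding prodn_phipol[OF even_zero] 2 by (simp only: phipol_def)
    thus ?thesis using assms by (simp add: psi_phipol)
  next
    case 3
    have "fls_nth (wop 1 0 (plain [a, b]) 1) (- k - 1) = 0" for a b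
      unfolding wop2_vacuum by (rule Kser_Kser_nth(2)) (use 3 in auto)
    thus ?thesis unfolding prodn_phipol[OF even_zero] by (simp only: mult_zero_right sum.neutral_const psi_0)
  qed
qed

subsection \<open>The leading term of a product\<close>

lemma pair_leading_term:
  assumes S: "psub S"
    and pair: "\<And>N a b x. Wd 1 (2 * r) N x \<Longrightarrow> S (fls_nth (wop 1 (2 * int r) (plain [a, b]) x) 0)"
    and x: "Wd 1 (2 * r) N x"
  shows "S (Hs 1 c * (Hs 1 d * x))"
  using x
proof (induction N arbitrary: c d x rule: less_induct)
  case (less N)
  define D where "D = wt x"
  have D: "wle (int D) x" unfolding D_def by (rule wle_wt)
  \<comment> \<open>On charge 2r every letter carries z^r, and the constant term of the (c + r)-th
    Hasse derivative of z^r H(z) is h_c.\<close>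
  define a b where "a = c + r" and "b = d + r"
  define Y where "Y = (\<lambda>i e. fls_nth (Kser 1 (int r - int i) a * (Kser 1 (int r - int e) b * fls_const (Ep 1 e (Ep 1 i x)))) 0)"
  have Y00: "Y 0 0 = Hs 1 c * (Hs 1 d * x)"
    unfolding Y_def by (simp add: Kser_Kser_nth a_def b_def)
  \<comment> \<open>A term with an annihilation operator involves a word y of smaller weight,
    possibly with other indices c' and d'; the induction covers it since c and d are arbitrary
    there.\<close>
  have Y: "S (Y i e)" if "i \<noteq> 0 \<or> e \<noteq> 0" for i e
  proof -
    define y where "y = Ep 1 e (Ep 1 i x)"
    \<comment> \<open>For N = 0 the truncated subtraction N - i - e would not decrease; there y
      vanishes outright.\<close>
    have y: "y = 0 \<or> (\<exists>N'<N. Wd 1 (2 * r) N' y)"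
    proof (cases "N = 0")
      case True
      have "WZ 1 (2 * r) (int N - int e) (EZ 1 (int e) x)" "WZ 1 (2 * r) (int N - int i) (EZ 1 (int i) x)"
        by (rule WZ_EZ[OF less.prems])+
      hence "Ep 1 e x = 0 \<or> Ep 1 i x = 0" using that True by (auto simp: WZ_def split: if_splits)
      moreover have "y = Ep 1 i (Ep 1 e x)" unfolding y_def by (rule Ep_commute)
      ultimately have "y = 0" unfolding y_def using EpD(3) by metis
      thus ?thesis ..
    next
      case False
      have "Wd 1 (2 * r) (N - i - e) y" unfolding y_def by (intro Wd_Ep less.prems)
      thus ?thesis using False that by (intro disjI2 exI[of _ "N - i - e"]) auto
    qed
    obtain B where B: "\<And>j. j < B \<Longrightarrow> fls_nth (Kser 1 (int r - int e) b * fls_const y) j = 0"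
      by (rule fls_low[of "Kser 1 (int r - int e) b * fls_const y"]) blast
    have "Y i e = (\<Sum>j\<in>{int r - int i - int a..0 - B}. fls_nth (Kser 1 (int r - int i) a) j *
        fls_nth (Kser 1 (int r - int e) b * fls_const y) (0 - j))"
      unfolding Y_def y_def[symmetric] by (rule fls_times_nth_bounds, erule Kser_low, erule B)
    moreover have "S (fls_nth (Kser 1 (int r - int i) a) j * fls_nth (Kser 1 (int r - int e) b * fls_const y) (0 - j))" for j
    proof -
      have HH: "S (HZ 1 c' * (HZ 1 d' * y))" for c' d'
      proof (cases "y = 0 \<or> c' < 0 \<or> d' < 0")
        case True
        thus ?thesis using psubD(1)[OF S] by auto
      next
        case False
        with y obtain N' where "N' < N" "Wd 1 (2 * r) N' y" by blast
        from less.IH[OF this] False show ?thesis by (simp add: HZ_def)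
      qed
      have "fls_nth (Kser 1 (int r - int i) a) j * fls_nth (Kser 1 (int r - int e) b * fls_const y) (0 - j) =
         sc ((of_int j + of_nat a gchoose a) * (of_int (0 - j) + of_nat b gchoose b)) *
         (HZ 1 (j + int a - (int r - int i)) * (HZ 1 (0 - j + int b - (int r - int e)) * y))"
        by (simp only: fls_mult_const_nth Kser_nth sc_simps mult_ac)
      thus ?thesis by (simp only: psubD(3)[OF S HH])
    qed
    ultimately show ?thesis by (auto intro: psubD(5)[OF S])
  qed
  have "fls_nth (wop 1 (2 * int r) (plain [a, b]) x) 0 = (\<Sum>i\<le>D. \<Sum>e\<le>D. Y i e)"
  proof -
    have "wop 1 (2 * int r) (plain [a, b]) x = (\<Sum>i\<le>D. Kser 1 (int r - int i) a *
       (\<Sum>e\<le>D. Kser 1 (int r - int e) b * fls_const (Ep 1 e (Ep 1 i x))))"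
      by (simp add: vop_eq[OF D linF_vop[OF linF_fls_const]] vop_eq[OF wle_int_Ep[OF D] linF_fls_const])
    thus ?thesis by (simp add: Y_def fls_nth_sum sum_distrib_left)
  qed
  also have "\<dots> = Y 0 0 + (\<Sum>p\<in>{..D} \<times> {..D} - {(0, 0)}. Y (fst p) (snd p))"
    by (simp add: sum.cartesian_product case_prod_unfold sum.remove[of _ "(0, 0)"])
  finally have "Y 0 0 = fls_nth (wop 1 (2 * int r) (plain [a, b]) x) 0 - (\<Sum>p\<in>{..D} \<times> {..D} - {(0, 0)}. Y (fst p) (snd p))"
    by simp
  moreover have "S \<dots>"
    by (intro psubD(4)[OF S] psubD(5)[OF S] pair[OF less.prems] Y) auto
  ultimately show ?case by (simp only: Y00)
qed

section \<open>The commutant\<close>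

definition vsub :: "vec set \<Rightarrow> bool" where
  "vsub U \<longleftrightarrow> (\<lambda>k. 0) \<in> U \<and> (\<forall>v\<in>U. \<forall>w\<in>U. (\<lambda>k. v k + w k) \<in> U) \<and> (\<forall>c. \<forall>v\<in>U. (\<lambda>k. c * v k) \<in> U)"

lemma vsubD:
  assumes "vsub U"
  shows "(\<lambda>k. 0) \<in> U" "v \<in> U \<Longrightarrow> w \<in> U \<Longrightarrow> (\<lambda>k. v k + w k) \<in> U" "v \<in> U \<Longrightarrow> (\<lambda>k. c * v k) \<in> U"
  using assms by (auto simp: vsub_def)

lemma vsub_sum:
  assumes "vsub U" "\<And>x. x \<in> A \<Longrightarrow> f x \<in> U"
  shows "(\<lambda>k. \<Sum>x\<in>A. f x k) \<in> U"
  using assms(2)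
proof (induction A rule: infinite_finite_induct)
  case (insert x A)
  hence "(\<lambda>k. f x k + (\<Sum>x\<in>A. f x k)) \<in> U" by (intro vsubD(2)[OF assms(1)]) auto
  thus ?case using insert by simp
qed (auto intro: vsubD(1)[OF assms(1)])

lemma lspan_minimal:
  assumes "vsub U" "X \<subseteq> U"
  shows "lspan X \<subseteq> U"
proof
  fix v assume "v \<in> lspan X"
  then obtain F c where F: "finite F" "F \<subseteq> X" and v: "v = (\<lambda>k. \<Sum>x\<in>F. c x * x k)"
    by (auto simp: lspan_def)
  show "v \<in> U" unfolding v
    by (rule vsub_sum[OF assms(1)], rule vsubD(3)[OF assms(1)]) (use F assms(2) in auto)
qed

lemma lspan_superset: "X \<subseteq> lspan X"
proof
  fix x assume "x \<in> X"
  thus "x \<in> lspan X"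
    unfolding lspan_def by (intro CollectI exI[of _ "{x}"] exI[of _ "\<lambda>_. 1"]) auto
qed

lemma vsub_lspan: "vsub (lspan X)"
  unfolding vsub_def
proof (intro conjI ballI allI)
  show "(\<lambda>k. 0) \<in> lspan X"
    unfolding lspan_def by (intro CollectI exI[of _ "{}"] exI[of _ "\<lambda>_. 0"]) auto
next
  fix v w assume "v \<in> lspan X" "w \<in> lspan X"
  then obtain F c G d where F: "finite F" "F \<subseteq> X" "v = (\<lambda>k. \<Sum>x\<in>F. c x * x k)"
    and G: "finite G" "G \<subseteq> X" "w = (\<lambda>k. \<Sum>x\<in>G. d x * x k)"
    by (auto simp: lspan_def)
  define e where "e = (\<lambda>x. (if x \<in> F then c x else 0) + (if x \<in> G then d x else 0))"
  have "(\<lambda>k. v k + w k) = (\<lambda>k. \<Sum>x\<in>F \<union> G. e x * x k)"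
  proof
    fix k
    have "(\<Sum>x\<in>F. c x * x k) = (\<Sum>x\<in>F \<union> G. (if x \<in> F then c x else 0) * x k)"
      using F G by (intro sum.mono_neutral_cong_left) auto
    moreover have "(\<Sum>x\<in>G. d x * x k) = (\<Sum>x\<in>F \<union> G. (if x \<in> G then d x else 0) * x k)"
      using F G by (intro sum.mono_neutral_cong_left) auto
    ultimately show "v k + w k = (\<Sum>x\<in>F \<union> G. e x * x k)"
      by (simp add: F(3) G(3) e_def ring_distribs sum.distrib)
  qed
  thus "(\<lambda>k. v k + w k) \<in> lspan X"
    unfolding lspan_def using F G by (intro CollectI exI[of _ "F \<union> G"] exI[of _ e]) auto
next
  fix c v assume "v \<in> lspan X"
  then obtain F d where F: "finite F" "F \<subseteq> X" "v = (\<lambda>k. \<Sum>x\<in>F. d x * x k)"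
    by (auto simp: lspan_def)
  thus "(\<lambda>k. c * v k) \<in> lspan X"
    unfolding lspan_def
    by (intro CollectI exI[of _ F] exI[of _ "\<lambda>x. c * d x"]) (auto simp: sum_distrib_left mult.assoc)
qed

lemma mk_add: "mk (\<lambda>m. F m + G m) = (\<lambda>k. mk F k + mk G k)"
  and mk_scale: "mk (\<lambda>m. sc c * F m) = (\<lambda>k. c * mk F k)"
  and mk_0: "mk (\<lambda>m. 0) = (\<lambda>k. 0)"
  by (auto simp: fun_eq_iff lookup_add)

lemma good_0: "good (\<lambda>m. 0)" and good_scale: "good G \<Longrightarrow> good (\<lambda>m. sc c * G m)"
  and good_add: "good F \<Longrightarrow> good G \<Longrightarrow> good (\<lambda>m. F m + G m)"
proof -
  show "good (\<lambda>m. 0)" by (simp add: good_def)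
  show "good (\<lambda>m. sc c * G m)" if "good G"
  proof -
    have "chs (\<lambda>m. sc c * G m) \<subseteq> chs G" by auto
    thus ?thesis using that finite_subset unfolding good_def by auto
  qed
  show "good (\<lambda>m. F m + G m)" if "good F" "good G"
  proof -
    have "chs (\<lambda>m. F m + G m) \<subseteq> chs F \<union> chs G" by auto
    thus ?thesis using that finite_subset[of _ "chs F \<union> chs G"] unfolding good_def by auto
  qed
qed

lemma good_pt: "even m \<Longrightarrow> good (pt m g)"
proof -
  assume "even m"
  moreover have "chs (pt m g) \<subseteq> {m}" by (auto simp: pt_def)
  ultimately show ?thesis using finite_subset[of "chs (pt m g)" "{m}"] by (auto simp: good_def pt_def)
qed

definition modep :: "(int \<Rightarrow> pol) \<Rightarrow> int \<Rightarrow> (int \<Rightarrow> pol) \<Rightarrow> int \<Rightarrow> pol" where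
  "modep V n G M = (\<Sum>j\<in>chs V. prodn n j (M - j) (V j) (G (M - j)))"

lemma vmode_modep: "good V \<Longrightarrow> good G \<Longrightarrow> vmode (mk V) n (mk G) = mk (modep V n G)"
  unfolding modep_def by (rule vmode_mk)

lemma prodn_0_right: "prodn n j m f 0 = 0" and prodn_0_left: "prodn n j m 0 g = 0"
  by (simp_all add: prodnD_right(3) prodnD_left(3))

lemma good_modep: "good V \<Longrightarrow> good G \<Longrightarrow> good (modep V n G)"
proof -
  assume V: "good V" and G: "good G"
  have "chs (modep V n G) \<subseteq> (\<lambda>(j, m). j + m) ` (chs V \<times> chs G)"
  proof
    fix M assume "M \<in> chs (modep V n G)"
    then obtain j where j: "j \<in> chs V" "prodn n j (M - j) (V j) (G (M - j)) \<noteq> 0"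
      unfolding modep_def by (auto elim: sum.not_neutral_contains_not_neutral)
    hence "M - j \<in> chs G" using prodn_0_right by auto
    thus "M \<in> (\<lambda>(j, m). j + m) ` (chs V \<times> chs G)" using j by (intro image_eqI[of _ _ "(j, M - j)"]) auto
  qed
  hence "finite (chs (modep V n G))"
    using V G by (auto simp: good_def intro: finite_subset)
  moreover have "modep V n G M = 0" if "odd M" for M
    unfolding modep_def
  proof (intro sum.neutral ballI)
    fix j assume "j \<in> chs V"
    hence "odd (M - j)" using that V by (auto simp: good_def)
    thus "prodn n j (M - j) (V j) (G (M - j)) = 0" using G by (simp add: good_def prodn_0_right)
  qed
  ultimately show ?thesis by (simp add: good_def)
qed

lemma modep_pt:
  "modep (pt j f) n (pt m g) = pt (j + m) (prodn n j m f g)"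
proof
  fix M
  show "modep (pt j f) n (pt m g) M = pt (j + m) (prodn n j m f g) M"
  proof (cases "f = 0")
    case True
    hence "chs (pt j f) = {}" by (auto simp: pt_def)
    thus ?thesis using True by (simp add: modep_def prodn_0_left) (simp add: pt_def)
  next
    case False
    hence "chs (pt j f) = {j}" by (auto simp: pt_def)
    thus ?thesis by (auto simp: modep_def pt_def prodn_0_right)
  qed
qed

lemma vmode_pt: "even j \<Longrightarrow> even m \<Longrightarrow> vmode (mk (pt j f)) n (mk (pt m g)) = mk (pt (j + m) (prodn n j m f g))"
  by (simp add: vmode_modep good_pt modep_pt)

text \<open>\<open>VS 1\<close> will turn out to be the commutant, and \<open>VS 2\<close> contains the subalgebra generated by
  \<^const>\<open>e_alpha\<close>.\<close>

definition VSp :: "int \<Rightarrow> (int \<Rightarrow> pol) \<Rightarrow> bool" where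
  "VSp s G \<longleftrightarrow> good G \<and> (\<forall>m<0. G m = 0) \<and> (\<forall>m\<ge>0. Ws s (nat (m div s)) (G m))"

definition VS :: "int \<Rightarrow> vec set" where
  "VS s = mk ` {G. VSp s G}"

lemma mk_in_VS: "mk G \<in> VS s \<longleftrightarrow> VSp s G"
  by (auto simp: VS_def)

lemma VSp_nonzero:
  assumes "VSp s G" "G m \<noteq> 0"
  shows "m \<ge> 0" "even m"
proof -
  show "m \<ge> 0" by (rule ccontr) (use assms in \<open>auto simp: VSp_def\<close>)
  show "even m" by (rule ccontr) (use assms in \<open>auto simp: VSp_def good_def\<close>)
qed

lemma VS_subset_VA1: "VS s \<subseteq> VA1"
  by (auto simp: VS_def VSp_def mk_in_VA1)

lemma vsub_VA1: "vsub VA1"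
  unfolding vsub_def
proof (intro conjI ballI allI)
  show "(\<lambda>k. 0) \<in> VA1" using good_0 mk_in_VA1 by (simp flip: mk_0)
next
  fix v w assume "v \<in> VA1" "w \<in> VA1"
  thus "(\<lambda>k. v k + w k) \<in> VA1" by (auto simp: VA1_eq simp flip: mk_add intro!: good_add)
next
  fix c v assume "v \<in> VA1"
  thus "(\<lambda>k. c * v k) \<in> VA1" by (auto simp: VA1_eq simp flip: mk_scale intro!: good_scale)
qed

lemma vsub_VS: "vsub (VS s)"
  unfolding vsub_def
proof (intro conjI ballI allI)
  have "VSp s (\<lambda>m. 0)" by (simp add: VSp_def good_0 Ws_0)
  thus "(\<lambda>k. 0) \<in> VS s" by (simp add: mk_in_VS flip: mk_0)
next
  fix v w assume "v \<in> VS s" "w \<in> VS s"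
  then obtain F G where *: "v = mk F" "w = mk G" "VSp s F" "VSp s G" by (auto simp: VS_def)
  hence "VSp s (\<lambda>m. F m + G m)" by (simp add: VSp_def good_add Ws_add)
  thus "(\<lambda>k. v k + w k) \<in> VS s" using * by (simp add: mk_in_VS flip: mk_add)
next
  fix c v assume "v \<in> VS s"
  then obtain F where *: "v = mk F" "VSp s F" by (auto simp: VS_def)
  hence "VSp s (\<lambda>m. sc c * F m)" by (simp add: VSp_def good_scale Ws_scale)
  thus "(\<lambda>k. c * v k) \<in> VS s" using * by (simp add: mk_in_VS flip: mk_scale)
qed

lemma VSp_modep:
  assumes s: "s = 1 \<or> s = 2" and V: "VSp s V" and G: "VSp s G"
  shows "VSp s (modep V n G)"
  unfolding VSp_def
proof (intro conjI allI impI)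
  show "good (modep V n G)" using V G by (intro good_modep) (auto simp: VSp_def)
next
  have V0: "V j = 0" if "j < 0" for j using V that by (simp add: VSp_def)
  have G0: "G j = 0" if "j < 0" for j using G that by (simp add: VSp_def)
  fix M :: int
  show "modep V n G M = 0" if "M < 0"
    unfolding modep_def
  proof (intro sum.neutral ballI)
    fix j assume "j \<in> chs V"
    hence "j \<ge> 0" using V0 by force
    thus "prodn n j (M - j) (V j) (G (M - j)) = 0" using that by (simp add: G0 prodn_0_right)
  qed
  show "Ws s (nat (M div s)) (modep V n G M)" if "M \<ge> 0"
    unfolding modep_def
  proof (intro Ws_sum)
    fix j assume j: "j \<in> chs V"
    hence jp: "j \<ge> 0" "even j" using VSp_nonzero[OF V, of j] by auto
    show "Ws s (nat (M div s)) (prodn n j (M - j) (V j) (G (M - j)))"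
    proof (cases "G (M - j) = 0")
      case True
      thus ?thesis by (simp add: prodn_0_right Ws_0)
    next
      case False
      hence m: "M - j \<ge> 0" "even (M - j)" by (rule VSp_nonzero[OF G])+
      define r t where "r = nat (j div s)" and "t = nat ((M - j) div s)"
      have js: "j = s * int r" using s jp by (auto simp: r_def)
      have Ms: "nat (M div s) = t + r" using s jp m by (auto simp: r_def t_def elim!: evenE)
      have "Ws s r (V j)" "Ws s t (G (M - j))"
        using V G jp m by (auto simp: VSp_def r_def t_def)
      from Ws_prodn[OF _ this, of "M - j" n] m show ?thesis unfolding Ms js[symmetric] by simp
    qed
  qed
qed

lemma VS_vmode: "s = 1 \<or> s = 2 \<Longrightarrow> v \<in> VS s \<Longrightarrow> w \<in> VS s \<Longrightarrow> vmode v n w \<in> VS s"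
proof -
  assume s: "s = 1 \<or> s = 2" and "v \<in> VS s" "w \<in> VS s"
  then obtain V G where *: "v = mk V" "w = mk G" "VSp s V" "VSp s G" by (auto simp: VS_def)
  hence "vmode v n w = mk (modep V n G)" by (simp add: vmode_modep VSp_def)
  thus ?thesis by (simp only: mk_in_VS VSp_modep[OF s *(3,4)])
qed

lemma pt_VS: "s = 1 \<or> s = 2 \<Longrightarrow> Ws s r g \<Longrightarrow> even (s * int r) \<Longrightarrow> mk (pt (s * int r) g) \<in> VS s"
  unfolding mk_in_VS VSp_def
proof (intro conjI allI impI)
  assume s: "s = 1 \<or> s = 2" and g: "Ws s r g" and "even (s * int r)"
  show "good (pt (s * int r) g)" by (rule good_pt) fact
  show "pt (s * int r) g m = 0" if "m < 0" for m using s that by (auto simp: pt_def)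
  show "Ws s (nat (m div s)) (pt (s * int r) g m)" if "m \<ge> 0" for m
    using s g by (auto simp: pt_def Ws_0)
qed

lemma vacuum_VS: "s = 1 \<or> s = 2 \<Longrightarrow> vacuum \<in> VS s"
  using pt_VS[of s 0 1] Ws_sc[of s 1] by (simp add: vacuum_mk)

lemma e_alpha_mk: "e_alpha = mk (pt 2 1)"
  by (simp add: e_alpha_def delta_mk)

text \<open>\<open>VS 2\<close> is a subalgebra containing e^alpha. An upper bound for W is enough:
  what commutes with the larger space commutes with W.\<close>

lemma Wsub_subset: "Wsub \<subseteq> VS 2"
proof -
  have "e_alpha \<in> VS 2"
    using pt_VS[of 2 1 1] Ws_Suc[OF Ws_sc[of 2 1]] by (simp add: e_alpha_mk)
  moreover have "vsubalg (VS 2)"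
    unfolding vsubalg_def using VS_subset_VA1 lspan_minimal[OF vsub_VS order_refl] vacuum_VS VS_vmode by blast
  ultimately show ?thesis by (auto simp: Wsub_def)
qed

lemma modep_commute:
  assumes U: "VSp 2 U" and V: "VSp 1 V" and G: "good G"
  shows "modep U n (modep V n' G) = modep V n' (modep U n G)"
proof
  fix M
  have "modep U n (modep V n' G) M =
     (\<Sum>j\<in>chs U. \<Sum>i\<in>chs V. prodn n j (M - j) (U j) (prodn n' i (M - j - i) (V i) (G (M - j - i))))"
    by (simp add: modep_def prodnD_right(6))
  also have "\<dots> = (\<Sum>j\<in>chs U. \<Sum>i\<in>chs V. prodn n' i (M - i) (V i) (prodn n j (M - i - j) (U j) (G (M - i - j))))"
  proof (intro sum.cong refl)
    fix j i assume j: "j \<in> chs U" and i: "i \<in> chs V"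
    define m where "m = M - j - i"
    have eqs: "M - j = m + i" "M - i - j = m" "M - i = m + j" "M - j - i = m" by (auto simp: m_def)
    show "prodn n j (M - j) (U j) (prodn n' i (M - j - i) (V i) (G (M - j - i))) =
       prodn n' i (M - i) (V i) (prodn n j (M - i - j) (U j) (G (M - i - j)))"
    proof (cases "even m")
      case False
      hence "G m = 0" using G by (simp add: good_def)
      thus ?thesis unfolding eqs by (simp add: prodn_0_right)
    next
      case True
      have jp: "j \<ge> 0" "even j" using j VSp_nonzero[OF U, of j] by auto
      have ip: "i \<ge> 0" "even i" using i VSp_nonzero[OF V, of i] by auto
      define r i' where "r = nat (j div 2)" and "i' = nat i"
      have r: "j = 2 * int r" "i = int i'" using jp ip by (auto simp: r_def i'_def)
      have w: "Ws 2 r (U j)" "Ws 1 i' (V i)" using U V jp ip by (auto simp: VSp_def r_def i'_def)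
      have "even i'" using ip r by simp
      from prodn_commute[OF True this w] show ?thesis
        unfolding eqs r[symmetric] by simp
    qed
  qed
  also have "\<dots> = modep V n' (modep U n G) M"
    by (subst sum.swap) (simp add: modep_def prodnD_right(6))
  finally show "modep U n (modep V n' G) M = modep V n' (modep U n G) M" .
qed

lemma VS_subset_Ccomm: "VS 1 \<subseteq> Ccomm"
proof
  fix v assume v: "v \<in> VS 1"
  then obtain V where V: "v = mk V" "VSp 1 V" by (auto simp: VS_def)
  have "vmode u n (vmode v m w) = vmode v m (vmode u n w)" if "u \<in> Wsub" "w \<in> VA1" for u n m w
  proof -
    from that Wsub_subset obtain U where U: "u = mk U" "VSp 2 U" by (auto simp: VS_def)
    from that obtain G where G: "w = mk G" "good G" by (auto simp: VA1_eq)
    have g: "good U" "good V" using U V by (auto simp: VSp_def)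
    show ?thesis
      by (simp add: U(1) V(1) G(1) vmode_modep g G(2) good_modep modep_commute[OF U(2) V(2) G(2)])
  qed
  moreover have "v \<in> VA1" using v VS_subset_VA1 by blast
  ultimately show "v \<in> Ccomm" by (simp add: Ccomm_def)
qed

text \<open>The creation property. On the vacuum all terms with \<open>heis\<close> vanish,
  including the zero mode, so that only power series are multiplied; each constant term contributes
  its variable.\<close>

lemma creation_NM:
  "(\<forall>n<0. fls_nth (NM 0 p (bop j 0) 1) n = 0) \<and> fls_nth (NM 0 p (bop j 0) 1) 0 = single p 1"
proof (induction "tdeg p" arbitrary: p)
  case 0
  hence "p = 0" using tdeg_minus_sg[OF lookup_Min_keys, of p] by fastforce
  thus ?case by (simp add: bop_def vop_def gop_def Kser_nonneg Kser_nth_0)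
next
  case (Suc n)
  hence p: "p \<noteq> 0" by auto
  define i where "i = Min (keys p)"
  define w where "w = p - sg i"
  have pw: "w + sg i = p" unfolding w_def i_def by (rule minus_sg_add_sg[OF lookup_Min_keys[OF p]])
  have "n = tdeg w" using Suc tdeg_add_sg[of w i] by (simp add: pw)
  note IH = Suc.hyps(1)[OF this]
  define F where "F = NM 0 w (bop j 0)"
  have lF: "linF F" unfolding F_def by (intro linF_NM linF_bop)
  have e: "NM 0 p (bop j 0) 1 = hasse i Aser * F 1"
    unfolding NM_rec[OF p i_def] w_def[symmetric] F_def[symmetric] Nop_def gop_def
    by (simp add: heis_1 linFD(3)[OF lF])
  have A0: "fls_nth (hasse i Aser) a = 0" if "a < 0" for a
    by (rule hasse_low[OF _ that]) (simp add: Aser_def)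
  have nth: "fls_nth (NM 0 p (bop j 0) 1) n = (\<Sum>a\<in>{0..n - 0}. fls_nth (hasse i Aser) a * fls_nth (F 1) (n - a))" for n
    unfolding e by (rule fls_times_nth_bounds) (use A0 IH in \<open>auto simp: F_def simp del: hasse_nth\<close>)
  have "fls_nth (hasse i Aser) 0 = pvar i" by (simp add: Aser_def flip: binomial_gbinomial)
  thus ?case
    unfolding nth using IH by (simp add: F_def pvar_mult_single pw del: hasse_nth)
qed

lemma prodn_creation: "prodn (- 1) j 0 f 1 = f"
proof (rule linop_eqI[of "\<lambda>f. prodn (- 1) j 0 f 1" "\<lambda>f. f"])
  show "linop (\<lambda>f. prodn (- 1) j 0 f 1)" by (rule linop_prodn_left)
  show "linop (\<lambda>f. f)" by (rule linop_id)
  show "prodn (- 1) j 0 (single p 1) 1 = single p 1" for p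
    using creation_NM[of p j] by (simp add: prodn_def NA_single)
qed

lemma vmode_creation: "good V \<Longrightarrow> vmode (mk V) (- 1) vacuum = mk V"
proof -
  assume V: "good V"
  have fin: "finite (chs V)" using V by (simp add: good_def)
  have "modep V (- 1) (pt 0 1) M = V M" for M
  proof -
    have "modep V (- 1) (pt 0 1) M = (\<Sum>j\<in>chs V. if j = M then V M else 0)"
      unfolding modep_def by (intro sum.cong refl) (auto simp: pt_def prodn_creation prodn_0_right)
    thus ?thesis using fin by auto
  qed
  hence "modep V (- 1) (pt 0 1) = V" by (rule ext)
  thus ?thesis using V by (simp add: vacuum_mk vmode_modep good_pt)
qed

lemma Hser_0: "Hser 0 = 1"
  by (rule Hser_unique[symmetric]) auto

text \<open>Multiplication by the power series \<open>Hser (- 2)\<close> strips off the creation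
  part without introducing poles. What remains is z^m times the annihilation part, in which
  \<open>Ep 2 c g\<close> is the coefficient of z^(m - c).\<close>

lemma bop_regular_imp:
  assumes "\<And>a. a < 0 \<Longrightarrow> fls_nth (bop 2 m g) a = 0" and "int c > m"
  shows "Ep 2 c g = 0"
proof (cases "c \<le> wt g")
  case True
  define T where "T = (\<Sum>d\<le>wt g. Xp (m - int d) * fls_const (Ep 2 d g))"
  have "bop 2 m g = Hser 2 * T"
    unfolding bop_def vop_def gop_def T_def Kser_def sum_distrib_left by (simp add: mult_ac)
  hence "Hser (- 2) * bop 2 m g = (Hser (-2) * Hser 2) * T" by (simp only: mult.assoc)
  hence T: "Hser (- 2) * bop 2 m g = T" by (simp only: Hser_add) (simp add: Hser_0)
  have "fls_nth T (m - int c) = (\<Sum>i\<in>{0..(m - int c) - 0}. fls_nth (Hser (-2)) i * fls_nth (bop 2 m g) (m - int c - i))"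
    unfolding T[symmetric] by (rule fls_times_nth_bounds) (use assms in auto)
  hence "fls_nth T (m - int c) = 0" using assms(2) by simp
  moreover have "fls_nth T (m - int c) = (\<Sum>d\<le>wt g. if d = c then Ep 2 c g else 0)"
    unfolding T_def fls_nth_sum fls_X_intpow_times_conv_shift(1) by (intro sum.cong refl) auto
  ultimately show ?thesis using True by simp
next
  case False
  thus ?thesis by (intro Ep_eq_0[OF wle_wt]) auto
qed

lemma vmode_e_alpha: "good G \<Longrightarrow> vmode e_alpha n (mk G) = mk (\<lambda>M. fls_nth (bop 2 (M - 2) (G (M - 2))) (- n - 1))"
proof -
  assume G: "good G"
  have "chs (pt 2 1) = {2}" by (auto simp: pt_def)
  thus ?thesis
    using G by (simp add: e_alpha_mk vmode_modep good_pt modep_def [abs_def] prodn_def)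
qed

text \<open>Since v = v(-1) 1, commutation on the vacuum gives e^alpha(n) v = v(-1) e^alpha(n) 1 = 0
  for n >= 0; the kernel lemma then bounds the degree.\<close>

lemma Ccomm_subset_VS: "Ccomm \<subseteq> VS 1"
proof
  fix v assume v: "v \<in> Ccomm"
  hence "v \<in> VA1" by (simp add: Ccomm_def)
  then obtain V where V: "v = mk V" "good V" by (auto simp: VA1_eq)
  have eW: "e_alpha \<in> Wsub" by (simp add: Wsub_def)
  have vac: "vacuum \<in> VA1" by (simp add: vacuum_mk mk_in_VA1 good_pt)
  have kill: "fls_nth (bop 2 m (V m)) (- n - 1) = 0" if "n \<ge> 0" for m n
  proof -
    have "vmode e_alpha n vacuum = mk (\<lambda>m. 0)"
    proof -
      have "fls_nth (bop 2 (M - 2) (pt 0 1 (M - 2))) (- n - 1) = 0" for M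
      proof (cases "M = 2")
        case True
        thus ?thesis using creation_NM[of 0 2] that by simp
      next
        case False
        thus ?thesis by (simp add: pt_def linFD(3)[OF linF_bop])
      qed
      thus ?thesis by (simp add: vacuum_mk vmode_e_alpha good_pt)
    qed
    moreover have "vmode e_alpha n (vmode v (- 1) vacuum) = vmode v (- 1) (vmode e_alpha n vacuum)"
      using v eW vac by (simp add: Ccomm_def)
    moreover have "vmode v (- 1) (mk (\<lambda>m. 0)) = mk (\<lambda>m. 0)"
      by (simp add: V vmode_modep good_0 modep_def [abs_def] prodn_0_right)
    ultimately have "vmode e_alpha n (mk V) = mk (\<lambda>m. 0)"
      by (simp add: V vmode_creation)
    hence "(\<lambda>M. fls_nth (bop 2 (M - 2) (V (M - 2))) (- n - 1)) = (\<lambda>m. 0)"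
      by (simp add: vmode_e_alpha V)
    from fun_cong[OF this, of "m + 2"] show ?thesis by simp
  qed
  have reg: "fls_nth (bop 2 m (V m)) a = 0" if "a < 0" for a m
    using kill[of "- a - 1" m] that by simp
  have "VSp 1 V"
    unfolding VSp_def
  proof (intro conjI allI impI)
    \<comment> \<open>For negative m already c = 0 exceeds m, and \<open>Ep 2 0\<close> is the
      identity.\<close>
    show "V m = 0" if "m < 0" for m
      using bop_regular_imp[of m "V m" 0, OF reg] that by simp
    show "Ws 1 (nat (m div 1)) (V m)" if "m \<ge> 0" for m
      using Ep_kernel[of "nat m" "V m"] bop_regular_imp[of m "V m", OF reg] that by simp
  qed (rule V(2))
  thus "v \<in> VS 1" by (simp add: V mk_in_VS)
qed

lemma Ccomm_eq: "Ccomm = VS 1"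
  using VS_subset_Ccomm Ccomm_subset_VS by blast

section \<open>Generators\<close>

lemma Ep_Hs_1: "Ep 1 b (Hs 1 n) = (if b \<le> n then sc (kap (1/2) b) * Hs 1 (n - b) else 0)"
proof -
  have "EZ 1 (int b) (HZ 1 (int n) * 1) =
      (\<Sum>i\<le>n. sc (kap (1/2) i) * (HZ 1 (int n - int i) * EZ 1 (int b - int i) 1))"
    using EZ_HZ[of "int n" n 1 "int b" 1 1] by simp
  also have "\<dots> = (\<Sum>i\<le>n. if i = b then sc (kap (1/2) b) * HZ 1 (int n - int b) else 0)"
    by (intro sum.cong refl) (auto simp: EZ_def Ep_1)
  finally show ?thesis by (auto simp: of_nat_diff[symmetric] simp del: of_nat_diff)
qed

lemma phi_mk: "phi n = mk (pt 2 (phipol n))"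
proof -
  have chs: "finite (chs (pt m g))" for m g
    by (rule finite_subset[of _ "{m}"]) (auto simp: pt_def)
  have lift: "emode 1 N (mk (pt m g)) = mk (pt (m + 1) (EM 1 N m g))" for N m g
    by (subst emode_mk[OF chs]) (auto simp: pt_def fun_eq_iff linopD(3)[OF linop_EM])
  have 1: "EM 1 (- 2 * int n - 2) 0 1 = Hs 1 n"
    by (simp add: EM_def Let_def)
  \<comment> \<open>The bound is enlarged by n so as to cover the range of
    \<open>phipol\<close>.\<close>
  have D: "wle (int (wt (Hs 1 n) + n)) (Hs 1 n)" by (rule wle_mono[OF wle_wt]) simp
  have "EM 1 (- 2 * int n - 3) 1 (Hs 1 n) = (\<Sum>b\<le>wt (Hs 1 n) + n. Hs 1 (n + b) * Ep 1 b (Hs 1 n))"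
    unfolding EM_eq[OF D]
  proof (intro sum.cong refl)
    fix b
    \<comment> \<open>The exponent 1/2 from z^(varpi(0)) on charge 1 matches the half-integral mode
      index, so the creation index n + b is integral.\<close>
    have "2 * int b - 1 * 1 - (- 2 * int n - 3) - 2 = 2 * int (n + b)" by simp
    thus "(let a2 = 2 * int b - 1 * 1 - (- 2 * int n - 3) - 2 in
       if even a2 \<and> 0 \<le> a2 then Hs 1 (nat (a2 div 2)) * Ep 1 b (Hs 1 n) else 0) = Hs 1 (n + b) * Ep 1 b (Hs 1 n)"
      by (simp only: Let_def) (simp add: nat_int_add)
  qed
  also have "\<dots> = (\<Sum>b\<le>n. Hs 1 (n + b) * Ep 1 b (Hs 1 n))"
    by (rule sum_atMost_extend) (auto simp: Ep_Hs_1)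
  also have "\<dots> = phipol n"
    unfolding phipol_def by (intro sum.cong refl) (auto simp: Ep_Hs_1 mult_ac)
  finally have 2: "EM 1 (- 2 * int n - 3) 1 (Hs 1 n) = phipol n" .
  show ?thesis
    unfolding phi_def vacuum_mk lift 1 by (simp only: add_0 lift 2) simp
qed

lemma Ws_phipol: "Ws 1 2 (phipol n)"
proof -
  have "Ws 1 2 (Hs 1 a * Hs 1 b)" for a b
    using Ws_word[of 1 "[a, b]"] by (simp add: numeral_2_eq_2)
  thus ?thesis unfolding phipol_def by (intro Ws_sum Ws_scale)
qed

lemma phi_VS: "phi n \<in> VS 1"
  using pt_VS[of 1 2 "phipol n"] Ws_phipol by (simp add: phi_mk)

lemma mono_apply_VS: "\<forall>(a, n)\<in>set l. a \<in> range phi \<Longrightarrow> mono_apply l \<in> VS 1"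
proof (induction l)
  case Nil
  thus ?case by (simp add: mono_apply_def vacuum_VS)
next
  case (Cons x l)
  obtain a n where x: "x = (a, n)" by (cases x)
  have "vmode a n (mono_apply l) \<in> VS 1"
    using Cons x phi_VS by (intro VS_vmode) auto
  thus ?case by (simp add: mono_apply_def x)
qed

lemma pt_linear:
  "mk (pt j (f + g)) = (\<lambda>k. mk (pt j f) k + mk (pt j g) k)"
  "mk (pt j (sc c * f)) = (\<lambda>k. c * mk (pt j f) k)"
  "mk (pt j 0) = (\<lambda>k. 0)"
  by (auto simp: pt_def fun_eq_iff lookup_add)

lemma psub_pt: "vsub U \<Longrightarrow> psub (\<lambda>g. mk (pt j g) \<in> U)"
  unfolding psub_def pt_linear using vsubD by blast

section \<open>Strong generation\<close>

definition strong_monos :: "vec set" where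
  "strong_monos = {mono_apply l | l. \<forall>(a, n)\<in>set l. a \<in> range phi \<and> n \<le> -1}"

lemma vmode_linear:
  assumes "good V" "v \<in> VA1" "w \<in> VA1"
  shows "vmode (mk V) n (\<lambda>k. v k + w k) = (\<lambda>k. vmode (mk V) n v k + vmode (mk V) n w k)"
    "vmode (mk V) n (\<lambda>k. c * v k) = (\<lambda>k. c * vmode (mk V) n v k)"
proof -
  obtain F G where *: "v = mk F" "w = mk G" "good F" "good G" using assms by (auto simp: VA1_eq)
  note vm = vmode_modep[OF assms(1)]
  have "modep V n (\<lambda>m. F m + G m) = (\<lambda>M. modep V n F M + modep V n G M)"
    by (simp add: modep_def fun_eq_iff prodnD_right(1) sum.distrib)
  thus "vmode (mk V) n (\<lambda>k. v k + w k) = (\<lambda>k. vmode (mk V) n v k + vmode (mk V) n w k)"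
    by (simp only: *(1,2) mk_add[symmetric] vm[OF good_add[OF *(3,4)]] vm[OF *(3)] vm[OF *(4)])
  have "modep V n (\<lambda>m. sc c * F m) = (\<lambda>M. sc c * modep V n F M)"
    by (simp add: modep_def fun_eq_iff prodnD_right(2) sum_distrib_left)
  thus "vmode (mk V) n (\<lambda>k. c * v k) = (\<lambda>k. c * vmode (mk V) n v k)"
    by (simp only: *(1) mk_scale[symmetric] vm[OF good_scale[OF *(3)]] vm[OF *(3)])
qed

lemma vmode_zero: "good V \<Longrightarrow> vmode (mk V) n (\<lambda>k. 0) = (\<lambda>k. 0)"
  unfolding mk_0[symmetric] by (simp add: vmode_modep good_0 modep_def [abs_def] prodn_0_right)

lemma strong_monos_VA1: "lspan strong_monos \<subseteq> VA1"
proof (rule lspan_minimal[OF vsub_VA1])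
  show "strong_monos \<subseteq> VA1"
    unfolding strong_monos_def using mono_apply_VS VS_subset_VA1 by (fastforce simp: case_prod_unfold)
qed

text \<open>Prefixing such a mode keeps a monomial strong. The passage to the span uses linearity of
  the mode, which \<open>vmode_linear\<close> gives inside \<open>VA1\<close>; hence that condition
  in \<open>U\<close>.\<close>

lemma phi_mode_strong:
  assumes "n \<le> -1" "w \<in> lspan strong_monos"
  shows "vmode (phi i) n w \<in> lspan strong_monos"
proof -
  define U where "U = {w \<in> VA1. vmode (phi i) n w \<in> lspan strong_monos}"
  have g: "good (pt 2 (phipol i))" by (simp add: good_pt)
  have "vsub U"
    unfolding vsub_def U_def phi_mk
    by (auto simp: vmode_linear[OF g] vmode_zero[OF g] vsubD[OF vsub_VA1] intro: vsubD[OF vsub_lspan])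
  moreover have "strong_monos \<subseteq> U"
  proof
    fix x assume x: "x \<in> strong_monos"
    then obtain l where l: "x = mono_apply l" "\<forall>(a, n)\<in>set l. a \<in> range phi \<and> n \<le> -1"
      by (auto simp: strong_monos_def)
    have "vmode (phi i) n x = mono_apply ((phi i, n) # l)" by (simp add: mono_apply_def l(1))
    moreover have "mono_apply ((phi i, n) # l) \<in> strong_monos"
      unfolding strong_monos_def using l(2) assms(1) by (intro CollectI exI[of _ "(phi i, n) # l"]) auto
    ultimately have "vmode (phi i) n x \<in> lspan strong_monos" using lspan_superset by auto
    moreover have "x \<in> VA1" using x lspan_superset strong_monos_VA1 by blast
    ultimately show "x \<in> U" by (simp add: U_def)
  qed
  ultimately show ?thesis using lspan_minimal[of U strong_monos] assms(2) by (auto simp: U_def)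
qed

lemma Wd_0_const: "Wd s t N x \<Longrightarrow> t = 0 \<Longrightarrow> \<exists>c. x = sc c"
proof (induction rule: Wd.induct)
  case (add t N x y)
  then obtain c d where "x = sc c" "y = sc d" by blast
  thus ?case by (intro exI[of _ "c + d"]) simp
qed auto

lemma strong_span: "Ws 1 (2 * r) g \<Longrightarrow> mk (pt (2 * int r) g) \<in> lspan strong_monos"
proof (induction r arbitrary: g)
  case 0
  then obtain c where c: "g = sc c * 1" using Wd_0_const[of 1 0 _ g] by (auto simp: Ws_def)
  have "vacuum \<in> strong_monos"
    unfolding strong_monos_def by (intro CollectI exI[of _ "[]"]) (auto simp: mono_apply_def)
  hence "mk (pt 0 1) \<in> lspan strong_monos" using lspan_superset by (auto simp: vacuum_mk)
  from vsubD(3)[OF vsub_lspan this, of c] show ?case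
    unfolding c pt_linear(2)[symmetric] by simp
next
  case (Suc r)
  define S where "S = (\<lambda>g. mk (pt (2 * int (Suc r)) g) \<in> lspan strong_monos)"
  have S: "psub S" unfolding S_def by (intro psub_pt vsub_lspan)
  \<comment> \<open>For fixed x, the coefficients of z^k in the fields of h_a h_b e^alpha satisfy
    the hypotheses of \<open>span_generators\<close>. Natural numbers k correspond exactly to the
    modes of index at most -1.\<close>
  have pair: "S (fls_nth (wop 1 (2 * int r) (plain [a, b]) x) (int k))" if "Wd 1 (2 * r) N x" for N a b x k
  proof (rule span_generators[OF S, where X = "\<lambda>a b k. fls_nth (wop 1 (2 * int r) (plain [a, b]) x) (int k)"])
    show "fls_nth (wop 1 (2 * int r) (plain [a, b]) x) (int k) = fls_nth (wop 1 (2 * int r) (plain [b, a]) x) (int k)" for a b k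
      by (simp only: wop2_sym[of "2 * int r" a b x] even_mult_iff even_numeral simp_thms)
    show "of_nat (Suc k) * fls_nth (wop 1 (2 * int r) (plain [a, b]) x) (int (Suc k)) =
       of_nat (Suc a) * fls_nth (wop 1 (2 * int r) (plain [Suc a, b]) x) (int k) +
       of_nat (Suc b) * fls_nth (wop 1 (2 * int r) (plain [a, Suc b]) x) (int k)" for a b k
    proof -
      have "int (Suc k) = int k + 1" "(of_nat (Suc k) :: pol) = of_int (int k + 1)" by simp_all
      thus ?thesis by (simp only: deriv_wop2_nth)
    qed
    fix n k
    have x: "mk (pt (2 * int r) x) \<in> lspan strong_monos"
      using that by (intro Suc.IH) (auto simp: Ws_def)
    have "vmode (phi n) (- int k - 1) (mk (pt (2 * int r) x)) \<in> lspan strong_monos"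
      by (rule phi_mode_strong[OF _ x]) simp
    hence "S (prodn (- int k - 1) 2 (2 * int r) (phipol n) x)"
      by (simp add: phi_mk vmode_pt S_def add.commute)
    thus "S (\<Sum>l\<le>n. sc (kap (1/2) l) * fls_nth (wop 1 (2 * int r) (plain [n + l, n - l]) x) (int k))"
      by (subst (asm) prodn_phipol) simp_all
  qed
  have lead: "S (Hs 1 c * (Hs 1 d * x))" if "Wd 1 (2 * r) N x" for N x c d
    using pair_leading_term[OF S _ that] pair[where k = 0] by simp
  from Suc.prems have "Ws 1 (Suc (Suc (2 * r))) g" by simp
  hence "S g"
  proof (induction rule: Ws_induct)
    case (word ks)
    then obtain c d ls where ks: "ks = c # d # ls" "length ls = 2 * r"
      by (auto simp: length_Suc_conv)
    obtain N where "Wd 1 (2 * r) N (prod_list (map (Hs 1) ls))"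
      using Ws_word[of 1 ls] ks(2) by (auto simp: Ws_def)
    from lead[OF this] show ?case by (simp add: ks(1))
  qed (auto intro: psubD[OF S])
  thus ?case by (simp add: S_def)
qed

lemma VS_subset_strong: "VS 1 \<subseteq> lspan strong_monos"
proof
  fix v assume "v \<in> VS 1"
  then obtain V where V: "v = mk V" "VSp 1 V" by (auto simp: VS_def)
  have fin: "finite (chs V)" using V by (simp add: VSp_def good_def)
  have "mk V = (\<lambda>k. \<Sum>m\<in>chs V. mk (pt m (V m)) k)"
  proof (rule ext, clarify)
    fix M q
    have "(\<Sum>m\<in>chs V. mk (pt m (V m)) (M, q)) = (\<Sum>m\<in>chs V. if m = M then lookup (V M) q else 0)"
      by (intro sum.cong refl) (auto simp: pt_def)
    thus "mk V (M, q) = (\<Sum>m\<in>chs V. mk (pt m (V m)) (M, q))" using fin by auto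
  qed
  also have "\<dots> \<in> lspan strong_monos"
  proof (rule vsub_sum[OF vsub_lspan])
    fix m assume m: "m \<in> chs V"
    hence "m \<ge> 0" "even m" using VSp_nonzero[OF V(2), of m] by auto
    then obtain r where r: "m = 2 * int r" by (metis evenE nonneg_int_cases zero_le_mult_iff zero_less_numeral not_less)
    have "Ws 1 (nat m) (V m)" using V \<open>m \<ge> 0\<close> by (simp add: VSp_def)
    hence "Ws 1 (2 * r) (V m)" by (simp add: r nat_mult_distrib)
    from strong_span[OF this] show "mk (pt m (V m)) \<in> lspan strong_monos" by (simp only: r)
  qed
  finally show "v \<in> lspan strong_monos" by (simp only: V)
qed

lemma strongly_generates_phi: "strongly_generates (range phi) Ccomm"
proof -
  have "lspan strong_monos \<subseteq> VS 1"
    by (rule lspan_minimal[OF vsub_VS])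
       (use mono_apply_VS in \<open>fastforce simp: strong_monos_def case_prod_unfold\<close>)
  hence "lspan strong_monos = Ccomm" using VS_subset_strong by (auto simp: Ccomm_eq)
  thus ?thesis by (simp only: strongly_generates_def strong_monos_def)
qed

section \<open>Minimality\<close>

lemma mono_apply_pt:
  assumes "\<forall>(a, n)\<in>set l. a \<in> range phi"
  shows "\<exists>x. mono_apply l = mk (pt (2 * int (length l)) x)"
  using assms
proof (induction l)
  case Nil
  show ?case by (intro exI[of _ 1]) (simp add: mono_apply_def vacuum_mk)
next
  case (Cons y l)
  obtain i n where y: "y = (phi i, n)" using Cons.prems by (cases y) auto
  obtain x where "mono_apply l = mk (pt (2 * int (length l)) x)" using Cons by auto
  hence "mono_apply (y # l) = mk (pt (2 * int (length (y # l))) (prodn n 2 (2 * int (length l)) (phipol i) x))"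
    by (simp add: mono_apply_def y phi_mk vmode_pt algebra_simps)
  thus ?case by blast
qed

text \<open>Each letter contributes charge 2 (\<open>mono_apply_pt\<close>), so the component of
  charge 2 isolates the monomials with one letter, and to those \<open>psi_prodn_phipol\<close>
  applies.\<close>

lemma psi_mono_apply:
  assumes "\<forall>(a, n)\<in>set l. a \<in> range phi - {phi i}"
  shows "psi i (cmp 2 (mono_apply l)) = 0"
proof (cases "length l = 1")
  case True
  then obtain a n where l: "l = [(a, n)]" by (metis length_0_conv length_Suc_conv One_nat_def surj_pair)
  then obtain k where k: "a = phi k" "k \<noteq> i" using assms by auto
  have "mono_apply l = mk (pt 2 (prodn n 2 0 (phipol k) 1))"
    by (simp add: l k mono_apply_def phi_mk vacuum_mk vmode_pt)
  thus ?thesis by (simp add: psi_prodn_phipol[OF k(2)])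
next
  case False
  obtain x where "mono_apply l = mk (pt (2 * int (length l)) x)"
    using mono_apply_pt[of l] assms by fastforce
  thus ?thesis using False by (simp add: pt_def psi_0)
qed

lemma not_generates:
  assumes "T \<subset> range phi"
  shows "\<not> generates T Ccomm"
proof
  assume gen: "generates T Ccomm"
  from assms obtain i where i: "phi i \<notin> T" by blast
  define X where "X = {mono_apply l | l. \<forall>(a, n)\<in>set l. a \<in> T}"
  \<comment> \<open>A subspace that contains every monomial in T but not phi_i.\<close>
  define U where "U = {v \<in> VA1. psi i (cmp 2 v) = 0}"
  have "vsub U"
    unfolding vsub_def
  proof (intro conjI ballI allI)
    show "(\<lambda>k. 0) \<in> U" using vsubD(1)[OF vsub_VA1] by (simp add: U_def psi_0 flip: mk_0)
  next
    fix v w assume "v \<in> U" "w \<in> U"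
    thus "(\<lambda>k. v k + w k) \<in> U"
      using vsubD(2)[OF vsub_VA1, of v w] by (auto simp: U_def VA1_eq psi_add simp flip: mk_add)
  next
    fix c v assume "v \<in> U"
    thus "(\<lambda>k. c * v k) \<in> U"
      using vsubD(3)[OF vsub_VA1, of v c] by (auto simp: U_def VA1_eq psi_scale simp flip: mk_scale)
  qed
  moreover have "X \<subseteq> U"
  proof
    fix x assume "x \<in> X"
    then obtain l where l: "x = mono_apply l" "\<forall>(a, n)\<in>set l. a \<in> T" by (auto simp: X_def)
    have "\<forall>(a, n)\<in>set l. a \<in> range phi - {phi i}" using l(2) assms i by auto
    moreover from this have "x \<in> VA1" using mono_apply_VS[of l] VS_subset_VA1 l(1) by auto
    ultimately show "x \<in> U" using psi_mono_apply by (simp add: U_def l(1))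
  qed
  ultimately have "lspan X \<subseteq> U" by (rule lspan_minimal)
  moreover have "phi i \<in> lspan X"
    using gen phi_VS[of i] by (simp add: generates_def X_def Ccomm_eq)
  ultimately have "psi i (phipol i) = 0" by (auto simp: U_def phi_mk)
  thus False using phiwt_nonzero by (simp add: psi_phipol)
qed

theorem theorem3p1:
  shows "range phi \<subseteq> Ccomm \<and> strongly_generates (range phi) Ccomm \<and>
         (\<forall>T. T \<subset> range phi \<longrightarrow> \<not> generates T Ccomm)"
  using phi_VS strongly_generates_phi not_generates by (auto simp: Ccomm_eq)

end
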